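(* The group $2V$ is presented, as a group, by the generating set $\{A_i,B_i,\pi_i,\overline{\pi}_i\mid i\in\{0,1\}\}$ and the following 70 relations, where the remaining symbols are abbreviations: for $i\ge2$ $$A_i=A_0^{1-i}A_1A_0^{i-1},\quad B_i=A_0^{1-i}B_1A_0^{i-1},\quad \pi_i=A_0^{1-i}\pi_1A_0^{i-1},\quad \overline{\pi}_i=A_0^{1-i}\,\overline{\pi}_1A_0^{i-1},$$ and for $m\ge0$, $C_m=(\overline{\pi}_mB_m\overline{\pi}_{m+1}\pi_m)(B_m\pi_{m+1}A_m^{-1})$. First, 40 relations: $A_2A_1=A_1A_3$, $A_3A_1=A_1A_4$, $B_2A_1=A_1B_3$, $B_3A_1=A_1B_4$, $A_1B_0=B_0A_2$, $A_2B_0=B_0A_3$, $A_2B_1=B_1A_3$, $A_3B_1=B_1A_4$, $B_1B_0=B_0B_2$, $B_2B_0=B_0B_3$, $B_2B_1=B_1B_3$, $B_3B_1=B_1B_4$, $\pi_0A_2=A_2\pi_0$, $\pi_0A_3=A_3\pi_0$, $\pi_1A_3=A_3\pi_1$, $\pi_1A_4=A_4\pi_1$, $\pi_0B_2=B_2\pi_0$, $\pi_0B_3=B_3\pi_0$, $\pi_1B_3=B_3\pi_1$, $\pi_1B_4=B_4\pi_1$, $\pi_0A_0=A_1\pi_0\pi_1$, $\pi_1A_1=A_2\pi_1\pi_2$, $\pi_0B_0=B_1\pi_0\pi_1$, $\pi_1B_1=B_2\pi_1\pi_2$, $\pi_1B_0=B_0\pi_2$, $\pi_2B_0=B_0\pi_3$,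 $\pi_2B_1=B_1\pi_3$, $\pi_3B_1=B_1\pi_4$, $\pi_2A_1=A_1\pi_3$, $\pi_3A_1=A_1\pi_4$, $\pi_0^2=1$, $\pi_1^2=1$, $\pi_0\pi_2=\pi_2\pi_0$, $\pi_0\pi_3=\pi_3\pi_0$, $\pi_1\pi_3=\pi_3\pi_1$, $\pi_1\pi_4=\pi_4\pi_1$, $\pi_0\pi_1\pi_0=\pi_1\pi_0\pi_1$, $\pi_1\pi_2\pi_1=\pi_2\pi_1\pi_2$, $A_0B_1B_0=B_0A_1A_0\pi_1$, $A_1B_2B_1=B_1A_2A_1\pi_2$. Second, 30 relations: $\overline{\pi}_2A_1=A_1\overline{\pi}_3$, $\overline{\pi}_3A_1=A_1\overline{\pi}_4$, $\overline{\pi}_1B_0=B_0\overline{\pi}_2$, $\overline{\pi}_2B_0=B_0\overline{\pi}_3$, $\overline{\pi}_2B_1=B_1\overline{\pi}_3$, $\overline{\pi}_3B_1=B_1\overline{\pi}_4$, $\overline{\pi}_0A_0=\pi_0\overline{\pi}_1$, $\overline{\pi}_1A_1=\pi_1\overline{\pi}_2$, $\overline{\pi}_0B_0=C_1\pi_0\overline{\pi}_1$, $\overline{\pi}_1B_1=C_2\pi_1\overline{\pi}_2$, $C_2A_1=A_1C_3$, $C_3A_1=A_1C_4$, $C_1B_0=B_0C_2$, $C_2B_0=B_0C_3$, $C_2B_1=B_1C_3$, $C_3B_1=B_1C_4$, $C_0A_0=B_0C_2\pi_1$, $C_1A_1=B_1C_3\pi_2$, $\overline{\pi}_0^{\,2}=1$,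 $\overline{\pi}_1^{\,2}=1$, $\pi_0C_2=C_2\pi_0$, $\pi_0C_3=C_3\pi_0$, $\pi_1C_3=C_3\pi_1$, $\pi_1C_4=C_4\pi_1$, $\pi_0\overline{\pi}_2=\overline{\pi}_2\pi_0$, $\pi_0\overline{\pi}_3=\overline{\pi}_3\pi_0$, $\pi_1\overline{\pi}_3=\overline{\pi}_3\pi_1$, $\pi_1\overline{\pi}_4=\overline{\pi}_4\pi_1$, $\pi_0\overline{\pi}_1\pi_0=\overline{\pi}_1\pi_0\overline{\pi}_1$, $\pi_1\overline{\pi}_2\pi_1=\overline{\pi}_2\pi_1\overline{\pi}_2$.
   Context: $\mathbb N=\{0,1,2,\dots\}$. For $i\in\mathbb N$ let $S_i=[2i,2i+1]\times[0,1]$. Let $C\subset[0,1]$ be the usual middle-thirds Cantor set and let $Y=\bigcup_{i\in\mathbb N}(2i+C)\times C$. The trivial pattern is $\{S_i\mid i\in\mathbb N\}$. A simple increment of a pattern replaces one rectangle $R$ of the pattern either by its (closed) left third and right third (vertical division) or by its (closed) bottom third and top third (horizontal division), leaving the other rectangles alone. A pattern is a set of rectangles obtainable from the trivial pattern by finitely many simple increments. A numbered pattern is a bijection from $\mathbb N$ to the rectangles of a pattern for which there are $j,k\in\mathbb N$ such that for every $i>k$ the square $S_i$ contains only one rectangle of the pattern and its number is $i+j$. A pair $(P,Q)$ of numbered patterns defines a homeomorphism of $Y$: for each $i$, it takes the intersection of $Y$ with the $i$-th rectangle of $Q$ onto the intersection of $Y$ with the $i$-th rectangle of $P$ by the unique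 affine map of the form $(x,y)\mapsto(a+3^jx,b+3^ky)$, $j,k\in\mathbb Z$, that does so. The group $\widehat{2V}$ is the set of all homeomorphisms of $Y$ obtained this way, under composition (acting on the left, composed right to left). Let $E$ be the trivial pattern with $S_i$ numbered $i$. A numbered pattern $P$ is identified with the element $(P,E)$ of $\widehat{2V}$; these elements form a submonoid, and for $P,Q$ in this submonoid $(P,Q)=PQ^{-1}$. The group $2V$ is the subgroup of $\widehat{2V}$ consisting of those elements that act as the identity off $Y\cap S_0$. Elements of $\widehat{2V}$, for $i\in\mathbb N$: $v_i$ is the numbered pattern in which $S_i$ is divided vertically, with left piece numbered $i$ and right piece numbered $i+1$, and every $S_j$ with $j\neq i$ is a single rectangle, numbered $j$ if $j<i$ and $j+1$ if $j>i$. $h_i$ is defined in the same way with $S_i$ divided horizontally, the bottom piece numbered $i$ and the top piece numbered $i+1$. $\sigma_i$ is the trivial pattern with $S_i$ numbered $i+1$, $S_{i+1}$ numbered $i$, and $S_j$ numbered $j$ for $j\notin\{i,i+1\}$. Elements of $2V$, for $i\ge0$ (with $(P,Q)=PQ^{-1}$): $A_i=(v_0^{i+1}v_1,\,v_0^{i+2})$, $B_i=(v_0^{i+1}h_1,\,v_0^{i+2})$, $C_i=(v_0^ih_0,\,v_0^{i+1})$, $\pi_i=(v_0^{i+2}\sigma_1,\,v_0^{i+2})$, $\overline{\pi}_i=(v_0^{i+1}\sigma_0,\,v_0^{i+1})$. (These elements satisfy the abbreviating formulas in the claim.) *)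

theory Defs
  imports Complex_Main "HOL-Algebra.Bij"
begin

text \<open>A word is a list of letters \<open>(x, e)\<close>, where \<open>(x, True)\<close> stands for the generator \<open>x\<close> and
  \<open>(x, False)\<close> for its formal inverse.  A relation \<open>l = r\<close> is the pair \<open>(l, r)\<close>.\<close>

type_synonym 'g word = "('g \<times> bool) list"

definition words :: "'g set \<Rightarrow> 'g word set"
  where "words X = lists (X \<times> UNIV)"

definition word_inv :: "'g word \<Rightarrow> 'g word"
  where "word_inv w = rev (map (\<lambda>(x, e). (x, \<not> e)) w)"

inductive_set word_cong :: "'g set \<Rightarrow> ('g word \<times> 'g word) set \<Rightarrow> ('g word \<times> 'g word) set"
  for X :: "'g set" and R :: "('g word \<times> 'g word) set"
  where
    refl: "w \<in> words X \<Longrightarrow> (w, w) \<in> word_cong X R"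
  | sym: "(u, v) \<in> word_cong X R \<Longrightarrow> (v, u) \<in> word_cong X R"
  | trans: "(u, v) \<in> word_cong X R \<Longrightarrow> (v, w) \<in> word_cong X R \<Longrightarrow> (u, w) \<in> word_cong X R"
  | cancel: "u \<in> words X \<Longrightarrow> v \<in> words X \<Longrightarrow> x \<in> X
      \<Longrightarrow> (u @ [(x, e), (x, \<not> e)] @ v, u @ v) \<in> word_cong X R"
  | relation: "u \<in> words X \<Longrightarrow> v \<in> words X \<Longrightarrow> (l, r) \<in> R
      \<Longrightarrow> (u @ l @ v, u @ r @ v) \<in> word_cong X R"

text \<open>The group \<open>\<langle>X | R\<rangle>\<close>: words modulo insertion and deletion of \<open>x x\<^sup>-\<^sup>1\<close>, \<open>x\<^sup>-\<^sup>1 x\<close> and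
  replacement of one side of a relation by the other.\<close>

definition presented_group :: "'g set \<Rightarrow> ('g word \<times> 'g word) set \<Rightarrow> 'g word set monoid"
  where "presented_group X R =
    \<lparr>carrier = words X // word_cong X R,
     mult = \<lambda>c d. \<Union>u\<in>c. \<Union>v\<in>d. word_cong X R `` {u @ v},
     one = word_cong X R `` {[]}\<rparr>"

text \<open>\<open>G\<close> is presented by generators \<open>\<phi> x\<close> (\<open>x \<in> X\<close>) and relations \<open>R\<close>: the assignment
  \<open>x \<mapsto> \<phi> x\<close> extends to an isomorphism \<open>\<langle>X | R\<rangle> \<rightarrow> G\<close>.\<close>

definition is_presentation ::
    "('a, 'b) monoid_scheme \<Rightarrow> 'g set \<Rightarrow> ('g \<Rightarrow> 'a) \<Rightarrow> ('g word \<times> 'g word) set \<Rightarrow> bool"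
  where "is_presentation G X \<phi> R \<longleftrightarrow>
    group G \<and> \<phi> \<in> X \<rightarrow> carrier G \<and> R \<subseteq> words X \<times> words X \<and>
    (\<exists>\<Phi> \<in> iso (presented_group X R) G. \<forall>x\<in>X. \<Phi> (word_cong X R `` {[(x, True)]}) = \<phi> x)"

type_synonym rect = "(real \<times> real) set"

definition unit_square :: "nat \<Rightarrow> rect"
  where "unit_square i = {2 * real i..2 * real i + 1} \<times> {0..1}"

definition left_third :: "real \<Rightarrow> real \<Rightarrow> real \<Rightarrow> real \<Rightarrow> rect"
  where "left_third a b c d = {a..a + (b - a) / 3} \<times> {c..d}"

definition right_third :: "real \<Rightarrow> real \<Rightarrow> real \<Rightarrow> real \<Rightarrow> rect"
  where "right_third a b c d = {b - (b - a) / 3..b} \<times> {c..d}"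

definition bottom_third :: "real \<Rightarrow> real \<Rightarrow> real \<Rightarrow> real \<Rightarrow> rect"
  where "bottom_third a b c d = {a..b} \<times> {c..c + (d - c) / 3}"

definition top_third :: "real \<Rightarrow> real \<Rightarrow> real \<Rightarrow> real \<Rightarrow> rect"
  where "top_third a b c d = {a..b} \<times> {d - (d - c) / 3..d}"

inductive is_pattern :: "rect set \<Rightarrow> bool"
  where
    trivial: "is_pattern (range unit_square)"
  | vertical: "is_pattern T \<Longrightarrow> {a..b} \<times> {c..d} \<in> T
      \<Longrightarrow> is_pattern (T - {{a..b} \<times> {c..d}} \<union> {left_third a b c d, right_third a b c d})"
  | horizontal: "is_pattern T \<Longrightarrow> {a..b} \<times> {c..d} \<in> T
      \<Longrightarrow> is_pattern (T - {{a..b} \<times> {c..d}} \<union> {bottom_third a b c d, top_third a b c d})"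

text \<open>\<open>P n\<close> is the rectangle with number \<open>n\<close>.\<close>

definition numbered_pattern :: "(nat \<Rightarrow> rect) \<Rightarrow> bool"
  where "numbered_pattern P \<longleftrightarrow>
    (\<exists>T. is_pattern T \<and> bij_betw P UNIV T) \<and>
    (\<exists>j k. \<forall>i>k. {n. P n \<subseteq> unit_square i} = {i + j})"

primrec cantor_stage :: "nat \<Rightarrow> real set"
  where
    "cantor_stage 0 = {0..1}"
  | "cantor_stage (Suc n) = (\<lambda>x. x / 3) ` cantor_stage n \<union> (\<lambda>x. (x + 2) / 3) ` cantor_stage n"

definition cantor_set :: "real set"
  where "cantor_set = (\<Inter>n. cantor_stage n)"

definition cantor_Y :: "(real \<times> real) set"
  where "cantor_Y = (\<Union>i. (\<lambda>x. 2 * real i + x) ` cantor_set \<times> cantor_set)"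

definition triadic_maps :: "(real \<times> real \<Rightarrow> real \<times> real) set"
  where "triadic_maps =
    {f. \<exists>a b (j::int) (k::int). f = (\<lambda>(x, y). (a + 3 powi j * x, b + 3 powi k * y))}"

text \<open>For numbered patterns \<open>P\<close> and \<open>Q\<close> exactly one function \<open>g\<close> satisfies the description
  below: the affine map on each rectangle is determined by the two images, and the sets
  \<open>cantor_Y \<inter> Q i\<close> partition \<open>cantor_Y\<close>.  The restriction to extensional functions only fixes a dummy value
  off \<open>cantor_Y\<close>, as in \<^const>\<open>BijGroup\<close>.\<close>

definition pattern_pair :: "(nat \<Rightarrow> rect) \<Rightarrow> (nat \<Rightarrow> rect) \<Rightarrow> real \<times> real \<Rightarrow> real \<times> real"
  where "pattern_pair P Q = (THE g. g \<in> extensional cantor_Y \<and>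
    (\<forall>i. \<exists>f\<in>triadic_maps. f ` (cantor_Y \<inter> Q i) = cantor_Y \<inter> P i \<and> (\<forall>p \<in> cantor_Y \<inter> Q i. g p = f p)))"

text \<open>The product of \<^term>\<open>BijGroup cantor_Y\<close> is \<open>g \<otimes> f = g \<circ> f\<close>, i.e. composition from right to left.\<close>

definition V2_hat :: "(real \<times> real \<Rightarrow> real \<times> real) monoid"
  where "V2_hat = (BijGroup cantor_Y)
    \<lparr>carrier := {pattern_pair P Q | P Q. numbered_pattern P \<and> numbered_pattern Q}\<rparr>"

definition V2 :: "(real \<times> real \<Rightarrow> real \<times> real) monoid"
  where "V2 = V2_hat
    \<lparr>carrier := {g \<in> carrier V2_hat. \<forall>p \<in> cantor_Y - unit_square 0. g p = p}\<rparr>"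

definition v_pattern :: "nat \<Rightarrow> nat \<Rightarrow> rect"
  where "v_pattern i n =
    (if n < i then unit_square n
     else if n = i then left_third (2 * real i) (2 * real i + 1) 0 1
     else if n = i + 1 then right_third (2 * real i) (2 * real i + 1) 0 1
     else unit_square (n - 1))"

definition h_pattern :: "nat \<Rightarrow> nat \<Rightarrow> rect"
  where "h_pattern i n =
    (if n < i then unit_square n
     else if n = i then bottom_third (2 * real i) (2 * real i + 1) 0 1
     else if n = i + 1 then top_third (2 * real i) (2 * real i + 1) 0 1
     else unit_square (n - 1))"

definition \<sigma>_pattern :: "nat \<Rightarrow> nat \<Rightarrow> rect"
  where "\<sigma>_pattern i n =
    (if n = i then unit_square (i + 1) else if n = i + 1 then unit_square i else unit_square n)"

definition elt_of_pattern :: "(nat \<Rightarrow> rect) \<Rightarrow> real \<times> real \<Rightarrow> real \<times> real"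
  where "elt_of_pattern P = pattern_pair P unit_square"

definition elt_v :: "nat \<Rightarrow> real \<times> real \<Rightarrow> real \<times> real"
  where "elt_v i = elt_of_pattern (v_pattern i)"

definition elt_h :: "nat \<Rightarrow> real \<times> real \<Rightarrow> real \<times> real"
  where "elt_h i = elt_of_pattern (h_pattern i)"

definition elt_\<sigma> :: "nat \<Rightarrow> real \<times> real \<Rightarrow> real \<times> real"
  where "elt_\<sigma> i = elt_of_pattern (\<sigma>_pattern i)"

text \<open>The element \<open>(p, q) = p q\<^sup>-\<^sup>1\<close>.\<close>

definition elt_quot :: "(real \<times> real \<Rightarrow> real \<times> real) \<Rightarrow> (real \<times> real \<Rightarrow> real \<times> real) \<Rightarrow>
    real \<times> real \<Rightarrow> real \<times> real"
  where "elt_quot p q = p \<otimes>\<^bsub>V2_hat\<^esub> inv\<^bsub>V2_hat\<^esub> q"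

definition elt_A :: "nat \<Rightarrow> real \<times> real \<Rightarrow> real \<times> real"
  where "elt_A i = elt_quot (elt_v 0 [^]\<^bsub>V2_hat\<^esub> (i + 1) \<otimes>\<^bsub>V2_hat\<^esub> elt_v 1) (elt_v 0 [^]\<^bsub>V2_hat\<^esub> (i + 2))"

definition elt_B :: "nat \<Rightarrow> real \<times> real \<Rightarrow> real \<times> real"
  where "elt_B i = elt_quot (elt_v 0 [^]\<^bsub>V2_hat\<^esub> (i + 1) \<otimes>\<^bsub>V2_hat\<^esub> elt_h 1) (elt_v 0 [^]\<^bsub>V2_hat\<^esub> (i + 2))"

definition elt_\<pi> :: "nat \<Rightarrow> real \<times> real \<Rightarrow> real \<times> real"
  where "elt_\<pi> i = elt_quot (elt_v 0 [^]\<^bsub>V2_hat\<^esub> (i + 2) \<otimes>\<^bsub>V2_hat\<^esub> elt_\<sigma> 1) (elt_v 0 [^]\<^bsub>V2_hat\<^esub> (i + 2))"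

definition elt_\<pi>b :: "nat \<Rightarrow> real \<times> real \<Rightarrow> real \<times> real"
  where "elt_\<pi>b i = elt_quot (elt_v 0 [^]\<^bsub>V2_hat\<^esub> (i + 1) \<otimes>\<^bsub>V2_hat\<^esub> elt_\<sigma> 0) (elt_v 0 [^]\<^bsub>V2_hat\<^esub> (i + 1))"

datatype gen = gA nat | gB nat | g\<pi> nat | g\<pi>b nat

definition gens :: "gen set"
  where "gens = (\<Union>i\<in>{0, 1}. {gA i, gB i, g\<pi> i, g\<pi>b i})"

primrec gen_val :: "gen \<Rightarrow> real \<times> real \<Rightarrow> real \<times> real"
  where
    "gen_val (gA i) = elt_A i"
  | "gen_val (gB i) = elt_B i"
  | "gen_val (g\<pi> i) = elt_\<pi> i"
  | "gen_val (g\<pi>b i) = elt_\<pi>b i"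

text \<open>The word \<open>x\<^sub>i\<close>, which for \<open>i \<ge> 2\<close> abbreviates \<open>A\<^sub>0\<^bsup>1-i\<^esup> x\<^sub>1 A\<^sub>0\<^bsup>i-1\<^esup>\<close>.\<close>

definition shifted :: "(nat \<Rightarrow> gen) \<Rightarrow> nat \<Rightarrow> gen word"
  where "shifted x i =
    (if i < 2 then [(x i, True)]
     else replicate (i - 1) (gA 0, False) @ [(x 1, True)] @ replicate (i - 1) (gA 0, True))"

abbreviation wA :: "nat \<Rightarrow> gen word" where "wA \<equiv> shifted gA"
abbreviation wB :: "nat \<Rightarrow> gen word" where "wB \<equiv> shifted gB"
abbreviation w\<pi> :: "nat \<Rightarrow> gen word" where "w\<pi> \<equiv> shifted g\<pi>"
abbreviation w\<pi>b :: "nat \<Rightarrow> gen word" where "w\<pi>b \<equiv> shifted g\<pi>b"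

definition wC :: "nat \<Rightarrow> gen word"
  where "wC m = (w\<pi>b m @ wB m @ w\<pi>b (m + 1) @ w\<pi> m) @ (wB m @ w\<pi> (m + 1) @ word_inv (wA m))"

definition relations1 :: "(gen word \<times> gen word) set"
  where "relations1 =
    {(wA 2 @ wA 1, wA 1 @ wA 3), (wA 3 @ wA 1, wA 1 @ wA 4),
     (wB 2 @ wA 1, wA 1 @ wB 3), (wB 3 @ wA 1, wA 1 @ wB 4),
     (wA 1 @ wB 0, wB 0 @ wA 2), (wA 2 @ wB 0, wB 0 @ wA 3),
     (wA 2 @ wB 1, wB 1 @ wA 3), (wA 3 @ wB 1, wB 1 @ wA 4),
     (wB 1 @ wB 0, wB 0 @ wB 2), (wB 2 @ wB 0, wB 0 @ wB 3),
     (wB 2 @ wB 1, wB 1 @ wB 3), (wB 3 @ wB 1, wB 1 @ wB 4),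
     (w\<pi> 0 @ wA 2, wA 2 @ w\<pi> 0), (w\<pi> 0 @ wA 3, wA 3 @ w\<pi> 0),
     (w\<pi> 1 @ wA 3, wA 3 @ w\<pi> 1), (w\<pi> 1 @ wA 4, wA 4 @ w\<pi> 1),
     (w\<pi> 0 @ wB 2, wB 2 @ w\<pi> 0), (w\<pi> 0 @ wB 3, wB 3 @ w\<pi> 0),
     (w\<pi> 1 @ wB 3, wB 3 @ w\<pi> 1), (w\<pi> 1 @ wB 4, wB 4 @ w\<pi> 1),
     (w\<pi> 0 @ wA 0, wA 1 @ w\<pi> 0 @ w\<pi> 1), (w\<pi> 1 @ wA 1, wA 2 @ w\<pi> 1 @ w\<pi> 2),
     (w\<pi> 0 @ wB 0, wB 1 @ w\<pi> 0 @ w\<pi> 1), (w\<pi> 1 @ wB 1, wB 2 @ w\<pi> 1 @ w\<pi> 2),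
     (w\<pi> 1 @ wB 0, wB 0 @ w\<pi> 2), (w\<pi> 2 @ wB 0, wB 0 @ w\<pi> 3),
     (w\<pi> 2 @ wB 1, wB 1 @ w\<pi> 3), (w\<pi> 3 @ wB 1, wB 1 @ w\<pi> 4),
     (w\<pi> 2 @ wA 1, wA 1 @ w\<pi> 3), (w\<pi> 3 @ wA 1, wA 1 @ w\<pi> 4),
     (w\<pi> 0 @ w\<pi> 0, []), (w\<pi> 1 @ w\<pi> 1, []),
     (w\<pi> 0 @ w\<pi> 2, w\<pi> 2 @ w\<pi> 0), (w\<pi> 0 @ w\<pi> 3, w\<pi> 3 @ w\<pi> 0),
     (w\<pi> 1 @ w\<pi> 3, w\<pi> 3 @ w\<pi> 1), (w\<pi> 1 @ w\<pi> 4, w\<pi> 4 @ w\<pi> 1),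
     (w\<pi> 0 @ w\<pi> 1 @ w\<pi> 0, w\<pi> 1 @ w\<pi> 0 @ w\<pi> 1), (w\<pi> 1 @ w\<pi> 2 @ w\<pi> 1, w\<pi> 2 @ w\<pi> 1 @ w\<pi> 2),
     (wA 0 @ wB 1 @ wB 0, wB 0 @ wA 1 @ wA 0 @ w\<pi> 1), (wA 1 @ wB 2 @ wB 1, wB 1 @ wA 2 @ wA 1 @ w\<pi> 2)}"

definition relations2 :: "(gen word \<times> gen word) set"
  where "relations2 =
    {(w\<pi>b 2 @ wA 1, wA 1 @ w\<pi>b 3), (w\<pi>b 3 @ wA 1, wA 1 @ w\<pi>b 4),
     (w\<pi>b 1 @ wB 0, wB 0 @ w\<pi>b 2), (w\<pi>b 2 @ wB 0, wB 0 @ w\<pi>b 3),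
     (w\<pi>b 2 @ wB 1, wB 1 @ w\<pi>b 3), (w\<pi>b 3 @ wB 1, wB 1 @ w\<pi>b 4),
     (w\<pi>b 0 @ wA 0, w\<pi> 0 @ w\<pi>b 1), (w\<pi>b 1 @ wA 1, w\<pi> 1 @ w\<pi>b 2),
     (w\<pi>b 0 @ wB 0, wC 1 @ w\<pi> 0 @ w\<pi>b 1), (w\<pi>b 1 @ wB 1, wC 2 @ w\<pi> 1 @ w\<pi>b 2),
     (wC 2 @ wA 1, wA 1 @ wC 3), (wC 3 @ wA 1, wA 1 @ wC 4),
     (wC 1 @ wB 0, wB 0 @ wC 2), (wC 2 @ wB 0, wB 0 @ wC 3),
     (wC 2 @ wB 1, wB 1 @ wC 3), (wC 3 @ wB 1, wB 1 @ wC 4),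
     (wC 0 @ wA 0, wB 0 @ wC 2 @ w\<pi> 1), (wC 1 @ wA 1, wB 1 @ wC 3 @ w\<pi> 2),
     (w\<pi>b 0 @ w\<pi>b 0, []), (w\<pi>b 1 @ w\<pi>b 1, []),
     (w\<pi> 0 @ wC 2, wC 2 @ w\<pi> 0), (w\<pi> 0 @ wC 3, wC 3 @ w\<pi> 0),
     (w\<pi> 1 @ wC 3, wC 3 @ w\<pi> 1), (w\<pi> 1 @ wC 4, wC 4 @ w\<pi> 1),
     (w\<pi> 0 @ w\<pi>b 2, w\<pi>b 2 @ w\<pi> 0), (w\<pi> 0 @ w\<pi>b 3, w\<pi>b 3 @ w\<pi> 0),
     (w\<pi> 1 @ w\<pi>b 3, w\<pi>b 3 @ w\<pi> 1), (w\<pi> 1 @ w\<pi>b 4, w\<pi>b 4 @ w\<pi> 1),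
     (w\<pi> 0 @ w\<pi>b 1 @ w\<pi> 0, w\<pi>b 1 @ w\<pi> 0 @ w\<pi>b 1), (w\<pi> 1 @ w\<pi>b 2 @ w\<pi> 1, w\<pi>b 2 @ w\<pi> 1 @ w\<pi>b 2)}"

end

theory Submission
  imports Defs "HOL-Library.Countable" "HOL-Library.Multiset"
begin

text \<open>Let the \<^emph>\<open>spine\<close> with \<open>n + 1\<close> rectangles be the pattern obtained
from the square \<open>S\<^sub>0\<close> by dividing rectangle number 0 vertically \<open>n\<close> times. An
element of \<open>2V\<close> is a pair \<open>(P, Q)\<close> of numbered patterns of \<open>S\<^sub>0\<close>
with equally many rectangles, hence a quotient \<open>[P] [Q]\<^sup>-\<^sup>1\<close>, where \<open>[P]\<close>
pairs \<open>P\<close> with the spine of the same size. If \<open>P'\<close> arises from \<open>P\<close>, with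
\<open>n + 1\<close> rectangles, by dividing rectangle \<open>k\<close> in direction \<open>c\<close>, then
\<open>[P'] = [P] E n k c\<close> with a factor that depends only on \<open>n\<close>, \<open>k\<close> and
\<open>c\<close>; exchanging the numbers \<open>k\<close> and \<open>k + 1\<close> multiplies \<open>[P]\<close>
by a factor \<open>S n k\<close>. Rectangle \<open>k > 0\<close> of the spine does not change when the spine
grows, except that its number does, so for \<open>k > 0\<close> these factors depend on \<open>n - k\<close>
only: they are \<open>A\<close> and \<open>B\<close> with index \<open>n - k\<close> and \<open>\<pi>\<close>
with index \<open>n - k - 1\<close>. For \<open>k = 0\<close> they are 1, \<open>C\<close> with index
\<open>n\<close>, and the barred \<open>\<pi>\<close> with index \<open>n - 1\<close>.

Read this way, each relation states that two sequences of moves build the same numbered pattern, so the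
relations hold in \<open>2V\<close> (\<open>relations_hold\<close>). Conversely, conjugation by
\<open>A\<^sub>0\<close> raises indices, and with its help the listed relations imply the same relations for all
indices (\<open>families_of_relations\<close>). These are exactly the laws of the locale
\<open>pattern_calculus\<close>: moves at different rectangles commute up to renumbering, dividing one rectangle
in both directions can be done in either order up to one exchange, and exchanges satisfy the Coxeter relations.

The heart of the proof is \<open>coherence\<close>: whenever these laws hold, the product of the factors along a
sequence of moves depends only on the numbered pattern that it builds. To see this, assign to a pattern the
product along one way of refining it to a grid of fixed depth and then sorting the numbers. Induction on the
number of divisions that are still missing shows that this product absorbs every first move
(\<open>grid_val_moves\<close>): two possible first divisions can be completed to a square by the laws, and once
nothing is left to divide the Coxeter relations suffice. The product along any sequence of moves is then the
quotient of the values at its two ends.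

Since two patterns have a common refinement, the quotients \<open>[P] [Q]\<^sup>-\<^sup>1\<close> form a
subgroup of the presented group; it contains the generators, so it is everything
(\<open>quotients_UNIV\<close>). If such a quotient acts trivially on the Cantor set, then \<open>P = Q\<close>,
and coherence makes the quotient 1; so the presented group embeds (\<open>realize_inject\<close>). Its image
consists of all pairs of patterns of \<open>S\<^sub>0\<close>, and that is \<open>2V\<close>
(\<open>V2_carrier_realize\<close>).\<close>

section \<open>Groups without a carrier set\<close>

text \<open>The presented group and the group of permutations of the Cantor set are made into types of this class,
so that calculations need no membership conditions.\<close>

class mult_group = monoid_mult + inverse +
  assumes group_left_inverse: "inverse a * a = 1"
    and divide_mult_inverse: "a / b = a * inverse b"
begin

lemma group_right_inverse: "a * inverse a = 1"
proof -
  have "a * inverse a = inverse (inverse a) * (inverse a * a) * inverse a"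
    by (metis group_left_inverse mult_1_left mult.assoc)
  thus ?thesis by (simp add: group_left_inverse)
qed

lemma group_left_cancel: "a * b = a * c \<longleftrightarrow> b = c"
  by (metis group_left_inverse mult.assoc mult_1_left)

lemma group_right_cancel: "b * a = c * a \<longleftrightarrow> b = c"
  by (metis group_right_inverse mult.assoc mult_1_right)

lemma group_inverse_cancel [simp]:
  "inverse a * a = 1" "a * inverse a = 1" "inverse a * (a * b) = b" "a * (inverse a * b) = b"
  by (simp_all add: group_left_inverse group_right_inverse mult.assoc[symmetric])

lemma group_inverse_unique: "a * b = 1 \<Longrightarrow> inverse a = b"
  by (metis group_left_cancel group_right_inverse)

lemma inverse_mult [simp]: "inverse (a * b) = inverse b * inverse a"
  by (rule group_inverse_unique) (simp add: mult.assoc)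

lemma inverse_inverse [simp]: "inverse (inverse a) = a"
  by (rule group_inverse_unique) simp

lemma inverse_1 [simp]: "inverse 1 = 1"
  by (rule group_inverse_unique) simp

end

section \<open>Cells of the Cantor set\<close>

text \<open>A word addresses the interval reached from \<open>[0, 1]\<close> by taking the left third for each
\<^const>\<open>False\<close> and the right third for each \<^const>\<open>True\<close>; this is its left
end.\<close>

primrec left_end :: "bool list \<Rightarrow> real" where
  "left_end [] = 0"
| "left_end (b # u) = (if b then 2 / 3 else 0) + left_end u / 3"

lemma left_end_snoc: "left_end (u @ [b]) = left_end u + (if b then 2 / 3 ^ Suc (length u) else 0)"
  by (induction u) auto

lemma left_end_bounds: "0 \<le> left_end u" "left_end u + 1 / 3 ^ length u \<le> 1"
proof (induction u)
  case (Cons b u)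
  have "(left_end u + 1 / 3 ^ length u) / 3 \<le> 1 / 3" using Cons(2) by simp
  hence "left_end u / 3 + 1 / 3 ^ length (b # u) \<le> 1 / 3" by (simp add: add_divide_distrib)
  thus "left_end (b # u) + 1 / 3 ^ length (b # u) \<le> 1" by simp
  show "0 \<le> left_end (b # u)" using Cons(1) by simp
qed simp_all

text \<open>The number of a square, and the words that address the two sides of a rectangle in it.\<close>

type_synonym addr = "nat \<times> bool list \<times> bool list"

fun cell :: "addr \<Rightarrow> rect" where
  "cell (s, u, v) =
    {2 * real s + left_end u..2 * real s + left_end u + 1 / 3 ^ length u} \<times> {left_end v..left_end v + 1 / 3 ^ length v}"

text \<open>The affine map from the unit square onto a cell. By \<open>Y_cell\<close> below it maps pairs of
points of the Cantor set onto the part of the cell in \<^const>\<open>cantor_Y\<close>.\<close>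

fun cell_point :: "addr \<Rightarrow> real \<times> real \<Rightarrow> real \<times> real" where
  "cell_point (s, u, v) (x, y) = (2 * real s + left_end u + x / 3 ^ length u, left_end v + y / 3 ^ length v)"

datatype dir = Vert | Horiz

fun child :: "dir \<Rightarrow> bool \<Rightarrow> addr \<Rightarrow> addr" where
  "child Vert b (s, u, v) = (s, u @ [b], v)"
| "child Horiz b (s, u, v) = (s, u, v @ [b])"

lemma cantor_stage_bounds: "x \<in> cantor_stage n \<Longrightarrow> 0 \<le> x \<and> x \<le> 1"
proof (induction n arbitrary: x)
  case (Suc n)
  then obtain z where "z \<in> cantor_stage n" "x = z / 3 \<or> x = (z + 2) / 3" by auto
  with Suc.IH[of z] show ?case by auto
qed simp

lemma cantor_bounds: "x \<in> cantor_set \<Longrightarrow> 0 \<le> x \<and> x \<le> 1"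
  using cantor_stage_bounds[of x 0] unfolding cantor_set_def by blast

lemma cantor_stage_decreasing: "cantor_stage (Suc n) \<subseteq> cantor_stage n"
proof (induction n)
  case 0
  show ?case by auto
next
  case (Suc n)
  show ?case
  proof
    fix x assume "x \<in> cantor_stage (Suc (Suc n))"
    then obtain z where "z \<in> cantor_stage (Suc n)" "x = z / 3 \<or> x = (z + 2) / 3"
      unfolding cantor_stage.simps(2)[of "Suc n"] by blast
    with Suc have "z \<in> cantor_stage n" "x = z / 3 \<or> x = (z + 2) / 3" by blast+
    thus "x \<in> cantor_stage (Suc n)" by auto
  qed
qed

lemma cantor_scale: assumes "0 \<le> z" "z \<le> 1"
  shows "((if b then 2 / 3 else 0) + z / 3 \<in> cantor_set) = (z \<in> cantor_set)"
proof -
  let ?w = "(if b then 2 / 3 else 0) + z / 3"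
  have *: "?w \<in> cantor_stage (Suc n) \<longleftrightarrow> z \<in> cantor_stage n" for n
  proof
    assume "?w \<in> cantor_stage (Suc n)"
    then obtain y where y: "y \<in> cantor_stage n" "?w = y / 3 \<or> ?w = (y + 2) / 3" by auto
    with assms cantor_stage_bounds[OF y(1)] have "y = z" by (auto split: if_splits)
    with y show "z \<in> cantor_stage n" by simp
  next
    assume "z \<in> cantor_stage n"
    thus "?w \<in> cantor_stage (Suc n)" by (cases b) (auto simp: image_iff add_divide_distrib)
  qed
  show ?thesis
  proof
    assume "?w \<in> cantor_set"
    thus "z \<in> cantor_set" using * unfolding cantor_set_def by blast
  next
    assume "z \<in> cantor_set"
    hence "?w \<in> cantor_stage (Suc n)" for n
      using * unfolding cantor_set_def by blast
    thus "?w \<in> cantor_set" using cantor_stage_decreasing unfolding cantor_set_def by blast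
  qed
qed

lemma cantor_cases: assumes "x \<in> cantor_set"
  obtains b z where "z \<in> cantor_set" "x = (if b then 2 / 3 else 0) + z / 3"
proof -
  have "x \<in> cantor_stage (Suc 0)" using assms unfolding cantor_set_def by blast
  then obtain y where "y \<in> cantor_stage 0" "x = y / 3 \<or> x = (y + 2) / 3" by auto
  then obtain b z where z: "0 \<le> z" "z \<le> 1" "x = (if b then 2 / 3 else 0) + z / 3"
    by (intro that[of y "x = (y + 2) / 3"]) (auto simp: add_divide_distrib)
  with assms have "z \<in> cantor_set" using cantor_scale[OF z(1,2), of b] by simp
  with z that show ?thesis by blast
qed

lemma cantor_endpoints: "0 \<in> cantor_set" "1 \<in> cantor_set"
proof -
  have "0 \<in> cantor_stage n \<and> 1 \<in> cantor_stage n" for n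
    by (induction n) (auto simp: image_iff)
  thus "0 \<in> cantor_set" "1 \<in> cantor_set" by (auto simp: cantor_set_def)
qed

text \<open>The Cantor set meets each addressed interval in a scaled copy of itself, because one step of the
addressing applies one of the two contractions that generate the Cantor set.\<close>

lemma cantor_in_interval: assumes "0 \<le> x" "x \<le> 1"
  shows "left_end u + x / 3 ^ length u \<in> cantor_set \<longleftrightarrow> x \<in> cantor_set"
proof (induction u)
  case (Cons b u)
  let ?z = "left_end u + x / 3 ^ length u"
  have "0 \<le> ?z" using left_end_bounds[of u] assms by simp
  moreover have "x / 3 ^ length u \<le> 1 / 3 ^ length u"
    using assms by (simp add: divide_right_mono)
  hence "?z \<le> 1" using left_end_bounds(2)[of u] by linarith
  ultimately have "(if b then 2 / 3 else 0) + ?z / 3 \<in> cantor_set \<longleftrightarrow> ?z \<in> cantor_set"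
    by (rule cantor_scale)
  moreover have "(if b then 2 / 3 else 0) + ?z / 3 = left_end (b # u) + x / 3 ^ length (b # u)"
    by (simp add: add_divide_distrib)
  ultimately show ?case using Cons by simp
qed simp

text \<open>Lengths and left ends of intervals determine their words: the first letter is read off from the half
of \<open>[0, 1]\<close> in which the interval begins.\<close>

lemma interval_inj:
  "left_end u = left_end w \<Longrightarrow> length u = length w \<Longrightarrow> u = w"
proof (induction u arbitrary: w)
  case (Cons b u)
  then obtain c w' where w: "w = c # w'" by (cases w) auto
  have *: "0 \<le> left_end x \<and> left_end x < 1" for x
    using left_end_bounds[of x] by (smt (verit) zero_less_divide_1_iff zero_less_power)
  have "b = c" using Cons.prems *[of u] *[of w'] by (auto simp: w split: if_splits)
  with Cons w show ?case by simp
qed simp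

lemma Y_iff: "(x, y) \<in> cantor_Y \<longleftrightarrow> (\<exists>i. x - 2 * real i \<in> cantor_set) \<and> y \<in> cantor_set"
proof -
  have "x \<in> (+) (2 * real i) ` cantor_set \<longleftrightarrow> x - 2 * real i \<in> cantor_set" for i
    by (force simp: image_iff)
  thus ?thesis by (auto simp: cantor_Y_def)
qed

lemma Y_cell: "cantor_Y \<inter> cell a = cell_point a ` (cantor_set \<times> cantor_set)"
proof -
  obtain s u v where a: "a = (s, u, v)" by (cases a)
  show ?thesis
  proof (rule Set.set_eqI, rule iffI)
    fix z assume z: "z \<in> cantor_Y \<inter> cell a"
    obtain x y where xy: "z = (x, y)" by (cases z)
    define c where "c = (x - 2 * real s - left_end u) * 3 ^ length u"
    define d where "d = (y - left_end v) * 3 ^ length v"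
    have c: "0 \<le> c" "c \<le> 1" "x = 2 * real s + (left_end u + c / 3 ^ length u)"
      using z by (simp add: a xy c_def, simp_all add: a xy c_def field_simps)
    have d: "0 \<le> d" "d \<le> 1" "y = left_end v + d / 3 ^ length v"
      using z by (simp add: a xy d_def, simp_all add: a xy d_def field_simps)
    obtain i where i: "x - 2 * real i \<in> cantor_set" and y: "y \<in> cantor_set"
      using z unfolding xy by (auto simp: Y_iff)
    have "0 \<le> x - 2 * real s" "x - 2 * real s \<le> 1"
      using z left_end_bounds[of u] by (auto simp: a xy)
    hence "\<bar>real i - real s\<bar> < 1" using cantor_bounds[OF i] by linarith
    hence "i = s" by linarith
    hence "c \<in> cantor_set" using i c cantor_in_interval[OF c(1,2)] by simp
    moreover have "d \<in> cantor_set" using y d cantor_in_interval[OF d(1,2)] by simp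
    ultimately show "z \<in> cell_point a ` (cantor_set \<times> cantor_set)"
      using c d by (force simp: a xy)
  next
    fix z assume "z \<in> cell_point a ` (cantor_set \<times> cantor_set)"
    then obtain c d where cd: "c \<in> cantor_set" "d \<in> cantor_set" "z = cell_point a (c, d)" by auto
    have b: "0 \<le> c" "c \<le> 1" "0 \<le> d" "d \<le> 1" using cd cantor_bounds by auto
    have "left_end u + c / 3 ^ length u \<in> cantor_set" "left_end v + d / 3 ^ length v \<in> cantor_set"
      using cd b cantor_in_interval by auto
    thus "z \<in> cantor_Y \<inter> cell a"
      using b by (auto simp: cd(3) a Y_iff divide_right_mono add.assoc intro!: exI[of _ s])
  qed
qed

lemma Y_cell_nonempty: "\<exists>z. z \<in> cantor_Y \<and> z \<in> cell a"
  using Y_cell[of a] cantor_endpoints by blast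

lemma cell_point_child:
  "cell_point (child Vert b a) (x, y) = cell_point a ((if b then 2 / 3 else 0) + x / 3, y)"
  "cell_point (child Horiz b a) (x, y) = cell_point a (x, (if b then 2 / 3 else 0) + y / 3)"
  by (cases a; auto simp: left_end_snoc add_divide_distrib)+

lemma cell_point_inj: "cell_point a z = cell_point a w \<longleftrightarrow> z = w"
  by (cases a; cases z; cases w; auto)

lemma cantor_thirds:
  assumes "x \<in> cantor_set" shows "(if b then 2 / 3 else 0) + x / 3 \<in> cantor_set"
  using cantor_scale cantor_bounds[OF assms] assms by blast

lemma Y_child:
  assumes "z \<in> cantor_Y"
  shows "z \<in> cell a \<longleftrightarrow> z \<in> cell (child c False a) \<or> z \<in> cell (child c True a)"
    and "\<not> (z \<in> cell (child c False a) \<and> z \<in> cell (child c True a))"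
proof -
  have eq: "z \<in> cell d \<longleftrightarrow> z \<in> cell_point d ` (cantor_set \<times> cantor_set)" for d
    using assms Y_cell[of d] by blast
  show "z \<in> cell a \<longleftrightarrow> z \<in> cell (child c False a) \<or> z \<in> cell (child c True a)"
  proof
    assume "z \<in> cell a"
    then obtain x y where xy: "x \<in> cantor_set" "y \<in> cantor_set" "z = cell_point a (x, y)"
      by (auto simp: eq)
    have "\<exists>b. z \<in> cell (child c b a)"
    proof (cases c)
      case Vert
      obtain b x' where "x' \<in> cantor_set" "x = (if b then 2 / 3 else 0) + x' / 3"
        using cantor_cases xy(1) by blast
      hence "z = cell_point (child Vert b a) (x', y)" by (simp only: cell_point_child xy)
      thus ?thesis unfolding eq Vert using \<open>x' \<in> cantor_set\<close> xy by blast
    next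
      case Horiz
      obtain b y' where "y' \<in> cantor_set" "y = (if b then 2 / 3 else 0) + y' / 3"
        using cantor_cases xy(2) by blast
      hence "z = cell_point (child Horiz b a) (x, y')" by (simp only: cell_point_child xy)
      thus ?thesis unfolding eq Horiz using \<open>y' \<in> cantor_set\<close> xy by blast
    qed
    thus "z \<in> cell (child c False a) \<or> z \<in> cell (child c True a)" by (metis (full_types))
  next
    have "z \<in> cell a" if "z \<in> cell (child c b a)" for b
      using that unfolding eq
      by (cases c) (auto simp: cell_point_child image_iff simp del: cell_point.simps intro: cantor_thirds)
    thus "z \<in> cell (child c False a) \<or> z \<in> cell (child c True a) \<Longrightarrow> z \<in> cell a" by blast
  qed
  show "\<not> (z \<in> cell (child c False a) \<and> z \<in> cell (child c True a))"
  proof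
    assume "z \<in> cell (child c False a) \<and> z \<in> cell (child c True a)"
    then obtain x y x' y' where
      "x \<in> cantor_set" "y \<in> cantor_set" "z = cell_point (child c False a) (x, y)"
      "x' \<in> cantor_set" "y' \<in> cantor_set" "z = cell_point (child c True a) (x', y')"
      unfolding eq by blast
    thus False
      using cantor_bounds[of x] cantor_bounds[of y] cantor_bounds[of x'] cantor_bounds[of y']
      by (cases c) (auto simp: cell_point_child cell_point_inj)
  qed
qed

text \<open>The connection with the thirds that define increments of patterns.\<close>

lemma cell_thirds:
  fixes s u v defines "a \<equiv> 2 * real s + left_end u" and "c \<equiv> left_end v"
  shows "left_third a (a + 1 / 3 ^ length u) c (c + 1 / 3 ^ length v) = cell (child Vert False (s, u, v))"
    "right_third a (a + 1 / 3 ^ length u) c (c + 1 / 3 ^ length v) = cell (child Vert True (s, u, v))"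
    "bottom_third a (a + 1 / 3 ^ length u) c (c + 1 / 3 ^ length v) = cell (child Horiz False (s, u, v))"
    "top_third a (a + 1 / 3 ^ length u) c (c + 1 / 3 ^ length v) = cell (child Horiz True (s, u, v))"
proof -
  have third: "x + 1 / 3 ^ n - (x + 1 / 3 ^ n - x) / 3 = x + 2 / 3 ^ Suc n"
    "x + (x + 1 / 3 ^ n - x) / 3 = x + 1 / 3 ^ Suc n"
    "x + 2 / 3 ^ Suc n + 1 / 3 ^ Suc n = x + 1 / 3 ^ n" for x :: real and n
    by (simp_all add: field_simps)
  show "left_third a (a + 1 / 3 ^ length u) c (c + 1 / 3 ^ length v) = cell (child Vert False (s, u, v))"
    "right_third a (a + 1 / 3 ^ length u) c (c + 1 / 3 ^ length v) = cell (child Vert True (s, u, v))"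
    "bottom_third a (a + 1 / 3 ^ length u) c (c + 1 / 3 ^ length v) = cell (child Horiz False (s, u, v))"
    "top_third a (a + 1 / 3 ^ length u) c (c + 1 / 3 ^ length v) = cell (child Horiz True (s, u, v))"
    unfolding left_third_def right_third_def bottom_third_def top_third_def third child.simps
      cell.simps left_end_snoc length_append_singleton if_True if_False a_def c_def
    by (simp_all only: add.assoc[symmetric] third add_0_right)
qed

lemma cell_inj: "cell a = cell b \<longleftrightarrow> a = b"
proof
  assume eq: "cell a = cell b"
  obtain s u v s' u' v' where ab: "a = (s, u, v)" "b = (s', u', v')" by (cases a; cases b)
  have ne: "(0::real) < 1 / 3 ^ n" for n by simp
  have box: "{x..x+d} \<times> {y..y+e} = {x'..x'+d'} \<times> {y'..y'+e'} \<Longrightarrow> 0 < d \<Longrightarrow> 0 < e \<Longrightarrow>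
     x = x' \<and> d = d' \<and> y = y' \<and> e = e'" for x y d e x' y' d' e' :: real
    by (auto simp: times_eq_iff Icc_eq_Icc)
  have h: "2 * real s + left_end u = 2 * real s' + left_end u'" "1 / 3 ^ length u = (1 / 3 ^ length u' :: real)"
    "left_end v = left_end v'" "1 / 3 ^ length v = (1 / 3 ^ length v' :: real)"
    using box[OF eq[unfolded ab cell.simps] ne ne] by simp_all
  have len: "length u = length u'" "length v = length v'"
    using h by simp_all
  have "0 \<le> left_end u \<and> left_end u \<le> 1" "0 \<le> left_end u' \<and> left_end u' \<le> 1"
    using left_end_bounds[of u] left_end_bounds[of u'] ne[of "length u"] ne[of "length u'"] by linarith+
  hence "\<bar>real s - real s'\<bar> < 1" using h(1) by linarith
  hence "s = s'" by linarith
  with h len show "a = b" by (simp add: ab interval_inj)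
qed simp

text \<open>The second argument is the source: \<open>cell_map a b\<close> takes the cell \<open>b\<close> to
the cell \<open>a\<close>.\<close>

fun cell_map :: "addr \<Rightarrow> addr \<Rightarrow> real \<times> real \<Rightarrow> real \<times> real" where
  "cell_map (s, u, v) (s', u', v') (x, y) =
    (2 * real s + left_end u + (x - 2 * real s' - left_end u') * 3 ^ length u' / 3 ^ length u,
     left_end v + (y - left_end v') * 3 ^ length v' / 3 ^ length v)"

lemma cell_map_point: "cell_map a b (cell_point b z) = cell_point a z"
  by (cases a; cases b; cases z) auto

text \<open>Dividing source and target in the same way does not change the affine map; this is why both patterns
of a pair can be refined at once.\<close>

lemma cell_map_child: "cell_map (child c t a) (child c t b) = cell_map a b"
proof
  fix z show "cell_map (child c t a) (child c t b) z = cell_map a b z"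
    by (cases a; cases b; cases z; cases c) (auto simp: left_end_snoc field_simps)
qed

lemma cell_map_self: "cell_map a a z = z"
  by (cases a; cases z) auto

lemma cell_map_triadic: "cell_map a b \<in> triadic_maps"
proof -
  obtain s u v s' u' v' where ab: "a = (s, u, v)" "b = (s', u', v')" by (cases a; cases b)
  have p: "(3::real) powi (int m - int n) = 3 ^ m / 3 ^ n" for m n
    by (simp add: power_int_diff)
  have "cell_map a b = (\<lambda>(x, y).
      (2 * real s + left_end u - (2 * real s' + left_end u') * 3 ^ length u' / 3 ^ length u
         + 3 powi (int (length u') - int (length u)) * x,
       left_end v - left_end v' * 3 ^ length v' / 3 ^ length v
         + 3 powi (int (length v') - int (length v)) * y))"
    by (auto simp: fun_eq_iff ab p field_simps)
  thus ?thesis unfolding triadic_maps_def by blast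
qed

text \<open>A map of this form is increasing in both coordinates, so it takes the two extreme corners of a cell,
which lie in the Cantor set, to those of its image. The two corners determine translation and scaling.\<close>

lemma cell_map_unique:
  assumes f: "f \<in> triadic_maps" and im: "f ` (cantor_Y \<inter> cell b) = cantor_Y \<inter> cell a"
  shows "f = cell_map a b"
proof -
  obtain s u v s' u' v' where ab: "a = (s, u, v)" "b = (s', u', v')" by (cases a; cases b)
  obtain \<alpha> \<beta> j k where f_eq: "f = (\<lambda>(x, y). (\<alpha> + 3 powi j * x, \<beta> + 3 powi k * y))"
    using f unfolding triadic_maps_def by blast
  define J K where "J = (3::real) powi j" and "K = (3::real) powi k"
  have pos: "J > 0" "K > 0" by (simp_all add: J_def K_def)
  have f_eq: "f (x, y) = (\<alpha> + J * x, \<beta> + K * y)" for x y by (simp add: f_eq J_def K_def)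
  have c: "cell_point b (0, 0) \<in> cantor_Y \<inter> cell b" "cell_point b (1, 1) \<in> cantor_Y \<inter> cell b"
    "cell_point a (0, 0) \<in> cantor_Y \<inter> cell a" "cell_point a (1, 1) \<in> cantor_Y \<inter> cell a"
    unfolding Y_cell using cantor_endpoints by blast+
  have low: "f (cell_point b (0, 0)) = cell_point a (0, 0)"
  proof -
    obtain z where z: "z \<in> cell b" "f z = cell_point a (0, 0)"
      using c(3) unfolding im[symmetric] by fastforce
    have "f (cell_point b (0, 0)) \<in> cell a" using imageI[OF c(1), of f] unfolding im by simp
    moreover have "fst (cell_point b (0, 0)) \<le> fst z" "snd (cell_point b (0, 0)) \<le> snd z"
      using z by (auto simp: ab)
    hence "fst (f (cell_point b (0, 0))) \<le> fst (f z)" "snd (f (cell_point b (0, 0))) \<le> snd (f z)"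
      using pos by (cases z; auto simp: f_eq ab)+
    ultimately show ?thesis using z(2) by (auto simp: ab f_eq)
  qed
  have high: "f (cell_point b (1, 1)) = cell_point a (1, 1)"
  proof -
    obtain z where z: "z \<in> cell b" "f z = cell_point a (1, 1)"
      using c(4) unfolding im[symmetric] by fastforce
    have *: "f (cell_point b (1, 1)) \<in> cell a" using imageI[OF c(2), of f] unfolding im by simp
    have "fst z \<le> fst (cell_point b (1, 1))" "snd z \<le> snd (cell_point b (1, 1))"
      using z by (auto simp: ab)
    hence "fst (f z) \<le> fst (f (cell_point b (1, 1)))" "snd (f z) \<le> snd (f (cell_point b (1, 1)))"
      using pos by (cases z; auto simp: f_eq ab)+
    with z(2) * show ?thesis by (auto simp: ab f_eq)
  qed
  have "J * (1 / 3 ^ length u') = 1 / 3 ^ length u" "K * (1 / 3 ^ length v') = 1 / 3 ^ length v"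
    using low high by (auto simp: ab f_eq algebra_simps)
  hence JK: "J = 3 ^ length u' / 3 ^ length u" "K = 3 ^ length v' / 3 ^ length v"
    by (simp_all add: field_simps)
  have ab': "\<alpha> = 2 * real s + left_end u - J * (2 * real s' + left_end u')" "\<beta> = left_end v - K * left_end v'"
    using low by (auto simp: ab f_eq algebra_simps)
  show ?thesis
  proof
    fix z show "f z = cell_map a b z"
      by (cases z) (simp add: ab f_eq ab' JK field_simps)
  qed
qed

lemma cell_map_image: "cell_map a b ` (cantor_Y \<inter> cell b) = cantor_Y \<inter> cell a"
  unfolding Y_cell image_image cell_map_point ..

lemma cell_map_compose: "cell_map a b (cell_map b d z) = cell_map a d z"
  by (cases a; cases b; cases d; cases z) simp


section \<open>Configurations\<close>

text \<open>A numbered pattern is represented by the sequence of the addresses of its rectangles.\<close>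

type_synonym config = "nat \<Rightarrow> addr"

definition squares :: config where "squares n = (n, [], [])"

definition split_at :: "dir \<Rightarrow> nat \<Rightarrow> config \<Rightarrow> config" where
  "split_at c k p = (\<lambda>n. if n < k then p n else if n = k then child c False (p k)
     else if n = Suc k then child c True (p k) else p (n - 1))"

definition swap_at :: "nat \<Rightarrow> config \<Rightarrow> config" where
  "swap_at k p = (\<lambda>n. if n = k then p (Suc k) else if n = Suc k then p k else p n)"

lemma child_commute: "child Vert a (child Horiz b x) = child Horiz b (child Vert a x)"
  by (cases x) simp

text \<open>The next lemmas compare sequences of divisions and exchanges with the same outcome. Each of them
turns into a relation between group elements.\<close>

lemma split_split:
  "k < l \<Longrightarrow> split_at d (Suc l) (split_at c k p) = split_at c k (split_at d l p)"
  by (rule ext) (auto simp: split_at_def)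

lemma split_cross:
  "swap_at (Suc k) (split_at Horiz (Suc (Suc k)) (split_at Horiz k (split_at Vert k p)))
   = split_at Vert (Suc (Suc k)) (split_at Vert k (split_at Horiz k p))"
  by (rule ext) (auto simp: split_at_def swap_at_def child_commute)

lemma swap_swap: "swap_at k (swap_at k p) = p"
  by (rule ext) (auto simp: swap_at_def)

lemma swap_commute: "Suc k < l \<Longrightarrow> swap_at k (swap_at l p) = swap_at l (swap_at k p)"
  by (rule ext) (auto simp: swap_at_def)

lemma swap_braid: "swap_at k (swap_at (Suc k) (swap_at k p))
    = swap_at (Suc k) (swap_at k (swap_at (Suc k) p))"
  by (rule ext) (auto simp: swap_at_def)

lemma split_swap_below: "l < k \<Longrightarrow> split_at c l (swap_at k p) = swap_at (Suc k) (split_at c l p)"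
  by (rule ext) (auto simp: swap_at_def split_at_def)

lemma split_swap_above: "Suc k < l \<Longrightarrow> split_at c l (swap_at k p) = swap_at k (split_at c l p)"
  by (rule ext) (auto simp: swap_at_def split_at_def)

lemma split_swap_left: "split_at c k (swap_at k p) = swap_at (Suc k) (swap_at k (split_at c (Suc k) p))"
  by (rule ext) (auto simp: swap_at_def split_at_def)

lemma split_swap_right: "split_at c (Suc k) (swap_at k p) = swap_at k (swap_at (Suc k) (split_at c k p))"
  by (rule ext) (auto simp: swap_at_def split_at_def)

text \<open>The rectangles of a pattern may leave gaps in the squares, but they cover the Cantor set.\<close>

definition tiling :: "config \<Rightarrow> bool" where
  "tiling p \<longleftrightarrow> (\<forall>z\<in>cantor_Y. \<exists>!i. z \<in> cell (p i))"

lemma tiling_squares: "tiling squares"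
  unfolding tiling_def
proof
  fix z assume z: "z \<in> cantor_Y"
  obtain x y where xy: "z = (x, y)" by (cases z)
  obtain i where i: "x - 2 * real i \<in> cantor_set" "y \<in> cantor_set"
    using z unfolding xy Y_iff by blast
  show "\<exists>!i. z \<in> cell (squares i)"
  proof (rule ex1I)
    show "z \<in> cell (squares i)" using cantor_bounds[OF i(1)] cantor_bounds[OF i(2)] by (auto simp: squares_def xy)
    fix j assume "z \<in> cell (squares j)"
    hence "\<bar>real i - real j\<bar> < 1" using cantor_bounds[OF i(1)] by (auto simp: squares_def xy)
    thus "j = i" by linarith
  qed
qed

lemma tiling_swap: assumes "tiling p" shows "tiling (swap_at k p)"
  unfolding tiling_def
proof
  fix z assume "z \<in> cantor_Y"
  then obtain i where i: "z \<in> cell (p i)" "\<And>j. z \<in> cell (p j) \<Longrightarrow> j = i"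
    using assms unfolding tiling_def by blast
  let ?t = "\<lambda>i. if i = k then Suc k else if i = Suc k then k else i"
  have *: "swap_at k p j = p (?t j)" for j by (simp add: swap_at_def)
  show "\<exists>!j. z \<in> cell (swap_at k p j)"
  proof (rule ex1I[of _ "?t i"])
    show "z \<in> cell (swap_at k p (?t i))" using i(1) by (auto simp: swap_at_def)
    fix j assume "z \<in> cell (swap_at k p j)"
    hence "?t j = i" using i(2) * by metis
    thus "j = ?t i" by (auto split: if_splits)
  qed
qed

lemma tiling_split: assumes "tiling p" shows "tiling (split_at c k p)"
  unfolding tiling_def
proof
  fix z assume z: "z \<in> cantor_Y"
  then obtain i where i: "z \<in> cell (p i)" "\<And>j. z \<in> cell (p j) \<Longrightarrow> j = i"
    using assms unfolding tiling_def by blast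
  note ch = Y_child[OF z, where c=c]
  show "\<exists>!j. z \<in> cell (split_at c k p j)"
  proof (cases "i = k")
    case True
    obtain b where b: "z \<in> cell (child c b (p k))" "z \<notin> cell (child c (\<not> b) (p k))"
      using i ch[where a="p k"] True by (metis (full_types))
    show ?thesis
    proof (rule ex1I[of _ "if b then Suc k else k"])
      show "z \<in> cell (split_at c k p (if b then Suc k else k))"
        using b by (cases b) (simp_all add: split_at_def)
      fix j assume j: "z \<in> cell (split_at c k p j)"
      have "j = k \<or> j = Suc k"
      proof (rule ccontr)
        assume "\<not> (j = k \<or> j = Suc k)"
        hence "z \<in> cell (p (if j < k then j else j - 1))" using j by (simp add: split_at_def split: if_splits)
        hence "(if j < k then j else j - 1) = k" using i(2) True by blast
        with \<open>\<not> (j = k \<or> j = Suc k)\<close> show False by (auto split: if_splits)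
      qed
      with b j show "j = (if b then Suc k else k)" by (auto simp: split_at_def)
    qed
  next
    case False
    hence nb: "z \<notin> cell (child c b (p k))" for b
      using i ch(1)[where a="p k"] by (metis (full_types))
    have *: "i \<noteq> k" "z \<in> cell (p i)" using i(1) False by auto
    show ?thesis
    proof (rule ex1I[of _ "if i < k then i else Suc i"])
      show "z \<in> cell (split_at c k p (if i < k then i else Suc i))"
        using * by (simp add: split_at_def)
      fix j assume j: "z \<in> cell (split_at c k p j)"
      consider "j < k" | "j = k \<or> j = Suc k" | "Suc k < j" by linarith
      thus "j = (if i < k then i else Suc i)"
      proof cases
        case 1
        with j have "z \<in> cell (p j)" by (simp add: split_at_def)
        with i(2) 1 show ?thesis by auto
      next
        case 2
        with j nb show ?thesis by (auto simp: split_at_def)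
      next
        case 3
        with j have "z \<in> cell (p (j - 1))" by (simp add: split_at_def)
        with i(2) have "j - 1 = i" by blast
        with 3 show ?thesis by auto
      qed
    qed
  qed
qed

lemma tiling_disjoint:
  assumes "tiling p" "z \<in> cantor_Y" "z \<in> cell (p i)" "z \<in> cell (p j)" shows "i = j"
  using assms unfolding tiling_def by blast

lemma tiling_inj: assumes "tiling p" shows "inj p"
  by (metis Y_cell_nonempty assms injI tiling_disjoint)

text \<open>The map of the pair \<open>(p, q)\<close>. Off the Cantor set it takes the dummy value of
extensional functions.\<close>

definition cellwise :: "config \<Rightarrow> config \<Rightarrow> real \<times> real \<Rightarrow> real \<times> real" where
  "cellwise p q = restrict (\<lambda>z. let i = (THE i. z \<in> cell (q i)) in cell_map (p i) (q i) z) cantor_Y"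

lemma cellwise_eq:
  assumes "tiling q" "z \<in> cantor_Y" "z \<in> cell (q i)"
  shows "cellwise p q z = cell_map (p i) (q i) z"
proof -
  have "(THE i. z \<in> cell (q i)) = i" using assms tiling_disjoint by blast
  thus ?thesis using assms by (simp add: cellwise_def Let_def)
qed

lemma tiling_obtain:
  assumes "tiling q" "z \<in> cantor_Y" obtains i where "z \<in> cell (q i)"
  using assms unfolding tiling_def by blast

lemma cellwise_cell:
  assumes "tiling q" "z \<in> cantor_Y" "z \<in> cell (q i)"
  shows "cellwise p q z \<in> cantor_Y" "cellwise p q z \<in> cell (p i)"
  using cell_map_image[of "p i" "q i"] assms by (auto simp: cellwise_eq)

lemma cellwise_compose:
  assumes "tiling q" "tiling r" "z \<in> cantor_Y"
  shows "cellwise p q (cellwise q r z) = cellwise p r z"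
proof -
  obtain i where i: "z \<in> cell (r i)" using tiling_obtain assms(2,3) .
  have "cellwise p q (cellwise q r z) = cell_map (p i) (q i) (cellwise q r z)"
    using cellwise_cell[OF assms(2,3) i] cellwise_eq[OF assms(1)] by blast
  thus ?thesis using assms i by (simp add: cellwise_eq cell_map_compose)
qed

lemma cellwise_self: assumes "tiling p" "z \<in> cantor_Y" shows "cellwise p p z = z"
proof -
  obtain i where i: "z \<in> cell (p i)" using tiling_obtain assms .
  thus ?thesis using assms by (simp add: cellwise_eq cell_map_self)
qed

lemma cellwise_extensional: "cellwise p q \<in> extensional cantor_Y"
  by (simp add: cellwise_def)

lemma cellwise_Bij: assumes "tiling p" "tiling q" shows "cellwise p q \<in> Bij cantor_Y"
proof -
  have "cellwise p q \<in> cantor_Y \<rightarrow> cantor_Y" if "tiling q" for p q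
  proof
    fix z assume "z \<in> cantor_Y"
    thus "cellwise p q z \<in> cantor_Y" using cellwise_cell(1) tiling_obtain that by metis
  qed
  hence "bij_betw (cellwise p q) cantor_Y cantor_Y"
    using assms by (intro bij_betwI[of _ _ _ "cellwise q p"]) (auto simp: cellwise_compose cellwise_self)
  thus ?thesis using cellwise_extensional unfolding Bij_def by blast
qed

text \<open>On each cell the affine map is determined by its image (\<open>cell_map_unique\<close>), and the
cells cover the Cantor set.\<close>

lemma pattern_pair_eq_cellwise:
  assumes "tiling p" "tiling q"
  shows "pattern_pair (\<lambda>i. cell (p i)) (\<lambda>i. cell (q i)) = cellwise p q"
  unfolding pattern_pair_def
proof (rule the_equality, intro conjI allI)
  show "cellwise p q \<in> extensional cantor_Y" by (rule cellwise_extensional)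
  show "\<exists>f\<in>triadic_maps. f ` (cantor_Y \<inter> cell (q i)) = cantor_Y \<inter> cell (p i) \<and>
      (\<forall>z\<in>cantor_Y \<inter> cell (q i). cellwise p q z = f z)" for i
    using assms by (intro bexI[of _ "cell_map (p i) (q i)"]) (auto simp: cell_map_image cell_map_triadic cellwise_eq)
next
  fix g assume g: "g \<in> extensional cantor_Y \<and> (\<forall>i. \<exists>f\<in>triadic_maps.
      f ` (cantor_Y \<inter> cell (q i)) = cantor_Y \<inter> cell (p i) \<and> (\<forall>z\<in>cantor_Y \<inter> cell (q i). g z = f z))"
  show "g = cellwise p q"
  proof (rule extensionalityI)
    fix z assume z: "z \<in> cantor_Y"
    obtain i where i: "z \<in> cell (q i)" using tiling_obtain assms(2) z .
    obtain f where "f \<in> triadic_maps" "f ` (cantor_Y \<inter> cell (q i)) = cantor_Y \<inter> cell (p i)"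
       "g z = f z" using g i z by blast
    thus "g z = cellwise p q z" using cell_map_unique cellwise_eq[OF assms(2) z i] by metis
  qed (use g cellwise_extensional in auto)
qed

lemma cellwise_split:
  assumes "tiling p" "tiling q" shows "cellwise (split_at c k p) (split_at c k q) = cellwise p q"
proof (rule extensionalityI)
  fix z assume z: "z \<in> cantor_Y"
  obtain i where i: "z \<in> cell (split_at c k q i)" using tiling_obtain tiling_split assms(2) z .
  have eq: "cellwise (split_at c k p) (split_at c k q) z = cell_map (split_at c k p i) (split_at c k q i) z"
    using cellwise_eq tiling_split assms(2) z i by blast
  show "cellwise (split_at c k p) (split_at c k q) z = cellwise p q z"
  proof (cases "i = k \<or> i = Suc k")
    case True
    then obtain b where b: "\<And>p. split_at c k p i = child c b (p k)"
      by (auto simp: split_at_def)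
    have "z \<in> cell (q k)" using i Y_child(1)[OF z] unfolding b by (metis (full_types))
    thus ?thesis using eq assms z by (simp add: b cell_map_child cellwise_eq)
  next
    case False
    then obtain j where "\<And>p. split_at c k p i = p j"
      by (metis (no_types, lifting) split_at_def)
    thus ?thesis using eq assms z i by (simp add: cellwise_eq)
  qed
qed (auto intro: cellwise_extensional)

lemma cellwise_swap:
  assumes "tiling p" "tiling q" shows "cellwise (swap_at k p) (swap_at k q) = cellwise p q"
proof (rule extensionalityI)
  fix z assume z: "z \<in> cantor_Y"
  obtain i where i: "z \<in> cell (swap_at k q i)" using tiling_obtain tiling_swap assms(2) z .
  have eq: "cellwise (swap_at k p) (swap_at k q) z = cell_map (swap_at k p i) (swap_at k q i) z"
    using cellwise_eq tiling_swap assms(2) z i by blast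
  obtain j where "\<And>p. swap_at k p i = p j"
    by (metis (no_types, lifting) swap_at_def)
  thus "cellwise (swap_at k p) (swap_at k q) z = cellwise p q z" using eq assms z i by (simp add: cellwise_eq)
qed (auto intro: cellwise_extensional)

lemma cell_point_eq_imp_cell_eq:
  assumes "\<And>z. cell_point a z = cell_point b z" shows "cell a = cell b"
  using assms[of "(0, 0)"] assms[of "(1, 1)"] by (cases a; cases b) simp

lemma cellwise_id_imp_eq:
  assumes "tiling p" "tiling q" "\<And>z. z \<in> cantor_Y \<Longrightarrow> cellwise p q z = z" shows "p = q"
proof
  fix i
  have "cell_map (p i) (q i) z = z" if "z \<in> cantor_Y \<inter> cell (q i)" for z
    using that assms(2,3) cellwise_eq[of q z i p] by simp
  hence "cantor_Y \<inter> cell (p i) = (\<lambda>z. z) ` (cantor_Y \<inter> cell (q i))"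
    unfolding cell_map_image[of "p i" "q i", symmetric] by (intro image_cong) auto
  hence "(\<lambda>z. z) ` (cantor_Y \<inter> cell (q i)) = cantor_Y \<inter> cell (p i)" by simp
  moreover have "(\<lambda>z. z) \<in> triadic_maps"
    using cell_map_triadic[of "squares 0" "squares 0"] cell_map_self[of "squares 0", abs_def] by simp
  ultimately have "(\<lambda>z. z) = cell_map (p i) (q i)" by (rule cell_map_unique[rotated])
  hence *: "cell_map (p i) (q i) z = z" for z by metis
  hence "cell_point (p i) z = cell_point (q i) z" for z by (metis cell_map_point)
  hence "cell (p i) = cell (q i)" by (rule cell_point_eq_imp_cell_eq)
  thus "p i = q i" by (simp add: cell_inj)
qed


section \<open>Permutations of the Cantor set\<close>

typedef cperm = "Bij cantor_Y" by (rule exI) (rule id_Bij)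

setup_lifting type_definition_cperm

instantiation cperm :: "{one, times, inverse}"
begin

lift_definition one_cperm :: cperm is "\<lambda>x\<in>cantor_Y. x" by (rule id_Bij)
lift_definition times_cperm :: "cperm \<Rightarrow> cperm \<Rightarrow> cperm" is "compose cantor_Y"
  by (rule compose_Bij)
lift_definition inverse_cperm :: "cperm \<Rightarrow> cperm"
  is "\<lambda>f. restrict (inv_into cantor_Y f) cantor_Y" by (rule restrict_inv_into_Bij)
definition divide_cperm :: "cperm \<Rightarrow> cperm \<Rightarrow> cperm" where
  "divide_cperm a b = a * inverse b"

instance ..

end

instance cperm :: mult_group
proof
  fix a b c :: cperm
  show "a * b * c = a * (b * c)"
    by transfer (metis Bij_imp_funcset compose_assoc)
  show "1 * a = a" by transfer (simp add: Id_compose Bij_imp_extensional Bij_imp_funcset)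
  show "a * 1 = a" by transfer (rule compose_Id[OF Bij_imp_funcset Bij_imp_extensional])
  show "inverse a * a = 1"
    by transfer (simp add: Bij_compose_restrict_eq)
  show "a / b = a * inverse b" by (rule divide_cperm_def)
qed

definition pair_perm :: "config \<Rightarrow> config \<Rightarrow> cperm" where
  "pair_perm p q = Abs_cperm (cellwise p q)"

lemma Rep_pair_perm: "tiling p \<Longrightarrow> tiling q \<Longrightarrow> Rep_cperm (pair_perm p q) = cellwise p q"
  by (simp add: pair_perm_def Abs_cperm_inverse cellwise_Bij)

lemma pair_perm_mult:
  assumes "tiling p" "tiling q" "tiling r" shows "pair_perm p q * pair_perm q r = pair_perm p r"
proof -
  have "compose cantor_Y (cellwise p q) (cellwise q r) = cellwise p r"
    by (rule extensionalityI[of _ cantor_Y])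
      (auto simp: compose_def cellwise_compose assms cellwise_extensional)
  thus ?thesis by (simp add: Rep_cperm_inject[symmetric] times_cperm.rep_eq Rep_pair_perm assms)
qed

lemma pair_perm_self: assumes "tiling p" shows "pair_perm p p = 1"
proof -
  have "cellwise p p = (\<lambda>x\<in>cantor_Y. x)"
    by (rule extensionalityI[of _ cantor_Y]) (auto simp: cellwise_self assms cellwise_extensional)
  thus ?thesis by (simp add: Rep_cperm_inject[symmetric] one_cperm.rep_eq Rep_pair_perm assms)
qed

lemma inverse_pair_perm: "tiling p \<Longrightarrow> tiling q \<Longrightarrow> inverse (pair_perm p q) = pair_perm q p"
  by (rule group_inverse_unique) (simp add: pair_perm_mult pair_perm_self)

lemma pair_perm_eq_1: "tiling p \<Longrightarrow> tiling q \<Longrightarrow> pair_perm p q = 1 \<Longrightarrow> p = q"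
  by (rule cellwise_id_imp_eq) (auto simp: Rep_pair_perm[symmetric] one_cperm.rep_eq)

text \<open>A configuration, identified with the permutation that it forms with the trivial pattern.\<close>

definition config_perm :: "config \<Rightarrow> cperm" where "config_perm p = pair_perm p squares"

definition split_perm :: "dir \<Rightarrow> nat \<Rightarrow> cperm" where "split_perm c k = config_perm (split_at c k squares)"
definition swap_perm :: "nat \<Rightarrow> cperm" where "swap_perm k = config_perm (swap_at k squares)"

lemmas tiling_intros [simp, intro] = tiling_squares tiling_split tiling_swap

lemma config_perm_squares [simp]: "config_perm squares = 1"
  by (simp add: config_perm_def pair_perm_self)

text \<open>Dividing both patterns of the pair \<open>(p, squares)\<close> at \<open>k\<close> does not change
its permutation. So the divided pattern differs from \<open>p\<close> by a right factor that does not depend on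
\<open>p\<close>.\<close>

lemma config_perm_split: "tiling p \<Longrightarrow> config_perm (split_at c k p) = config_perm p * split_perm c k"
  using pair_perm_mult[of "split_at c k p" "split_at c k squares" squares]
  by (simp add: config_perm_def split_perm_def pair_perm_def cellwise_split)

lemma config_perm_swap: "tiling p \<Longrightarrow> config_perm (swap_at k p) = config_perm p * swap_perm k"
  using pair_perm_mult[of "swap_at k p" "swap_at k squares" squares]
  by (simp add: config_perm_def swap_perm_def pair_perm_def cellwise_swap)

lemma pair_perm_eq: "tiling p \<Longrightarrow> tiling q \<Longrightarrow> pair_perm p q = config_perm p * inverse (config_perm q)"
  by (simp add: config_perm_def inverse_pair_perm pair_perm_mult)

lemmas config_perm_cong = arg_cong[where f=config_perm]

lemma split_perm_commute: "k < l \<Longrightarrow> split_perm c k * split_perm d (Suc l) = split_perm d l * split_perm c k"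
  using config_perm_cong[OF split_split[of k l d c squares]] by (simp add: config_perm_split)

lemma split_perm_cross: "split_perm Horiz k * (split_perm Vert k * split_perm Vert (Suc (Suc k)))
    = split_perm Vert k * (split_perm Horiz k * (split_perm Horiz (Suc (Suc k)) * swap_perm (Suc k)))"
  using config_perm_cong[OF split_cross[of k squares]] by (simp add: config_perm_split config_perm_swap mult.assoc)

lemma swap_perm_square: "swap_perm k * swap_perm k = 1"
  using config_perm_cong[OF swap_swap[of k squares]] by (simp add: config_perm_swap)

lemma swap_perm_commute: "Suc k < l \<Longrightarrow> swap_perm k * swap_perm l = swap_perm l * swap_perm k"
  using config_perm_cong[OF swap_commute[of k l squares]] by (simp add: config_perm_swap)

lemma swap_perm_braid: "swap_perm k * (swap_perm (Suc k) * swap_perm k) = swap_perm (Suc k) * (swap_perm k * swap_perm (Suc k))"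
  using config_perm_cong[OF swap_braid[of k squares]] by (simp add: config_perm_swap mult.assoc)

lemma swap_split_perm_below: "l < k \<Longrightarrow> swap_perm k * split_perm c l = split_perm c l * swap_perm (Suc k)"
  using config_perm_cong[OF split_swap_below[of l k c squares]] by (simp add: config_perm_swap config_perm_split)

lemma swap_split_perm_above: "Suc k < l \<Longrightarrow> swap_perm k * split_perm c l = split_perm c l * swap_perm k"
  using config_perm_cong[OF split_swap_above[of k l c squares]] by (simp add: config_perm_swap config_perm_split)

lemma swap_split_perm_right: "swap_perm k * split_perm c (Suc k) = split_perm c k * (swap_perm (Suc k) * swap_perm k)"
  using config_perm_cong[OF split_swap_right[of c k squares]] by (simp add: config_perm_swap config_perm_split mult.assoc)


section \<open>Adjacent transpositions\<close>

fun lswap :: "nat \<Rightarrow> 'a list \<Rightarrow> 'a list" where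
  "lswap 0 (x # y # zs) = y # x # zs"
| "lswap (Suc k) (x # xs) = x # lswap k xs"
| "lswap _ xs = xs"

lemma mset_lswap [simp]: "mset (lswap k xs) = mset xs"
  by (induction k xs rule: lswap.induct) auto

text \<open>The product of adjacent transpositions that carries an entry at position \<open>i\<close> past the
\<open>j\<close> entries that follow it.\<close>

primrec bubble :: "(nat \<Rightarrow> 'g::mult_group) \<Rightarrow> nat \<Rightarrow> nat \<Rightarrow> 'g" where
  "bubble s i 0 = 1"
| "bubble s i (Suc j) = s (i + j) * bubble s i j"

text \<open>The product along insertion sort of a list that starts at position \<open>i\<close>, in the order
that leads from the sorted list to the given one.\<close>

primrec sortval :: "(nat \<Rightarrow> 'g::mult_group) \<Rightarrow> nat \<Rightarrow> 'k::linorder list \<Rightarrow> 'g" where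
  "sortval s i [] = 1"
| "sortval s i (x # xs) = bubble s i (size (filter_mset (\<lambda>y. y < x) (mset xs))) * sortval s (Suc i) xs"

locale coxeter =
  fixes s :: "nat \<Rightarrow> 'g::mult_group" and n :: nat
  assumes sq: "k < n \<Longrightarrow> s k * s k = 1"
    and comm: "Suc k < l \<Longrightarrow> l < n \<Longrightarrow> s k * s l = s l * s k"
    and braid: "Suc k < n \<Longrightarrow> s k * (s (Suc k) * s k) = s (Suc k) * (s k * s (Suc k))"
begin

lemma comm_bubble: "Suc k < i \<Longrightarrow> i + j \<le> n \<Longrightarrow> s k * bubble s i j = bubble s i j * s k"
proof (induction j)
  case (Suc j)
  have "s k * bubble s i (Suc j) = (s k * s (i + j)) * bubble s i j" by (simp add: mult.assoc)
  also have "s k * s (i + j) = s (i + j) * s k" using Suc.prems by (intro comm) auto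
  finally show ?case using Suc by (simp add: mult.assoc)
qed simp

lemma comm_bubble_above:
  "i + j < k \<Longrightarrow> k < n \<Longrightarrow> s k * bubble s i j = bubble s i j * s k"
proof (induction j)
  case (Suc j)
  have "s k * bubble s i (Suc j) = (s k * s (i + j)) * bubble s i j" by (simp add: mult.assoc)
  also have "s k * s (i + j) = s (i + j) * s k" using Suc.prems comm[of "i + j" k] by simp
  finally show ?case using Suc by (simp add: mult.assoc)
qed simp

lemma comm_sortval: "Suc k < i \<Longrightarrow> i + length xs \<le> Suc n \<Longrightarrow> s k * sortval s i xs = sortval s i xs * s k"
proof (induction xs arbitrary: i)
  case (Cons x xs)
  let ?j = "size (filter_mset (\<lambda>y. y < x) (mset xs))"
  have "?j \<le> length xs" by (metis size_filter_mset_lesseq size_mset)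
  hence *: "s k * bubble s i ?j = bubble s i ?j * s k" using Cons.prems by (intro comm_bubble) auto
  have "s k * sortval s i (x # xs) = (s k * bubble s i ?j) * sortval s (Suc i) xs"
    by (simp add: mult.assoc)
  also have "\<dots> = bubble s i ?j * (s k * sortval s (Suc i) xs)" unfolding * by (simp add: mult.assoc)
  also have "s k * sortval s (Suc i) xs = sortval s (Suc i) xs * s k"
    using Cons.prems by (intro Cons.IH) auto
  finally show ?case by (simp add: mult.assoc)
qed simp

lemma bubble_Suc_right: "bubble s i (Suc j) = bubble s (Suc i) j * s i"
  by (induction j) (simp_all add: mult.assoc)

lemma bubble_shift:
  "1 \<le> m \<Longrightarrow> m \<le> j \<Longrightarrow> i + j < n \<Longrightarrow> bubble s i (Suc j) * s (i + m) = s (i + m - 1) * bubble s i (Suc j)"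
proof (induction j)
  case (Suc j)
  show ?case
  proof (cases "m = Suc j")
    case True
    have "bubble s i (Suc (Suc j)) * s (i + m)
      = s (Suc (i + j)) * (s (i + j) * (bubble s i j * s (Suc (i + j))))"
      by (simp add: True mult.assoc)
    also have "bubble s i j * s (Suc (i + j)) = s (Suc (i + j)) * bubble s i j"
      using Suc.prems comm_bubble_above[of i j "Suc (i + j)"] by simp
    also have "s (Suc (i + j)) * (s (i + j) * (s (Suc (i + j)) * bubble s i j))
        = (s (Suc (i + j)) * (s (i + j) * s (Suc (i + j)))) * bubble s i j" by (simp add: mult.assoc)
    also have "s (Suc (i + j)) * (s (i + j) * s (Suc (i + j))) = s (i + j) * (s (Suc (i + j)) * s (i + j))"
      using braid[of "i + j"] Suc.prems by simp
    finally show ?thesis by (simp add: True mult.assoc)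
  next
    case False
    have "bubble s i (Suc (Suc j)) * s (i + m) = s (i + Suc j) * (bubble s i (Suc j) * s (i + m))"
      by (simp add: mult.assoc)
    also have "bubble s i (Suc j) * s (i + m) = s (i + m - 1) * bubble s i (Suc j)"
      using Suc False by (intro Suc.IH) auto
    also have "s (i + Suc j) * (s (i + m - 1) * bubble s i (Suc j))
       = (s (i + Suc j) * s (i + m - 1)) * bubble s i (Suc j)" by (simp add: mult.assoc)
    also have "s (i + Suc j) * s (i + m - 1) = s (i + m - 1) * s (i + Suc j)"
      using Suc.prems False by (intro comm[symmetric]) auto
    finally show ?thesis by (simp add: mult.assoc)
  qed
qed simp

text \<open>Bringing two entries to the front in either order: the braid relations move one long cycle past the
other at the cost of an index shift.\<close>

lemma bubble_bubble:
  "l \<le> j \<Longrightarrow> i + j < n \<Longrightarrow> bubble s i (Suc j) * bubble s (Suc i) l = bubble s i l * bubble s i (Suc j)"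
proof (induction l)
  case (Suc l)
  have "bubble s i (Suc j) * bubble s (Suc i) (Suc l)
      = (bubble s i (Suc j) * s (i + Suc l)) * bubble s (Suc i) l" by (simp add: mult.assoc)
  also have "bubble s i (Suc j) * s (i + Suc l) = s (i + l) * bubble s i (Suc j)"
    using bubble_shift[of "Suc l" j i] Suc.prems by simp
  also have "s (i + l) * bubble s i (Suc j) * bubble s (Suc i) l
      = s (i + l) * (bubble s i l * bubble s i (Suc j))" using Suc by (simp add: mult.assoc)
  finally show ?case by (simp add: mult.assoc)
qed simp

lemma sortval_swap_less:
  assumes "x < y" "Suc i + length zs < Suc n"
  shows "sortval s i (y # x # zs) = sortval s i (x # y # zs) * s i"
proof -
  define a where "a = size (filter_mset (\<lambda>z. z < x) (mset zs))"
  define b where "b = size (filter_mset (\<lambda>z. z < y) (mset zs))"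
  have ab: "a \<le> b" unfolding a_def b_def
    using assms(1) by (intro size_mset_mono filter_mset_mono_strong) auto
  have b: "b \<le> length zs" unfolding b_def by (metis size_filter_mset_lesseq size_mset)
  have "sortval s i (y # x # zs) = (bubble s i (Suc b) * bubble s (Suc i) a) * sortval s (Suc (Suc i)) zs"
    using assms(1) by (simp add: a_def b_def mult.assoc)
  also have "bubble s i (Suc b) * bubble s (Suc i) a = bubble s i a * bubble s i (Suc b)"
    using ab b assms by (intro bubble_bubble) auto
  also have "\<dots> * sortval s (Suc (Suc i)) zs
     = bubble s i a * (bubble s (Suc i) b * (s i * sortval s (Suc (Suc i)) zs))"
    unfolding bubble_Suc_right by (simp add: mult.assoc)
  also have "s i * sortval s (Suc (Suc i)) zs = sortval s (Suc (Suc i)) zs * s i"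
    using assms by (intro comm_sortval) auto
  finally show ?thesis using assms(1) less_not_sym[OF assms(1)] by (simp add: a_def b_def mult.assoc)
qed

text \<open>Only the Coxeter relations enter here.  So the value of a product of adjacent transpositions
is determined by the arrangement that it produces, which is the Coxeter presentation of the symmetric
group in the form needed below.  Distinctness matters: exchanging equal entries would leave the
left-hand side unchanged.\<close>

lemma sortval_lswap:
  assumes "distinct xs" "Suc k < length xs" "i + length xs \<le> Suc n"
  shows "sortval s i (lswap k xs) = sortval s i xs * s (i + k)"
  using assms
proof (induction k xs arbitrary: i rule: lswap.induct)
  case (1 x y zs)
  show ?case
  proof (cases "x < y")
    case True
    with 1 show ?thesis using sortval_swap_less[of x y i zs] by simp
  next
    case False
    with 1 have "y < x" by auto
    hence "sortval s i (x # y # zs) * s i = sortval s i (y # x # zs) * (s i * s i)"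
      using 1 sortval_swap_less[of y x i zs] by (simp del: sortval.simps add: mult.assoc)
    also have "s i * s i = 1" using 1 by (intro sq) auto
    finally show ?thesis by simp
  qed
next
  case (2 k x xs)
  hence "sortval s (Suc i) (lswap k xs) = sortval s (Suc i) xs * s (Suc i + k)" by simp
  thus ?case by (simp add: mult.assoc)
qed auto

end

lemma map_swap_at:
  "Suc k < n \<Longrightarrow> map (swap_at k p) [0..<n] = lswap k (map p [0..<n])"
proof -
  have "i \<le> k \<Longrightarrow> Suc k < n \<Longrightarrow> map (swap_at k p) [i..<n] = lswap (k - i) (map p [i..<n])" for i
  proof (induction "k - i" arbitrary: i)
    case 0
    hence "[i..<n] = k # Suc k # [Suc (Suc k)..<n]" by (simp add: upt_conv_Cons)
    with 0 show ?case by (auto simp: swap_at_def)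
  next
    case (Suc d)
    hence "map (swap_at k p) [Suc i..<n] = lswap (k - Suc i) (map p [Suc i..<n])" by (intro Suc) auto
    moreover have "k - i = Suc (k - Suc i)" "[i..<n] = i # [Suc i..<n]" "swap_at k p i = p i"
      using Suc by (auto simp: upt_conv_Cons swap_at_def)
    ultimately show ?case by simp
  qed
  from this[of 0] show "Suc k < n \<Longrightarrow> map (swap_at k p) [0..<n] = lswap k (map p [0..<n])" by simp
qed

section \<open>Moves and coherence\<close>

datatype move = Split dir nat | Swap nat

fun act :: "move \<Rightarrow> config \<Rightarrow> config" where
  "act (Split c k) = split_at c k"
| "act (Swap k) = swap_at k"

text \<open>A configuration of size \<open>n\<close> has \<open>n + 1\<close> rectangles in play, with the
numbers from 0 to \<open>n\<close>.\<close>

fun next_size :: "nat \<Rightarrow> move \<Rightarrow> nat" where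
  "next_size n (Split c k) = Suc n"
| "next_size n (Swap k) = n"

fun valid_move :: "nat \<Rightarrow> move \<Rightarrow> bool" where
  "valid_move n (Split c k) \<longleftrightarrow> k \<le> n"
| "valid_move n (Swap k) \<longleftrightarrow> k < n"

primrec run :: "move list \<Rightarrow> config \<Rightarrow> config" where
  "run [] p = p"
| "run (m # ms) p = run ms (act m p)"

primrec final_size :: "nat \<Rightarrow> move list \<Rightarrow> nat" where
  "final_size n [] = n"
| "final_size n (m # ms) = final_size (next_size n m) ms"

primrec valid :: "nat \<Rightarrow> move list \<Rightarrow> bool" where
  "valid n [] \<longleftrightarrow> True"
| "valid n (m # ms) \<longleftrightarrow> valid_move n m \<and> valid (next_size n m) ms"

lemma run_append: "run (ms @ ms') p = run ms' (run ms p)"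
  by (induction ms arbitrary: p) auto

lemma final_size_append: "final_size n (ms @ ms') = final_size (final_size n ms) ms'"
  by (induction ms arbitrary: n) auto

lemma valid_append: "valid n (ms @ ms') \<longleftrightarrow> valid n ms \<and> valid (final_size n ms) ms'"
  by (induction ms arbitrary: n) auto

lemma tiling_act: "tiling p \<Longrightarrow> tiling (act m p)"
  by (cases m) auto

lemma tiling_run: "tiling p \<Longrightarrow> tiling (run ms p)"
  by (induction ms arbitrary: p) (auto simp: tiling_act)

text \<open>The bounds \<open>(d, e)\<close> limit the number of vertical and of horizontal divisions of a cell.\<close>

fun allowed :: "nat \<times> nat \<Rightarrow> dir \<Rightarrow> addr \<Rightarrow> bool" where
  "allowed (d, e) Vert (s, u, v) \<longleftrightarrow> length u < d"
| "allowed (d, e) Horiz (s, u, v) \<longleftrightarrow> length v < e"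

text \<open>The number of divisions that cut a cell into the \<open>2\<^sup>m\<close> pieces of maximal depth,
where \<open>m\<close> is the number of letters missing from its two words.\<close>

fun room :: "nat \<times> nat \<Rightarrow> addr \<Rightarrow> nat" where
  "room (d, e) (s, u, v) = 2 ^ ((d - length u) + (e - length v)) - 1"

definition total_room :: "nat \<times> nat \<Rightarrow> nat \<Rightarrow> config \<Rightarrow> nat" where
  "total_room D n p = (\<Sum>i\<le>n. room D (p i))"

lemma room_child: assumes "allowed D c a"
  shows "room D (child c False a) + room D (child c True a) < room D a"
proof -
  obtain s u v d e where a: "a = (s, u, v)" "D = (d, e)" by (cases a; cases D)
  have *: "(2::nat) ^ k - 1 + (2 ^ k - 1) < 2 ^ Suc k - 1" for k
  proof -
    have "(1::nat) \<le> 2 ^ k" by simp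
    thus ?thesis unfolding power_Suc by linarith
  qed
  show ?thesis
  proof (cases c)
    case Vert
    define k where "k = d - Suc (length u) + (e - length v)"
    have "d - length u + (e - length v) = Suc k" using Vert assms a by (auto simp: k_def)
    thus ?thesis using *[of k] by (simp only: Vert a child.simps room.simps length_append_singleton k_def)
  next
    case Horiz
    define k where "k = d - length u + (e - Suc (length v))"
    have "d - length u + (e - length v) = Suc k" using Horiz assms a by (auto simp: k_def)
    thus ?thesis using *[of k] by (simp only: Horiz a child.simps room.simps length_append_singleton k_def)
  qed
qed

lemma sum_split_at:
  fixes f :: "addr \<Rightarrow> nat"
  assumes "k \<le> n"
  shows "(\<Sum>i\<le>Suc n. f (split_at c k p i)) + f (p k)
    = (\<Sum>i\<le>n. f (p i)) + f (child c False (p k)) + f (child c True (p k))"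
  using assms
proof (induction n rule: dec_induct)
  case base
  have "(\<Sum>i<k. f (split_at c k p i)) = (\<Sum>i<k. f (p i))"
    by (intro sum.cong) (auto simp: split_at_def)
  thus ?case by (simp add: atMost_Suc lessThan_Suc_atMost[symmetric] split_at_def)
next
  case (step n)
  hence "split_at c k p (Suc (Suc n)) = p (Suc n)" by (simp add: split_at_def)
  with step show ?case by simp
qed

lemma sum_swap_at:
  fixes f :: "addr \<Rightarrow> nat"
  assumes "Suc k \<le> n"
  shows "(\<Sum>i\<le>n. f (swap_at k p i)) = (\<Sum>i\<le>n. f (p i))"
  using assms
proof (induction n rule: dec_induct)
  case base
  have "(\<Sum>i<k. f (swap_at k p i)) = (\<Sum>i<k. f (p i))"
    by (intro sum.cong) (auto simp: swap_at_def)
  thus ?case by (simp add: atMost_Suc lessThan_Suc_atMost[symmetric] swap_at_def)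
next
  case (step n)
  hence "swap_at k p (Suc n) = p (Suc n)" by (simp add: swap_at_def)
  with step show ?case by simp
qed

lemma total_room_split:
  assumes "k \<le> n" "allowed D c (p k)" shows "total_room D (Suc n) (split_at c k p) < total_room D n p"
  using sum_split_at[OF assms(1), of "room D" c p] room_child[OF assms(2)]
  unfolding total_room_def by linarith

lemma total_room_swap: "k < n \<Longrightarrow> total_room D n (swap_at k p) = total_room D n p"
  unfolding total_room_def by (rule sum_swap_at) simp

definition pick :: "nat \<times> nat \<Rightarrow> nat \<Rightarrow> config \<Rightarrow> nat \<times> dir" where
  "pick D n p = (SOME (k, c). k \<le> n \<and> allowed D c (p k))"

lemma pick:
  assumes "\<exists>k\<le>n. \<exists>c. allowed D c (p k)"
  obtains k c where "pick D n p = (k, c)" "k \<le> n" "allowed D c (p k)"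
proof -
  from assms have "\<exists>kc. case kc of (k, c) \<Rightarrow> k \<le> n \<and> allowed D c (p k)" by auto
  from someI_ex[OF this] show ?thesis using that unfolding pick_def
    by (metis (mono_tags, lifting) case_prod_unfold prod.collapse)
qed

text \<open>\<open>E n k c\<close> is the factor for dividing rectangle \<open>k\<close> of a configuration of
size \<open>n\<close>, and \<open>S n k\<close> the factor for exchanging the numbers \<open>k\<close> and
\<open>k + 1\<close>. The laws mirror the identities between configurations above; the one for
\<open>split_swap_left\<close> follows from the others (\<open>S_E_left\<close>).\<close>

locale pattern_calculus =
  fixes E :: "nat \<Rightarrow> nat \<Rightarrow> dir \<Rightarrow> 'g::mult_group" and S :: "nat \<Rightarrow> nat \<Rightarrow> 'g"
  assumes E_E: "k < l \<Longrightarrow> l \<le> n \<Longrightarrow> E n k c * E (Suc n) (Suc l) d = E n l d * E (Suc n) k c"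
    and E_cross: "k \<le> n \<Longrightarrow>
      E n k Horiz * (E (Suc n) k Vert * E (Suc (Suc n)) (Suc (Suc k)) Vert)
      = E n k Vert * (E (Suc n) k Horiz * (E (Suc (Suc n)) (Suc (Suc k)) Horiz * S (Suc (Suc (Suc n))) (Suc k)))"
    and S_S: "k < n \<Longrightarrow> S n k * S n k = 1"
    and S_commute: "Suc k < l \<Longrightarrow> l < n \<Longrightarrow> S n k * S n l = S n l * S n k"
    and S_braid: "Suc k < n \<Longrightarrow> S n k * (S n (Suc k) * S n k) = S n (Suc k) * (S n k * S n (Suc k))"
    and S_E_below: "l < k \<Longrightarrow> k < n \<Longrightarrow> S n k * E n l c = E n l c * S (Suc n) (Suc k)"
    and S_E_above: "Suc k < l \<Longrightarrow> l \<le> n \<Longrightarrow> S n k * E n l c = E n l c * S (Suc n) k"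
    and S_E_right: "k < n \<Longrightarrow> S n k * E n (Suc k) c = E n k c * (S (Suc n) (Suc k) * S (Suc n) k)"
begin

lemma S_S': "k < n \<Longrightarrow> S n k * (S n k * x) = x"
  by (simp add: mult.assoc[symmetric] S_S)

lemma S_E_left: assumes "k < n"
  shows "S n k * E n k c = E n (Suc k) c * (S (Suc n) k * S (Suc n) (Suc k))"
proof -
  have "E n (Suc k) c * (S (Suc n) k * S (Suc n) (Suc k))
      = S n k * (S n k * E n (Suc k) c) * (S (Suc n) k * S (Suc n) (Suc k))"
    using assms by (simp add: S_S' mult.assoc)
  also have "\<dots> = S n k * E n k c"
    using assms unfolding S_E_right[OF assms] by (simp add: S_S S_S' mult.assoc)
  finally show ?thesis ..
qed

primrec weight :: "nat \<Rightarrow> move \<Rightarrow> 'g" where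
  "weight n (Split c k) = E n k c"
| "weight n (Swap k) = S n k"

primrec val :: "nat \<Rightarrow> move list \<Rightarrow> 'g" where
  "val n [] = 1"
| "val n (m # ms) = weight n m * val (next_size n m) ms"

lemma val_append: "val n (ms @ ms') = val n ms * val (final_size n ms) ms'"
  by (induction ms arbitrary: n) (auto simp: mult.assoc)

text \<open>The product along a refinement to the grid, followed by sorting.  The choice of the cell
to be divided next is arbitrary; \<open>grid_val_moves\<close> shows that it has no influence.  Addresses are
compared by their codes, since any linear order will do.\<close>

function grid_val :: "nat \<times> nat \<Rightarrow> nat \<Rightarrow> config \<Rightarrow> 'g" where
  "grid_val D n p = (if \<exists>k\<le>n. \<exists>c. allowed D c (p k)
     then E n (fst (pick D n p)) (snd (pick D n p)) *
        grid_val D (Suc n) (split_at (snd (pick D n p)) (fst (pick D n p)) p)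
     else inverse (sortval (S n) 0 (map (\<lambda>i. to_nat (p i)) [0..<Suc n])))"
  by pat_completeness auto
termination
proof (relation "measure (\<lambda>(D, n, p). total_room D n p)", goal_cases)
  case (2 D n p)
  then obtain k c where "pick D n p = (k, c)" "k \<le> n" "allowed D c (p k)"
    by (rule pick)
  thus ?case using total_room_split[of k n D c p] by simp
qed simp

declare grid_val.simps [simp del]

lemma grid_val_full: "\<not> (\<exists>k\<le>n. \<exists>c. allowed D c (p k)) \<Longrightarrow>
    grid_val D n p = inverse (sortval (S n) 0 (map (\<lambda>i. to_nat (p i)) [0..<Suc n]))"
  by (subst grid_val.simps) (simp only: if_False)

lemma coxeter_S: "coxeter (S n) n"
  by unfold_locales (auto intro: S_S S_commute S_braid)

text \<open>Induction on the room that is left.  Two divisions of different rectangles, or of the same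
rectangle in different directions, can be completed to a square by divisions (and one exchange), and
the induction hypothesis applies to the configurations reached by them.  Hence all first divisions
give the same product, in particular the one chosen in the definition.  An exchange can be postponed
until after a division; if no division is left, it is absorbed by the sorting.\<close>

lemma grid_val_moves:
  assumes "tiling p"
  shows "(\<forall>k\<le>n. \<forall>c. allowed D c (p k) \<longrightarrow> grid_val D n p = E n k c * grid_val D (Suc n) (split_at c k p))
    \<and> (\<forall>k<n. grid_val D n p = S n k * grid_val D n (swap_at k p))"
  using assms
proof (induction "total_room D n p" arbitrary: n p rule: less_induct)
  case (less n p)
  let ?g = "grid_val D"
  have IH_split: "?g m q = E m k c * ?g (Suc m) (split_at c k q)"
    if "total_room D m q < total_room D n p" "tiling q" "k \<le> m" "allowed D c (q k)" for m q k c
    using less.hyps[OF that(1,2)] that by blast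
  have IH_swap: "?g m q = S m k * ?g m (swap_at k q)"
    if "total_room D m q < total_room D n p" "tiling q" "k < m" for m q k
    using less.hyps[OF that(1,2)] that by blast
  (* Both ways of cutting one cell into quarters; the two middle quarters come in opposite order. *)
  have same_square: "E n k Vert * ?g (Suc n) (split_at Vert k q) = E n k Horiz * ?g (Suc n) (split_at Horiz k q)"
    if q: "total_room D n q = total_room D n p" "tiling q" "k \<le> n" "allowed D Vert (q k)" "allowed D Horiz (q k)"
    for q k
  proof -
    have al: "allowed D Horiz (child Vert b (q k))" "allowed D Vert (child Horiz b (q k))" for b
      using q(4,5) by (cases D; cases "q k"; auto)+
    let ?V = "split_at Vert k q" and ?H = "split_at Horiz k q"
    let ?VH = "split_at Horiz k ?V" and ?HV = "split_at Vert k ?H"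
    let ?VHH = "split_at Horiz (Suc (Suc k)) ?VH" and ?HVV = "split_at Vert (Suc (Suc k)) ?HV"
    have at: "?V k = child Vert False (q k)" "?VH (Suc (Suc k)) = child Vert True (q k)"
      "?H k = child Horiz False (q k)" "?HV (Suc (Suc k)) = child Horiz True (q k)"
      by (simp_all add: split_at_def)
    have lt1: "total_room D (Suc n) ?V < total_room D n p" "total_room D (Suc n) ?H < total_room D n p"
      using total_room_split[of k n D _ q] q by auto
    have lt2: "total_room D (Suc (Suc n)) ?VH < total_room D n p" "total_room D (Suc (Suc n)) ?HV < total_room D n p"
      using lt1 total_room_split[of k "Suc n" D _ ?V] total_room_split[of k "Suc n" D _ ?H] q(3)
      by (simp_all add: at al) (meson al less_trans)+
    have lt3: "total_room D (Suc (Suc (Suc n))) ?VHH < total_room D n p"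
      using lt2 total_room_split[of "Suc (Suc k)" "Suc (Suc n)" D Horiz ?VH] q(3) by (auto simp: at al)
    have "E n k Vert * ?g (Suc n) ?V = E n k Vert * (E (Suc n) k Horiz * (E (Suc (Suc n)) (Suc (Suc k)) Horiz
        * (S (Suc (Suc (Suc n))) (Suc k) * ?g (Suc (Suc (Suc n))) (swap_at (Suc k) ?VHH))))"
      using IH_split[OF lt1(1), of k Horiz] IH_split[OF lt2(1), of "Suc (Suc k)" Horiz]
        IH_swap[OF lt3, of "Suc k"] q by (simp add: at al)
    also have "\<dots> = E n k Horiz * (E (Suc n) k Vert * E (Suc (Suc n)) (Suc (Suc k)) Vert)
        * ?g (Suc (Suc (Suc n))) (swap_at (Suc k) ?VHH)"
      unfolding E_cross[OF q(3)] by (simp add: mult.assoc)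
    also have "\<dots> = E n k Horiz * ?g (Suc n) ?H"
      using IH_split[OF lt1(2), of k Vert] IH_split[OF lt2(2), of "Suc (Suc k)" Vert] q
      by (simp add: at al split_cross mult.assoc)
    finally show ?thesis .
  qed
  have different: "E n k c * ?g (Suc n) (split_at c k q) = E n l d * ?g (Suc n) (split_at d l q)"
    if q: "total_room D n q = total_room D n p" "tiling q" "k < l" "l \<le> n"
        "allowed D c (q k)" "allowed D d (q l)" for q k l c d
  proof -
    have at: "split_at c k q (Suc l) = q l" "split_at d l q k = q k"
      using q by (simp_all add: split_at_def)
    have lt: "total_room D (Suc n) (split_at c k q) < total_room D n p"
      "total_room D (Suc n) (split_at d l q) < total_room D n p"
      using total_room_split[of k n D c q] total_room_split[of l n D d q] q by auto
    have "E n k c * ?g (Suc n) (split_at c k q) = (E n k c * E (Suc n) (Suc l) d)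
        * ?g (Suc (Suc n)) (split_at d (Suc l) (split_at c k q))"
      using IH_split[OF lt(1), of "Suc l" d] q by (simp add: at mult.assoc)
    also have "\<dots> = E n l d * (E (Suc n) k c * ?g (Suc (Suc n)) (split_at c k (split_at d l q)))"
      using q by (simp add: E_E split_split mult.assoc)
    also have "\<dots> = E n l d * ?g (Suc n) (split_at d l q)"
      using IH_split[OF lt(2), of k c] q by (simp add: at)
    finally show ?thesis .
  qed
  have any: "E n k c * ?g (Suc n) (split_at c k q) = E n l d * ?g (Suc n) (split_at d l q)"
    if q: "total_room D n q = total_room D n p" "tiling q" "k \<le> n" "l \<le> n"
        "allowed D c (q k)" "allowed D d (q l)" for q k l c d
  proof -
    consider "k < l" | "l < k" | "k = l" "c = d" | "k = l" "c = Vert" "d = Horiz" | "k = l" "c = Horiz" "d = Vert"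
      by (metis dir.exhaust linorder_neqE_nat)
    thus ?thesis
    proof cases
      case 1
      thus ?thesis using q by (intro different) auto
    next
      case 2
      thus ?thesis using q by (intro different[symmetric]) auto
    next
      case 4
      thus ?thesis using q same_square[of q k] by simp
    next
      case 5
      thus ?thesis using q same_square[of q k] by simp
    qed simp
  qed
  have split: "?g n q = E n k c * ?g (Suc n) (split_at c k q)"
    if q: "total_room D n q = total_room D n p" "tiling q" "k \<le> n" "allowed D c (q k)" for q k c
  proof -
    have ex: "\<exists>k\<le>n. \<exists>c. allowed D c (q k)" using q by blast
    then obtain l d where l: "pick D n q = (l, d)" "l \<le> n" "allowed D d (q l)" by (rule pick)
    have "?g n q = E n l d * ?g (Suc n) (split_at d l q)"
      using ex by (subst grid_val.simps) (simp only: if_True l fst_conv snd_conv)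
    thus ?thesis using any[OF q(1-3) l(2) q(4) l(3)] by simp
  qed
  have swap: "?g n p = S n k * ?g n (swap_at k p)" if k: "k < n" for k
  proof (cases "\<exists>k\<le>n. \<exists>c. allowed D c (p k)")
    case False
    interpret coxeter "S n" n by (rule coxeter_S)
    have False': "\<not> (\<exists>i\<le>n. \<exists>c. allowed D c (swap_at k p i))"
    proof safe
      fix i c assume "i \<le> n" "allowed D c (swap_at k p i)"
      moreover have "swap_at k p i = p (if i = k then Suc k else if i = Suc k then k else i)"
        by (simp add: swap_at_def)
      moreover have "(if i = k then Suc k else if i = Suc k then k else i) \<le> n"
        using \<open>i \<le> n\<close> k by simp
      ultimately show False using False by metis
    qed
    let ?xs = "map (\<lambda>i. to_nat (p i)) [0..<Suc n]"
    have "map (\<lambda>i. to_nat (swap_at k p i)) [0..<Suc n] = map to_nat (lswap k (map p [0..<Suc n]))"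
      using arg_cong[OF map_swap_at[of k "Suc n" p], of "map to_nat"] k by (simp add: comp_def)
    moreover have "map f (lswap k xs) = lswap k (map f xs)" for f :: "addr \<Rightarrow> nat" and xs
      by (induction k xs rule: lswap.induct) auto
    ultimately have *: "map (\<lambda>i. to_nat (swap_at k p i)) [0..<Suc n] = lswap k ?xs"
      by (simp add: comp_def)
    have "distinct ?xs"
      unfolding distinct_map
      by (intro conjI distinct_upt inj_onI) (use tiling_inj[OF less.prems] in \<open>simp only: to_nat_split inj_eq\<close>)
    hence "sortval (S n) 0 (lswap k ?xs) = sortval (S n) 0 ?xs * S n k"
      using sortval_lswap[of ?xs k 0] k by simp
    thus ?thesis using k unfolding grid_val_full[OF False] grid_val_full[OF False'] *
      by (simp add: group_inverse_unique[OF S_S] S_S')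
  next
    case True
    then obtain l c where l: "l \<le> n" "allowed D c (p l)" by blast
    note room = total_room_swap[OF k, of D p] total_room_split[of l n D c p, OF l]
    have gp: "?g n p = E n l c * ?g (Suc n) (split_at c l p)" using split l less.prems by blast
    have sw: "?g n (swap_at k p) = E n i c * ?g (Suc n) (split_at c i (swap_at k p))"
      if "i \<le> n" "swap_at k p i = p l" for i
      using that l less.prems room by (intro split) auto
    have IH: "?g (Suc n) (split_at c l p) = S (Suc n) i * ?g (Suc n) (swap_at i (split_at c l p))"
      if "i \<le> n" for i using that less.prems room by (intro IH_swap) auto
    have IH2: "?g (Suc n) (split_at c l p)
        = S (Suc n) i * (S (Suc n) j * ?g (Suc n) (swap_at j (swap_at i (split_at c l p))))"
      if "i \<le> n" "j \<le> n" for i j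
    proof -
      have "?g (Suc n) (swap_at i (split_at c l p))
         = S (Suc n) j * ?g (Suc n) (swap_at j (swap_at i (split_at c l p)))"
        using that less.prems room total_room_swap[of i "Suc n" D "split_at c l p"] by (intro IH_swap) auto
      thus ?thesis using IH[OF that(1)] by simp
    qed
    consider "l < k" | "Suc k < l" | "l = k" | "l = Suc k" by linarith
    thus ?thesis
    proof cases
      case 1
      have "swap_at k p l = p l" using 1 by (simp add: swap_at_def)
      hence "S n k * ?g n (swap_at k p)
          = S n k * E n l c * ?g (Suc n) (swap_at (Suc k) (split_at c l p))"
        using sw[of l] l by (simp add: split_swap_below 1 mult.assoc)
      thus ?thesis using gp IH[of "Suc k"] k 1 by (simp add: S_E_below mult.assoc)
    next
      case 2
      have "swap_at k p l = p l" using 2 by (simp add: swap_at_def)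
      hence "S n k * ?g n (swap_at k p)
          = S n k * E n l c * ?g (Suc n) (swap_at k (split_at c l p))"
        using sw[of l] l by (simp add: split_swap_above 2 mult.assoc)
      thus ?thesis using gp IH[of k] k 2 l by (simp add: S_E_above mult.assoc)
    next
      case 3
      have "swap_at k p (Suc k) = p l" using 3 by (simp add: swap_at_def)
      hence "S n k * ?g n (swap_at k p)
          = S n k * E n (Suc k) c * ?g (Suc n) (swap_at k (swap_at (Suc k) (split_at c l p)))"
        using sw[of "Suc k"] k by (simp add: split_swap_right 3 mult.assoc)
      thus ?thesis using gp IH2[of "Suc k" k] k 3 by (simp add: S_E_right mult.assoc)
    next
      case 4
      have "swap_at k p k = p l" using 4 by (simp add: swap_at_def)
      hence "S n k * ?g n (swap_at k p)
          = S n k * E n k c * ?g (Suc n) (swap_at (Suc k) (swap_at k (split_at c l p)))"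
        using sw[of k] k by (simp add: split_swap_left 4 mult.assoc)
      thus ?thesis using gp IH2[of k "Suc k"] k 4 by (simp add: S_E_left mult.assoc)
    qed
  qed
  show ?case using split[OF HOL.refl less.prems] swap by blast
qed

end

fun fits :: "nat \<times> nat \<Rightarrow> addr \<Rightarrow> bool" where
  "fits (d, e) (s, u, v) \<longleftrightarrow> length u \<le> d \<and> length v \<le> e"

lemma fits_child: "fits D (child c b a) \<longleftrightarrow> fits D a \<and> allowed D c a"
  by (cases D; cases a; cases c) auto

definition all_fit :: "nat \<times> nat \<Rightarrow> nat \<Rightarrow> config \<Rightarrow> bool" where
  "all_fit D n p \<longleftrightarrow> (\<forall>i\<le>n. fits D (p i))"

lemma all_fit_split: assumes "k \<le> n"
  shows "all_fit D (Suc n) (split_at c k p) \<longleftrightarrow> all_fit D n p \<and> allowed D c (p k)"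
proof
  assume *: "all_fit D (Suc n) (split_at c k p)"
  have "fits D (split_at c k p k)" using * assms unfolding all_fit_def by simp
  hence pk: "fits D (p k)" "allowed D c (p k)" by (auto simp: split_at_def fits_child)
  have "fits D (p i)" if "i \<le> n" "i \<noteq> k" for i
  proof -
    have "split_at c k p (if i < k then i else Suc i) = p i" using that by (simp add: split_at_def)
    moreover have "fits D (split_at c k p (if i < k then i else Suc i))"
      using * that unfolding all_fit_def by simp
    ultimately show ?thesis by simp
  qed
  with pk show "all_fit D n p \<and> allowed D c (p k)" unfolding all_fit_def by blast
next
  assume "all_fit D n p \<and> allowed D c (p k)"
  thus "all_fit D (Suc n) (split_at c k p)" using assms
    unfolding all_fit_def by (auto simp: split_at_def fits_child)
qed

lemma all_fit_swap: assumes "k < n" shows "all_fit D n (swap_at k p) \<longleftrightarrow> all_fit D n p"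
proof -
  have "all_fit D n (swap_at k p)" if "all_fit D n p" for p
    using that assms unfolding all_fit_def by (auto simp: swap_at_def)
  from this[of p] this[of "swap_at k p"] show ?thesis by (auto simp: swap_swap)
qed

lemma all_fit_run: "valid n ms \<Longrightarrow> all_fit D (final_size n ms) (run ms p) \<Longrightarrow> all_fit D n p"
proof (induction ms arbitrary: n p)
  case (Cons m ms)
  hence "all_fit D (next_size n m) (act m p)" by simp
  with Cons.prems(1) show ?case by (cases m) (auto simp: all_fit_split all_fit_swap)
qed simp

lemma all_fit_exists: "\<exists>D. all_fit D n p"
proof -
  let ?d = "\<lambda>i. length (fst (snd (p i)))" and ?e = "\<lambda>i. length (snd (snd (p i)))"
  have "fits (sum ?d {..n}, sum ?e {..n}) (p i)" if "i \<le> n" for i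
    using member_le_sum[of i "{..n}" ?d] member_le_sum[of i "{..n}" ?e] that
    by (cases "p i") auto
  thus ?thesis unfolding all_fit_def by blast
qed

context pattern_calculus begin

lemma grid_val_run:
  assumes "tiling p" "valid n ms" "all_fit D (final_size n ms) (run ms p)"
  shows "grid_val D n p = val n ms * grid_val D (final_size n ms) (run ms p)"
  using assms
proof (induction ms arbitrary: n p)
  case (Cons m ms)
  have "all_fit D (next_size n m) (act m p)" using Cons.prems all_fit_run[of "next_size n m" ms D "act m p"] by simp
  hence "grid_val D n p = weight n m * grid_val D (next_size n m) (act m p)"
    using grid_val_moves[OF Cons.prems(1), of n D] Cons.prems(2)
    by (cases m) (simp_all add: all_fit_split)
  moreover have "grid_val D (next_size n m) (act m p)
      = val (next_size n m) ms * grid_val D (final_size n (m # ms)) (run (m # ms) p)"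
    using Cons by (auto simp: tiling_act)
  ultimately show ?case by (simp add: mult.assoc)
qed simp

text \<open>The factor of a sequence of moves is the quotient of the grid values at its two ends, for any grid
fine enough for the final configuration.\<close>

theorem coherence:
  assumes "tiling p" "valid n ms" "valid n ms'" "final_size n ms = final_size n ms'" "run ms p = run ms' p"
  shows "val n ms = val n ms'"
proof -
  obtain D where "all_fit D (final_size n ms) (run ms p)" using all_fit_exists by blast
  hence "val n ms * grid_val D (final_size n ms) (run ms p) = val n ms' * grid_val D (final_size n ms) (run ms p)"
    using grid_val_run assms by metis
  thus ?thesis by (simp add: group_right_cancel)
qed

end


section \<open>From the given relations to all indices\<close>

primrec eval :: "('x \<Rightarrow> 'g::mult_group) \<Rightarrow> 'x word \<Rightarrow> 'g" where
  "eval f [] = 1"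
| "eval f (xe # w) = (if snd xe then f (fst xe) else inverse (f (fst xe))) * eval f w"

lemma eval_append [simp]: "eval f (u @ v) = eval f u * eval f v"
  by (induction u) (auto simp: mult.assoc)

lemma eval_word_inv [simp]: "eval f (word_inv w) = inverse (eval f w)"
  by (induction w) (auto simp: word_inv_def)

lemma eval_replicate: "eval f (replicate n (x, e)) = (if e then f x else inverse (f x)) ^ n"
  by (induction n) auto

text \<open>The relations for all indices, with \<open>a\<close>, \<open>b\<close>, \<open>p\<close>,
\<open>q\<close>, \<open>c\<close> in the roles of the families \<open>A\<close>, \<open>B\<close>,
\<open>\<pi>\<close>, barred \<open>\<pi>\<close> and \<open>C\<close>.\<close>

locale pattern_families =
  fixes a b p q c :: "nat \<Rightarrow> 'g::mult_group"
  assumes a_a: "i < j \<Longrightarrow> a j * a i = a i * a (Suc j)"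
    and b_a: "i < j \<Longrightarrow> b j * a i = a i * b (Suc j)"
    and p_a: "i < j \<Longrightarrow> p j * a i = a i * p (Suc j)"
    and q_a: "i < j \<Longrightarrow> q j * a i = a i * q (Suc j)"
    and c_a: "i < j \<Longrightarrow> c j * a i = a i * c (Suc j)"
    and a_b: "i < j \<Longrightarrow> a j * b i = b i * a (Suc j)"
    and b_b: "i < j \<Longrightarrow> b j * b i = b i * b (Suc j)"
    and p_b: "i < j \<Longrightarrow> p j * b i = b i * p (Suc j)"
    and q_b: "i < j \<Longrightarrow> q j * b i = b i * q (Suc j)"
    and c_b: "i < j \<Longrightarrow> c j * b i = b i * c (Suc j)"
    and a_p: "Suc i < j \<Longrightarrow> p i * a j = a j * p i"
    and b_p: "Suc i < j \<Longrightarrow> p i * b j = b j * p i"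
    and p_p: "Suc i < j \<Longrightarrow> p i * p j = p j * p i"
    and q_p: "Suc i < j \<Longrightarrow> p i * q j = q j * p i"
    and c_p: "Suc i < j \<Longrightarrow> p i * c j = c j * p i"
    and p_a_same: "p i * a i = a (Suc i) * (p i * p (Suc i))"
    and p_b_same: "p i * b i = b (Suc i) * (p i * p (Suc i))"
    and q_a_same: "q i * a i = p i * q (Suc i)"
    and q_b_same: "q i * b i = c (Suc i) * (p i * q (Suc i))"
    and p_square: "p i * p i = 1"
    and q_square: "q i * q i = 1"
    and p_braid: "p i * (p (Suc i) * p i) = p (Suc i) * (p i * p (Suc i))"
    and q_braid: "p i * (q (Suc i) * p i) = q (Suc i) * (p i * q (Suc i))"
    and cross_ab: "a i * (b (Suc i) * b i) = b i * (a (Suc i) * (a i * p (Suc i)))"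
    and cross_c: "c i * a i = b i * (c (Suc (Suc i)) * p (Suc i))"
begin

text \<open>Rectangle \<open>k > 0\<close> of the spine stays in place when the spine grows, and \<open>n -
k\<close> is what remains constant. Rectangle 0 is the tip: dividing it vertically only prolongs the spine,
whence the factor 1.\<close>

fun E :: "nat \<Rightarrow> nat \<Rightarrow> dir \<Rightarrow> 'g" where
  "E n 0 Vert = 1"
| "E n 0 Horiz = c n"
| "E n (Suc k) Vert = a (n - Suc k)"
| "E n (Suc k) Horiz = b (n - Suc k)"

fun S :: "nat \<Rightarrow> nat \<Rightarrow> 'g" where
  "S n 0 = q (n - 1)"
| "S n (Suc k) = p (n - Suc (Suc k))"

lemma p_square': "p i * (p i * x) = x"
  by (simp add: mult.assoc[symmetric] p_square)

sublocale pattern_calculus E S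
proof
  fix k l n :: nat and d e
  note [simp] = mult.assoc
  show "E n k d * E (Suc n) (Suc l) e = E n l e * E (Suc n) k d" if "k < l" "l \<le> n"
  proof -
    obtain l' where l: "l = Suc l'" using \<open>k < l\<close> by (cases l) auto
    show ?thesis
    proof (cases k)
      case 0
      thus ?thesis using that unfolding l by (cases d; cases e) (auto simp: c_a c_b)
    next
      case (Suc k')
      have "n - k' = Suc (n - Suc k')" using that Suc by auto
      thus ?thesis using that Suc unfolding l by (cases d; cases e) (auto simp: a_a b_a a_b b_b)
    qed
  qed
  show "E n k Horiz * (E (Suc n) k Vert * E (Suc (Suc n)) (Suc (Suc k)) Vert)
      = E n k Vert * (E (Suc n) k Horiz * (E (Suc (Suc n)) (Suc (Suc k)) Horiz
        * S (Suc (Suc (Suc n))) (Suc k)))" if "k \<le> n"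
  proof (cases k)
    case 0
    have "c n * a n = (c (Suc n) * b n) * p (Suc n)" unfolding cross_c c_b[OF lessI] by simp
    thus ?thesis by (simp add: 0)
  next
    case (Suc k')
    define i where "i = n - k"
    have [simp]: "n - Suc k' = i" "n - k' = Suc i" using that Suc by (auto simp: i_def)
    have "b i * (a (Suc i) * a i) = b i * (a (Suc i) * (a i * p (Suc i))) * p (Suc i)"
      by (simp add: p_square)
    also have "\<dots> = a i * (b (Suc i) * (b i * p (Suc i)))" unfolding cross_ab[symmetric] by simp
    finally show ?thesis using Suc by simp
  qed
  show "S n k * S n k = 1" if "k < n" by (cases k) (simp_all add: p_square q_square)
  show "S n k * S n l = S n l * S n k" if "Suc k < l" "l < n"
    using that p_p[of "n - Suc l" "n - Suc k"] q_p[of "n - Suc l" "n - 1"]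
    by (cases k; cases l) auto
  show "S n k * (S n (Suc k) * S n k) = S n (Suc k) * (S n k * S n (Suc k))" if "Suc k < n"
  proof -
    define i where "i = n - Suc (Suc k)"
    have "n - Suc k = Suc i" using that by (simp add: i_def)
    thus ?thesis using p_braid[of i] q_braid[of i] by (cases k) (simp_all add: i_def)
  qed
  show "S n k * E n l d = E n l d * S (Suc n) (Suc k)" if "l < k" "k < n"
    using that a_p[of "n - Suc k" "n - l"] b_p[of "n - Suc k" "n - l"] c_p[of "n - Suc k" "n - l"]
    by (cases k; cases l; cases d) auto
  show "S n k * E n l d = E n l d * S (Suc n) k" if "Suc k < l" "l \<le> n"
  proof -
    obtain l' where l: "l = Suc l'" using \<open>Suc k < l\<close> by (cases l) auto
    have "n - k = Suc (n - Suc k)" using that by auto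
    thus ?thesis using that p_a[of "n - l" "n - Suc k"] p_b[of "n - l" "n - Suc k"]
      q_a[of "n - l" "n - Suc k"] q_b[of "n - l" "n - Suc k"]
      by (cases k; cases d) (auto simp: l)
  qed
  show "S n k * E n (Suc k) d = E n k d * (S (Suc n) (Suc k) * S (Suc n) k)" if "k < n"
  proof -
    define i where "i = n - Suc k"
    have "n - k = Suc i" using that by (simp add: i_def)
    thus ?thesis using p_a_same[of i] p_b_same[of i] q_a_same[of i] q_b_same[of i] that
      by (cases k; cases d) (simp_all add: i_def)
  qed
qed

end

definition conj_by :: "'g::mult_group \<Rightarrow> 'g \<Rightarrow> 'g" where "conj_by z x = inverse z * (x * z)"

lemma conj_by_mult: "conj_by z (x * y) = conj_by z x * conj_by z y"
  by (simp add: conj_by_def mult.assoc)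

lemma conj_by_inverse: "conj_by z (inverse x) = inverse (conj_by z x)"
  by (simp add: conj_by_def mult.assoc)

lemma conj_by_1 [simp]: "conj_by z 1 = 1"
  by (simp add: conj_by_def)

lemma conj_by_eq_iff: "conj_by z x = y \<longleftrightarrow> x * z = z * y"
  unfolding conj_by_def by (metis group_inverse_cancel(3,4))

text \<open>From index 1 on, the abbreviations are successive conjugates by \<open>A\<^sub>0\<close>, and then
so are the two sides of every relation.\<close>

definition shift_seq :: "'g::mult_group \<Rightarrow> (nat \<Rightarrow> 'g) \<Rightarrow> bool" where
  "shift_seq z x \<longleftrightarrow> (\<forall>i\<ge>1. x (Suc i) = conj_by z (x i))"

lemma shift_seqD: "shift_seq z x \<Longrightarrow> 1 \<le> i \<Longrightarrow> conj_by z (x i) = x (Suc i)"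
  unfolding shift_seq_def by auto

lemma commutation_shift:
  assumes "shift_seq z x" "shift_seq z y" "1 \<le> i" "1 \<le> j" "x j * y i = y i * x (Suc j)"
  shows "x (Suc j) * y (Suc i) = y (Suc i) * x (Suc (Suc j))"
proof -
  have "conj_by z (x j) * conj_by z (y i) = conj_by z (y i) * conj_by z (x (Suc j))"
    by (simp only: conj_by_mult[symmetric] assms(5))
  thus ?thesis using assms(3,4) by (simp add: shift_seqD[OF assms(1)] shift_seqD[OF assms(2)])
qed

text \<open>Here \<open>x\<close>, \<open>x1\<close>, \<open>x2\<close> are consecutive members of a family,
conjugate by \<open>u\<close> and by \<open>v\<close>; as \<open>w\<close> takes \<open>u\<close> to
\<open>v\<close>, it takes a relation between \<open>x\<close> and \<open>x1\<close> to one between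
\<open>x1\<close> and \<open>x2\<close>.\<close>

lemma commutation_step:
  assumes "u * w = w * v" "x * u = u * x1" "x1 * v = v * x2" "x * w = w * x1"
  shows "x1 * w = w * (x2 :: 'g::mult_group)"
proof -
  have x1: "x1 = inverse u * (x * u)" using assms(2) by simp
  have uv: "inverse u * w = w * inverse v" by (metis assms(1) group_inverse_cancel mult.assoc mult_1_right)
  have "x1 * w = inverse u * (x * (w * v))" by (simp add: x1 mult.assoc assms(1))
  also have "\<dots> = inverse u * (w * (x1 * v))" by (simp add: mult.assoc[symmetric] assms(4))
  also have "\<dots> = (inverse u * w) * (v * x2)" by (simp add: mult.assoc assms(3))
  also have "\<dots> = w * x2" by (simp add: uv mult.assoc)
  finally show ?thesis .
qed

text \<open>Conjugation by \<open>a 0\<close> reduces everything to \<open>i = 1\<close>. For large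
\<open>j\<close>, the element \<open>x j\<close> is the conjugate of its predecessor by \<open>a 2\<close>,
which passes \<open>a 1\<close> as \<open>a 3\<close>; so each instance follows from earlier ones.\<close>

lemma family_past_a:
  fixes a :: "nat \<Rightarrow> 'g::mult_group"
  assumes a: "shift_seq (a 0) a" and x: "shift_seq (a 0) x"
    and a2: "a 2 * a 1 = a 1 * a 3" and x2: "x 2 * a 1 = a 1 * x 3" and x3: "x 3 * a 1 = a 1 * x 4"
    and "i < j"
  shows "x j * a i = a i * x (Suc j)"
proof -
  have one: "x j * a 1 = a 1 * x (Suc j)" if "2 \<le> j" for j
    using that
  proof (induction j rule: less_induct)
    case (less j)
    consider "j = 2" | "j = 3" | k where "j = Suc (Suc k)" "2 \<le> k"
      using less.prems by (metis One_nat_def Suc_1 Suc_le_mono le_Suc_eq le_add_diff_inverse numeral_3_eq_3 plus_1_eq_Suc)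
    thus ?case
    proof cases
      case 3
      have k: "x k * a 1 = a 1 * x (Suc k)" "x (Suc k) * a 1 = a 1 * x (Suc (Suc k))"
        using less.IH 3 by auto
      have s2: "x (Suc k) * a (Suc 1) = a (Suc 1) * x (Suc (Suc k))"
        using commutation_shift[OF x a _ _ k(1)] 3(2) by simp
      have s3: "x (Suc (Suc k)) * a (Suc (Suc 1)) = a (Suc (Suc 1)) * x (Suc (Suc (Suc k)))"
        using commutation_shift[OF x a _ _ s2] by simp
      show ?thesis unfolding 3(1)
        by (rule commutation_step[OF _ s2 s3 k(2)]) (use a2 in \<open>simp add: eval_nat_numeral\<close>)
    qed (use x2 x3 in \<open>simp_all add: eval_nat_numeral\<close>)
  qed
  show ?thesis using \<open>i < j\<close>
  proof (induction i arbitrary: j)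
    case 0
    thus ?case using shift_seqD[OF x, of j] unfolding conj_by_eq_iff by simp
  next
    case (Suc i)
    then obtain j' where j: "j = Suc j'" "i < j'" by (cases j) auto
    show ?case
    proof (cases "i = 0")
      case True
      thus ?thesis using one[of j] j by simp
    next
      case False
      thus ?thesis using commutation_shift[OF x a _ _ Suc.IH[of j']] j by simp
    qed
  qed
qed

text \<open>The same argument, now with two cases that conjugation by \<open>a 0\<close> does not relate,
\<open>i = 0\<close> and \<open>i = 1\<close>.\<close>

lemma family_past_b:
  fixes a :: "nat \<Rightarrow> 'g::mult_group"
  assumes b: "shift_seq (a 0) b" and x: "shift_seq (a 0) x"
    and x_a: "\<And>i j. i < j \<Longrightarrow> x j * a i = a i * x (Suc j)"
    and ab: "a 1 * b 0 = b 0 * a 2" "a 2 * b 1 = b 1 * a 3"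
    and xb0: "x 1 * b 0 = b 0 * x 2" "x 2 * b 0 = b 0 * x 3"
    and xb1: "x 2 * b 1 = b 1 * x 3" "x 3 * b 1 = b 1 * x 4"
    and "i < j"
  shows "x j * b i = b i * x (Suc j)"
proof -
  have zero: "x j * b 0 = b 0 * x (Suc j)" if "1 \<le> j" for j
    using that
  proof (induction j rule: dec_induct)
    case (step j)
    show ?case
    proof (cases "j = 1")
      case False
      thus ?thesis using step
        by (intro commutation_step[OF ab(1) x_a[of 1 j] x_a[of 2 "Suc j"]]) auto
    qed (use xb0 in \<open>simp add: eval_nat_numeral\<close>)
  qed (use xb0 in \<open>simp add: eval_nat_numeral\<close>)
  have one: "x j * b 1 = b 1 * x (Suc j)" if "2 \<le> j" for j
    using that
  proof (induction j rule: dec_induct)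
    case (step j)
    show ?case
    proof (cases "j = 2")
      case False
      thus ?thesis using step
        by (intro commutation_step[OF ab(2) x_a[of 2 j] x_a[of 3 "Suc j"]]) auto
    qed (use xb1 in \<open>simp add: eval_nat_numeral\<close>)
  qed (use xb1 in \<open>simp add: eval_nat_numeral\<close>)
  show ?thesis using \<open>i < j\<close>
  proof (induction i arbitrary: j)
    case (Suc i)
    then obtain j' where j: "j = Suc j'" "i < j'" by (cases j) auto
    show ?case
    proof (cases "i = 0")
      case True
      thus ?thesis using one[of j] j by simp
    next
      case False
      thus ?thesis using commutation_shift[OF x b _ _ Suc.IH[of j']] j by simp
    qed
  qed (use zero in simp)
qed

lemma commute_step:
  assumes "x * u = u * x1" "w * u = u * w" "w * x = x * w"
  shows "w * x1 = x1 * (w :: 'g::mult_group)"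
  using commutation_step[of u w u x x1 x1] assms
  by (metis mult.assoc group_left_cancel)

text \<open>As \<open>p 0\<close> commutes with \<open>a 2\<close>, it commutes with the conjugates by \<open>a
2\<close> of all elements that it commutes with; likewise for \<open>p 1\<close> and \<open>a 3\<close>.\<close>

lemma family_commute:
  fixes a :: "nat \<Rightarrow> 'g::mult_group"
  assumes p: "shift_seq (a 0) p" and x: "shift_seq (a 0) x"
    and x_a: "\<And>i j. i < j \<Longrightarrow> x j * a i = a i * x (Suc j)"
    and pa: "p 0 * a 2 = a 2 * p 0" "p 1 * a 3 = a 3 * p 1"
    and px0: "p 0 * x 2 = x 2 * p 0" "p 0 * x 3 = x 3 * p 0"
    and px1: "p 1 * x 3 = x 3 * p 1" "p 1 * x 4 = x 4 * p 1"
    and "Suc i < j"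
  shows "p i * x j = x j * p i"
proof -
  have zero: "p 0 * x j = x j * p 0" if "2 \<le> j" for j
    using that
  proof (induction j rule: dec_induct)
    case (step j)
    show ?case
    proof (cases "j = 2")
      case False
      thus ?thesis using step by (intro commute_step[OF x_a[of 2 j] pa(1)]) auto
    qed (use px0 in \<open>simp add: eval_nat_numeral\<close>)
  qed (use px0 in \<open>simp add: eval_nat_numeral\<close>)
  have one: "p 1 * x j = x j * p 1" if "3 \<le> j" for j
    using that
  proof (induction j rule: dec_induct)
    case (step j)
    show ?case
    proof (cases "j = 3")
      case False
      thus ?thesis using step by (intro commute_step[OF x_a[of 3 j] pa(2)]) auto
    qed (use px1 in \<open>simp add: eval_nat_numeral\<close>)
  qed (use px1 in \<open>simp add: eval_nat_numeral\<close>)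
  show ?thesis using \<open>Suc i < j\<close>
  proof (induction i arbitrary: j)
    case (Suc i)
    then obtain j' where j: "j = Suc j'" "Suc i < j'" by (cases j) auto
    show ?case
    proof (cases "i = 0")
      case True
      thus ?thesis using one[of j] j by simp
    next
      case False
      have "conj_by (a 0) (p i * x j') = conj_by (a 0) (x j' * p i)" using Suc.IH[of j'] j by simp
      thus ?thesis using False j by (simp add: conj_by_mult shift_seqD[OF p] shift_seqD[OF x])
    qed
  qed (use zero in simp)
qed

lemma shifted_0 [simp]: "eval f (shifted x 0) = f (x 0)" "eval f (shifted x (Suc 0)) = f (x 1)"
  by (simp_all add: shifted_def)

lemma shift_seq_shifted: "shift_seq (f (gA 0)) (\<lambda>i. eval f (shifted x i))"
  unfolding shift_seq_def
proof (intro allI impI)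
  fix i :: nat assume "1 \<le> i"
  then obtain j where i: "i = Suc j" by (cases i) auto
  let ?z = "f (gA 0)"
  have realize: "eval f (shifted x (Suc m)) = inverse ?z ^ m * (f (x 1) * ?z ^ m)" for m
    by (cases m) (simp_all add: shifted_def eval_replicate mult.assoc)
  show "eval f (shifted x (Suc i)) = conj_by ?z (eval f (shifted x i))"
    unfolding i realize conj_by_def by (simp add: mult.assoc power_commutes)
qed

definition satisfies :: "('x \<Rightarrow> 'g::mult_group) \<Rightarrow> ('x word \<times> 'x word) set \<Rightarrow> bool" where
  "satisfies f R \<longleftrightarrow> (\<forall>(l, r)\<in>R. eval f l = eval f r)"

lemma eval_wC: "eval f (wC m) = eval f (w\<pi>b m) * (eval f (wB m) * (eval f (w\<pi>b (Suc m)) * (eval f (w\<pi> m)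
    * (eval f (wB m) * (eval f (w\<pi> (Suc m)) * inverse (eval f (wA m)))))))"
  by (simp add: wC_def mult.assoc)

lemma families_of_relations:
  fixes f :: "gen \<Rightarrow> 'g::mult_group"
  assumes "satisfies f (relations1 \<union> relations2)"
  shows "pattern_families (\<lambda>i. eval f (wA i)) (\<lambda>i. eval f (wB i)) (\<lambda>i. eval f (w\<pi> i))
     (\<lambda>i. eval f (w\<pi>b i)) (\<lambda>i. eval f (wC i))"
proof -
  define a where "a = (\<lambda>i. eval f (wA i))"
  define b where "b = (\<lambda>i. eval f (wB i))"
  define p where "p = (\<lambda>i. eval f (w\<pi> i))"
  define q where "q = (\<lambda>i. eval f (w\<pi>b i))"
  define c where "c = (\<lambda>i. eval f (wC i))"
  note fold = a_def[THEN fun_cong, symmetric] b_def[THEN fun_cong, symmetric]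
    p_def[THEN fun_cong, symmetric] q_def[THEN fun_cong, symmetric] c_def[THEN fun_cong, symmetric]
  have r1: "satisfies f relations1" and r2: "satisfies f relations2"
    using assms by (auto simp: satisfies_def)
  note rel1 = r1[unfolded satisfies_def relations1_def ball_simps case_prod_conv eval_append eval.simps fold]
  note rel2 = r2[unfolded satisfies_def relations2_def ball_simps case_prod_conv eval_append eval.simps fold]
  have a0: "a 0 = f (gA 0)" by (simp add: a_def)
  have sh: "shift_seq (a 0) a" "shift_seq (a 0) b" "shift_seq (a 0) p" "shift_seq (a 0) q"
    unfolding a0 by (simp_all add: a_def b_def p_def q_def shift_seq_shifted)
  note shD = sh[THEN shift_seqD]
  have shc: "shift_seq (a 0) c"
    unfolding shift_seq_def c_def eval_wC unfolding fold
    by (simp add: conj_by_mult conj_by_inverse shD)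
  note past_a = family_past_a[OF sh(1)]
  have aa: "i < j \<Longrightarrow> a j * a i = a i * a (Suc j)" for i j
    by (rule past_a[OF sh(1)]) (use rel1 in blast)+
  have ba: "i < j \<Longrightarrow> b j * a i = a i * b (Suc j)" for i j
    by (rule past_a[OF sh(2)]) (use rel1 in blast)+
  have pa: "i < j \<Longrightarrow> p j * a i = a i * p (Suc j)" for i j
    by (rule past_a[OF sh(3)]) (use rel1 in blast)+
  have qa: "i < j \<Longrightarrow> q j * a i = a i * q (Suc j)" for i j
    by (rule past_a[OF sh(4)]) (use rel1 rel2 in blast)+
  have ca: "i < j \<Longrightarrow> c j * a i = a i * c (Suc j)" for i j
    by (rule past_a[OF shc]) (use rel1 rel2 in blast)+
  note past_b = family_past_b[where a=a, OF sh(2)]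
  have ab: "i < j \<Longrightarrow> a j * b i = b i * a (Suc j)" for i j
    by (rule past_b[OF sh(1) aa]) (use rel1 in \<open>blast | metis\<close>)+
  have bb: "i < j \<Longrightarrow> b j * b i = b i * b (Suc j)" for i j
    by (rule past_b[OF sh(2) ba]) (use rel1 in \<open>blast | metis\<close>)+
  have pb: "i < j \<Longrightarrow> p j * b i = b i * p (Suc j)" for i j
    by (rule past_b[OF sh(3) pa]) (use rel1 in \<open>blast | metis\<close>)+
  have qb: "i < j \<Longrightarrow> q j * b i = b i * q (Suc j)" for i j
    by (rule past_b[OF sh(4) qa]) (use rel1 rel2 in \<open>blast | metis\<close>)+
  have cb: "i < j \<Longrightarrow> c j * b i = b i * c (Suc j)" for i j
    by (rule past_b[OF shc ca]) (use rel1 rel2 in \<open>blast | metis\<close>)+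
  note commute = family_commute[where a=a, OF sh(3)]
  have ap: "Suc i < j \<Longrightarrow> p i * a j = a j * p i" for i j
    by (rule commute[OF sh(1) aa]) (use rel1 in \<open>blast | metis\<close>)+
  have bp: "Suc i < j \<Longrightarrow> p i * b j = b j * p i" for i j
    by (rule commute[OF sh(2) ba]) (use rel1 in \<open>blast | metis\<close>)+
  have pp: "Suc i < j \<Longrightarrow> p i * p j = p j * p i" for i j
    by (rule commute[OF sh(3) pa]) (use rel1 in \<open>blast | metis\<close>)+
  have qp: "Suc i < j \<Longrightarrow> p i * q j = q j * p i" for i j
    by (rule commute[OF sh(4) qa]) (use rel1 rel2 in \<open>blast | metis\<close>)+
  have cp: "Suc i < j \<Longrightarrow> p i * c j = c j * p i" for i j
    by (rule commute[OF shc ca]) (use rel1 rel2 in \<open>blast | metis\<close>)+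
  (* Both sides of a relation with a single index form sequences of successive conjugates. *)
  have by_shift: "\<forall>i. u i = v i"
    if "u 0 = v 0" "u 1 = v 1" "shift_seq (a 0) u" "shift_seq (a 0) v" for u v
  proof
    fix i show "u i = v i"
    proof (induction i)
      case (Suc i)
      thus ?case using that by (cases "i = 0") (auto simp: shift_seq_def)
    qed (use that in simp)
  qed
  have shift_mult: "shift_seq (a 0) (\<lambda>i. u i * v i)" if "shift_seq (a 0) u" "shift_seq (a 0) v" for u v
    using that by (simp add: shift_seq_def conj_by_mult)
  have shift_Suc: "shift_seq (a 0) (\<lambda>i. u (Suc i))" if "shift_seq (a 0) u" for u
    using that by (simp add: shift_seq_def)
  have shift_1: "shift_seq (a 0) (\<lambda>i. 1)" by (simp add: shift_seq_def)
  note shifts = shift_mult shift_Suc sh shc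
  have pasame: "\<forall>i. p i * a i = a (Suc i) * (p i * p (Suc i))"
    by (intro by_shift shifts) (use rel1 in \<open>simp_all add: eval_nat_numeral mult.assoc\<close>)
  have pbsame: "\<forall>i. p i * b i = b (Suc i) * (p i * p (Suc i))"
    by (intro by_shift shifts) (use rel1 in \<open>simp_all add: eval_nat_numeral mult.assoc\<close>)
  have qasame: "\<forall>i. q i * a i = p i * q (Suc i)"
    by (intro by_shift shifts) (use rel2 in \<open>simp_all add: eval_nat_numeral mult.assoc\<close>)
  have qbsame: "\<forall>i. q i * b i = c (Suc i) * (p i * q (Suc i))"
    by (intro by_shift shifts) (use rel2 in \<open>simp_all add: eval_nat_numeral mult.assoc\<close>)
  have psq: "\<forall>i. p i * p i = 1"
    by (rule by_shift[OF _ _ shift_mult[OF sh(3,3)] shift_1]) (use rel1 in \<open>simp_all add: eval_nat_numeral mult.assoc\<close>)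
  have qsq: "\<forall>i. q i * q i = 1"
    by (rule by_shift[OF _ _ shift_mult[OF sh(4,4)] shift_1]) (use rel2 in \<open>simp_all add: eval_nat_numeral mult.assoc\<close>)
  have pbraid: "\<forall>i. p i * (p (Suc i) * p i) = p (Suc i) * (p i * p (Suc i))"
    by (intro by_shift shifts) (use rel1 in \<open>simp_all add: eval_nat_numeral mult.assoc\<close>)
  have qbraid: "\<forall>i. p i * (q (Suc i) * p i) = q (Suc i) * (p i * q (Suc i))"
    by (intro by_shift shifts) (use rel2 in \<open>simp_all add: eval_nat_numeral mult.assoc\<close>)
  have crossab01: "a 0 * (b 1 * b 0) = b 0 * (a 1 * (a 0 * p 1))"
      "a 1 * (b 2 * b 1) = b 1 * (a 2 * (a 1 * p 2))"
    using rel1 by blast+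
  have crossab: "\<forall>i. a i * (b (Suc i) * b i) = b i * (a (Suc i) * (a i * p (Suc i)))"
    by (intro by_shift shifts) (use crossab01 in \<open>simp_all add: eval_nat_numeral\<close>)
  have crossc: "\<forall>i. c i * a i = b i * (c (Suc (Suc i)) * p (Suc i))"
    by (intro by_shift shifts) (use rel2 in \<open>simp_all add: eval_nat_numeral mult.assoc\<close>)
  have "pattern_families a b p q c"
    using pasame pbsame qasame qbsame psq qsq pbraid qbraid crossab crossc
    by unfold_locales (auto intro: aa ba pa qa ca ab bb pb qb cb ap bp pp qp cp)
  thus ?thesis unfolding a_def b_def p_def q_def c_def .
qed

lemma relations_of_families:
  fixes f :: "gen \<Rightarrow> 'g::mult_group"
  assumes "pattern_families (\<lambda>i. eval f (wA i)) (\<lambda>i. eval f (wB i)) (\<lambda>i. eval f (w\<pi> i))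
     (\<lambda>i. eval f (w\<pi>b i)) (\<lambda>i. eval f (wC i))"
  shows "satisfies f (relations1 \<union> relations2)"
proof -
  define a where "a = (\<lambda>i. eval f (wA i))"
  define b where "b = (\<lambda>i. eval f (wB i))"
  define p where "p = (\<lambda>i. eval f (w\<pi> i))"
  define q where "q = (\<lambda>i. eval f (w\<pi>b i))"
  define c where "c = (\<lambda>i. eval f (wC i))"
  note fold = a_def[THEN fun_cong, symmetric] b_def[THEN fun_cong, symmetric]
    p_def[THEN fun_cong, symmetric] q_def[THEN fun_cong, symmetric] c_def[THEN fun_cong, symmetric]
  interpret pattern_families a b p q c
    using assms unfolding a_def b_def p_def q_def c_def .
  note laws = a_a b_a p_a q_a c_a a_b b_b p_b q_b c_b
  have pp: "p 0 * p 2 = p 2 * p 0" "p 0 * p 3 = p 3 * p 0" "p 1 * p 3 = p 3 * p 1" "p 1 * p 4 = p 4 * p 1"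
    by (rule p_p; simp)+
  have "satisfies f relations1"
    unfolding satisfies_def relations1_def ball_simps case_prod_conv eval_append eval.simps fold
    using pp cross_ab[of 0] cross_ab[of 1] p_braid[of 0] p_braid[of 1] p_square[of 0] p_square[of 1]
      p_a_same[of 0] p_a_same[of 1] p_b_same[of 0] p_b_same[of 1]
    by (simp add: laws a_p b_p eval_nat_numeral mult.assoc)
  moreover have "satisfies f relations2"
    unfolding satisfies_def relations2_def ball_simps case_prod_conv eval_append eval.simps fold
    using cross_c[of 0] cross_c[of 1] q_braid[of 0] q_braid[of 1] q_square[of 0] q_square[of 1]
      q_a_same[of 0] q_a_same[of 1] q_b_same[of 0] q_b_same[of 1]
    by (simp add: laws q_p c_p eval_nat_numeral mult.assoc)
  ultimately show ?thesis by (auto simp: satisfies_def)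
qed


section \<open>The families as permutations\<close>

abbreviation split0 :: cperm where "split0 \<equiv> split_perm Vert 0"

text \<open>The powers of \<open>split0\<close> are the spines, so these are the elements that pair a spine
after one move with the spine of the appropriate size.\<close>

definition perm_E :: "nat \<Rightarrow> nat \<Rightarrow> dir \<Rightarrow> cperm" where
  "perm_E n k c = split0 ^ n * (split_perm c k * inverse (split0 ^ Suc n))"

definition perm_S :: "nat \<Rightarrow> nat \<Rightarrow> cperm" where
  "perm_S n k = split0 ^ n * (swap_perm k * inverse (split0 ^ n))"

interpretation perm_calc: pattern_calculus perm_E perm_S
proof
  fix k l n :: nat and d e
  have EE: "perm_E n k d * perm_E (Suc n) l e = split0 ^ n * (split_perm d k * (split_perm e l * inverse (split0 ^ Suc (Suc n))))" for n k l d e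
    by (simp only: perm_E_def mult.assoc group_inverse_cancel)
  show "perm_E n k d * perm_E (Suc n) (Suc l) e = perm_E n l e * perm_E (Suc n) k d" if "k < l" "l \<le> n"
    unfolding EE using split_perm_commute[OF that(1), of d e] by (simp only: mult.assoc[symmetric])
  show "perm_E n k Horiz * (perm_E (Suc n) k Vert * perm_E (Suc (Suc n)) (Suc (Suc k)) Vert)
      = perm_E n k Vert * (perm_E (Suc n) k Horiz * (perm_E (Suc (Suc n)) (Suc (Suc k)) Horiz
        * perm_S (Suc (Suc (Suc n))) (Suc k)))"
    using arg_cong[OF split_perm_cross[of k], of "\<lambda>x. split0 ^ n * (x * inverse (split0 ^ Suc (Suc (Suc n))))"]
    by (simp only: perm_E_def perm_S_def mult.assoc group_inverse_cancel)
  show "perm_S n k * perm_S n k = 1"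
    using swap_perm_square[of k] by (simp only: perm_S_def mult.assoc group_inverse_cancel) (simp add: mult.assoc[symmetric])
  show "perm_S n k * perm_S n l = perm_S n l * perm_S n k" if "Suc k < l" "l < n"
    using arg_cong[OF swap_perm_commute[OF that(1)], of "\<lambda>x. split0 ^ n * (x * inverse (split0 ^ n))"]
    by (simp only: perm_S_def mult.assoc group_inverse_cancel)
  show "perm_S n k * (perm_S n (Suc k) * perm_S n k) = perm_S n (Suc k) * (perm_S n k * perm_S n (Suc k))"
    using arg_cong[OF swap_perm_braid[of k], of "\<lambda>x. split0 ^ n * (x * inverse (split0 ^ n))"]
    by (simp only: perm_S_def mult.assoc group_inverse_cancel)
  show "perm_S n k * perm_E n l d = perm_E n l d * perm_S (Suc n) (Suc k)" if "l < k" "k < n"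
    using arg_cong[OF swap_split_perm_below[OF that(1)], of "\<lambda>x. split0 ^ n * (x * inverse (split0 ^ Suc n))"]
    by (simp only: perm_S_def perm_E_def mult.assoc group_inverse_cancel)
  show "perm_S n k * perm_E n l d = perm_E n l d * perm_S (Suc n) k" if "Suc k < l" "l \<le> n"
    using arg_cong[OF swap_split_perm_above[OF that(1)], of "\<lambda>x. split0 ^ n * (x * inverse (split0 ^ Suc n))"]
    by (simp only: perm_S_def perm_E_def mult.assoc group_inverse_cancel)
  show "perm_S n k * perm_E n (Suc k) d = perm_E n k d * (perm_S (Suc n) (Suc k) * perm_S (Suc n) k)"
    using arg_cong[OF swap_split_perm_right[of k d], of "\<lambda>x. split0 ^ n * (x * inverse (split0 ^ Suc n))"]
    by (simp only: perm_S_def perm_E_def mult.assoc group_inverse_cancel)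
qed

definition perm_a :: "nat \<Rightarrow> cperm" where "perm_a i = perm_E (Suc i) 1 Vert"
definition perm_b :: "nat \<Rightarrow> cperm" where "perm_b i = perm_E (Suc i) 1 Horiz"
definition perm_p :: "nat \<Rightarrow> cperm" where "perm_p i = perm_S (Suc (Suc i)) 1"
definition perm_q :: "nat \<Rightarrow> cperm" where "perm_q i = perm_S (Suc i) 0"
definition perm_c :: "nat \<Rightarrow> cperm" where "perm_c i = perm_E i 0 Horiz"

text \<open>Prolonging the spine only renumbers its rectangles other than the tip.\<close>

lemma perm_E_Suc: "perm_E (Suc n) (Suc (Suc k)) c = perm_E n (Suc k) c"
proof -
  have "split0 * split_perm c (Suc (Suc k)) = split_perm c (Suc k) * split0" by (rule split_perm_commute) simp
  hence eq: "split_perm c (Suc k) = split0 * (split_perm c (Suc (Suc k)) * inverse split0)"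
    by (metis group_inverse_cancel(2) mult.assoc mult_1_right)
  show ?thesis unfolding perm_E_def eq power_Suc2[of split0 n] power_Suc2[of split0 "Suc n"]
    by (simp only: inverse_mult mult.assoc)
qed

lemma perm_S_Suc: "perm_S (Suc n) (Suc (Suc k)) = perm_S n (Suc k)"
proof -
  have "swap_perm (Suc k) * split0 = split0 * swap_perm (Suc (Suc k))" by (rule swap_split_perm_below) simp
  hence eq: "swap_perm (Suc k) = split0 * (swap_perm (Suc (Suc k)) * inverse split0)"
    by (metis group_inverse_cancel(2) mult.assoc mult_1_right)
  show ?thesis unfolding perm_S_def eq power_Suc2[of split0 n]
    by (simp only: inverse_mult mult.assoc)
qed

lemma perm_E_index: "k < n \<Longrightarrow> perm_E n (Suc k) c = perm_E (n - k) 1 c"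
proof (induction k arbitrary: n)
  case (Suc k)
  then obtain m where "n = Suc m" by (cases n) auto
  with Suc show ?case by (simp add: perm_E_Suc)
qed simp

lemma perm_S_index: "Suc k < n \<Longrightarrow> perm_S n (Suc k) = perm_S (n - k) 1"
proof (induction k arbitrary: n)
  case (Suc k)
  then obtain m where "n = Suc m" by (cases n) auto
  with Suc show ?case by (simp add: perm_S_Suc)
qed simp

lemma perm_E_eq:
  "perm_E n 0 Vert = 1" "perm_E n 0 Horiz = perm_c n"
  "1 \<le> k \<Longrightarrow> k \<le> n \<Longrightarrow> perm_E n k Vert = perm_a (n - k)"
  "1 \<le> k \<Longrightarrow> k \<le> n \<Longrightarrow> perm_E n k Horiz = perm_b (n - k)"
proof -
  show "perm_E n 0 Vert = 1" unfolding perm_E_def power_Suc2[of split0 n] by (simp add: mult.assoc)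
  have *: "perm_E n k c = perm_E (Suc (n - k)) 1 c" if "1 \<le> k" "k \<le> n" for c
    using perm_E_index[of "k - 1" n c] that by (simp add: Suc_diff_le)
  show "1 \<le> k \<Longrightarrow> k \<le> n \<Longrightarrow> perm_E n k Vert = perm_a (n - k)"
   "1 \<le> k \<Longrightarrow> k \<le> n \<Longrightarrow> perm_E n k Horiz = perm_b (n - k)" by (simp_all add: * perm_a_def perm_b_def)
qed (simp add: perm_c_def)

lemma perm_S_eq:
  "1 \<le> n \<Longrightarrow> perm_S n 0 = perm_q (n - 1)"
  "1 \<le> k \<Longrightarrow> k < n \<Longrightarrow> perm_S n k = perm_p (n - Suc k)"
proof -
  show "1 \<le> k \<Longrightarrow> k < n \<Longrightarrow> perm_S n k = perm_p (n - Suc k)"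
    using perm_S_index[of "k - 1" n] by (simp add: perm_p_def Suc_diff_Suc Suc_diff_le)
qed (simp add: perm_q_def)

interpretation perm_fam: pattern_families perm_a perm_b perm_p perm_q perm_c
proof
  note eqs = perm_E_eq perm_S_eq
  fix i j :: nat
  {
    assume ij: "i < j"
    define l where "l = Suc j - i"
    have l: "1 < l" "l \<le> Suc j" "Suc j - l = i" using ij by (auto simp: l_def)
    have EE: "perm_E (Suc j) 1 c * perm_E (Suc (Suc j)) (Suc l) d = perm_E (Suc j) l d * perm_E (Suc (Suc j)) 1 c" for c d
      using perm_calc.E_E[of 1 l "Suc j"] l by simp
    show "perm_a j * perm_a i = perm_a i * perm_a (Suc j)" using EE[of Vert Vert] l by (simp add: eqs)
    show "perm_b j * perm_a i = perm_a i * perm_b (Suc j)" using EE[of Horiz Vert] l by (simp add: eqs)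
    show "perm_a j * perm_b i = perm_b i * perm_a (Suc j)" using EE[of Vert Horiz] l by (simp add: eqs)
    show "perm_b j * perm_b i = perm_b i * perm_b (Suc j)" using EE[of Horiz Horiz] l by (simp add: eqs)
    define m where "m = j - i"
    have m: "1 \<le> m" "m \<le> j" "j - m = i" using ij by (auto simp: m_def)
    have EE: "perm_E j 0 Horiz * perm_E (Suc j) (Suc m) d = perm_E j m d * perm_E (Suc j) 0 Horiz" for d
      using perm_calc.E_E[of 0 m j] m by simp
    show "perm_c j * perm_a i = perm_a i * perm_c (Suc j)" using EE[of Vert] m by (simp add: eqs)
    show "perm_c j * perm_b i = perm_b i * perm_c (Suc j)" using EE[of Horiz] m by (simp add: eqs)
    have lm: "2 < Suc l" "Suc l \<le> Suc (Suc j)" using l by auto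
    have SE: "perm_S (Suc (Suc j)) 1 * perm_E (Suc (Suc j)) (Suc l) d = perm_E (Suc (Suc j)) (Suc l) d * perm_S (Suc (Suc (Suc j))) 1" for d
      using perm_calc.S_E_above[of 1 "Suc l" "Suc (Suc j)"] lm by simp
    show "perm_p j * perm_a i = perm_a i * perm_p (Suc j)" using SE[of Vert] l by (simp add: eqs)
    show "perm_p j * perm_b i = perm_b i * perm_p (Suc j)" using SE[of Horiz] l by (simp add: eqs)
    have SE: "perm_S (Suc j) 0 * perm_E (Suc j) l d = perm_E (Suc j) l d * perm_S (Suc (Suc j)) 0" for d
      using perm_calc.S_E_above[of 0 l "Suc j"] l by simp
    show "perm_q j * perm_a i = perm_a i * perm_q (Suc j)" using SE[of Vert] l by (simp add: eqs)
    show "perm_q j * perm_b i = perm_b i * perm_q (Suc j)" using SE[of Horiz] l by (simp add: eqs)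
  }
  {
    assume ij: "Suc i < j"
    define k where "k = j - i"
    have k: "1 < k" "k < Suc j" "j - k = i" using ij by (auto simp: k_def)
    have SE: "perm_S (Suc j) k * perm_E (Suc j) 1 d = perm_E (Suc j) 1 d * perm_S (Suc (Suc j)) (Suc k)" for d
      using perm_calc.S_E_below[of 1 k "Suc j"] k by simp
    show "perm_p i * perm_a j = perm_a j * perm_p i" using SE[of Vert] k by (simp add: eqs)
    show "perm_p i * perm_b j = perm_b j * perm_p i" using SE[of Horiz] k by (simp add: eqs)
    have "perm_S (Suc (Suc j)) 1 * perm_S (Suc (Suc j)) (Suc k) = perm_S (Suc (Suc j)) (Suc k) * perm_S (Suc (Suc j)) 1"
      using k by (intro perm_calc.S_commute) auto
    thus "perm_p i * perm_p j = perm_p j * perm_p i" using k by (simp add: eqs)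
    have "perm_S (Suc j) 0 * perm_S (Suc j) k = perm_S (Suc j) k * perm_S (Suc j) 0"
      using k by (intro perm_calc.S_commute) auto
    thus "perm_p i * perm_q j = perm_q j * perm_p i" using k by (simp add: eqs)
    define m where "m = j - Suc i"
    have m: "0 < m" "m < j" "j - Suc m = i" using ij by (auto simp: m_def)
    have "perm_S j m * perm_E j 0 Horiz = perm_E j 0 Horiz * perm_S (Suc j) (Suc m)"
      using m by (intro perm_calc.S_E_below) auto
    thus "perm_p i * perm_c j = perm_c j * perm_p i" using m by (simp add: eqs)
  }
  show "perm_p i * perm_a i = perm_a (Suc i) * (perm_p i * perm_p (Suc i))" "perm_p i * perm_b i = perm_b (Suc i) * (perm_p i * perm_p (Suc i))"
    using perm_calc.S_E_right[of 1 "Suc (Suc i)" Vert] perm_calc.S_E_right[of 1 "Suc (Suc i)" Horiz]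
    by (simp_all add: eqs)
  show "perm_q i * perm_a i = perm_p i * perm_q (Suc i)" "perm_q i * perm_b i = perm_c (Suc i) * (perm_p i * perm_q (Suc i))"
    using perm_calc.S_E_right[of 0 "Suc i" Vert] perm_calc.S_E_right[of 0 "Suc i" Horiz]
    by (simp_all add: eqs)
  show "perm_p i * perm_p i = 1" using perm_calc.S_S[of 1 "Suc (Suc i)"] by (simp add: eqs)
  show "perm_q i * perm_q i = 1" using perm_calc.S_S[of 0 "Suc i"] by (simp add: eqs)
  show "perm_p i * (perm_p (Suc i) * perm_p i) = perm_p (Suc i) * (perm_p i * perm_p (Suc i))"
    using perm_calc.S_braid[of 1 "Suc (Suc (Suc i))"] by (simp add: eqs)
  show "perm_p i * (perm_q (Suc i) * perm_p i) = perm_q (Suc i) * (perm_p i * perm_q (Suc i))"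
    using perm_calc.S_braid[of 0 "Suc (Suc i)"] by (simp add: eqs)
  have "perm_b i * (perm_a (Suc i) * perm_a i) = perm_a i * (perm_b (Suc i) * (perm_b i * perm_p (Suc i)))"
    using perm_calc.E_cross[of 1 "Suc i"] by (simp add: eqs)
  moreover have pp: "perm_p (Suc i) * perm_p (Suc i) = 1" using perm_calc.S_S[of 1 "Suc (Suc (Suc i))"] by (simp add: eqs)
  ultimately show "perm_a i * (perm_b (Suc i) * perm_b i) = perm_b i * (perm_a (Suc i) * (perm_a i * perm_p (Suc i)))"
    by (metis mult.assoc mult_1_right)
  have "perm_c i * perm_a i = perm_c (Suc i) * (perm_b i * perm_p (Suc i))"
    using perm_calc.E_cross[of 0 i] by (simp add: eqs)
  moreover have "perm_c (Suc i) * perm_b i = perm_b i * perm_c (Suc (Suc i))"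
    using perm_calc.E_E[of 0 1 "Suc i" Horiz Horiz] by (simp add: eqs)
  ultimately show "perm_c i * perm_a i = perm_b i * (perm_c (Suc (Suc i)) * perm_p (Suc i))"
    by (metis mult.assoc)
qed

primrec gen_perm :: "gen \<Rightarrow> cperm" where
  "gen_perm (gA i) = perm_a i"
| "gen_perm (gB i) = perm_b i"
| "gen_perm (g\<pi> i) = perm_p i"
| "gen_perm (g\<pi>b i) = perm_q i"

lemma shift_seq_unique:
  assumes "shift_seq z x" "shift_seq z y" "x 0 = y 0" "x 1 = y 1" shows "x i = y i"
proof (induction i)
  case (Suc i)
  thus ?case using assms by (cases "i = 0") (auto simp: shift_seq_def)
qed (use assms in simp)

lemma eval_shifted_gens:
  "eval gen_perm (wA i) = perm_a i" "eval gen_perm (wB i) = perm_b i"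
  "eval gen_perm (w\<pi> i) = perm_p i" "eval gen_perm (w\<pi>b i) = perm_q i"
proof -
  have sh: "shift_seq (gen_perm (gA 0)) perm_a" "shift_seq (gen_perm (gA 0)) perm_b"
     "shift_seq (gen_perm (gA 0)) perm_p" "shift_seq (gen_perm (gA 0)) perm_q"
    unfolding shift_seq_def
    by (intro allI impI conj_by_eq_iff[THEN iffD2, symmetric];
      simp add: perm_fam.a_a perm_fam.b_a perm_fam.p_a perm_fam.q_a)+
  show "eval gen_perm (wA i) = perm_a i"
    by (rule shift_seq_unique[of _ "\<lambda>i. eval gen_perm (wA i)", OF shift_seq_shifted sh(1)]) simp_all
  show "eval gen_perm (wB i) = perm_b i"
    by (rule shift_seq_unique[of _ "\<lambda>i. eval gen_perm (wB i)", OF shift_seq_shifted sh(2)]) simp_all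
  show "eval gen_perm (w\<pi> i) = perm_p i"
    by (rule shift_seq_unique[of _ "\<lambda>i. eval gen_perm (w\<pi> i)", OF shift_seq_shifted sh(3)]) simp_all
  show "eval gen_perm (w\<pi>b i) = perm_q i"
    by (rule shift_seq_unique[of _ "\<lambda>i. eval gen_perm (w\<pi>b i)", OF shift_seq_shifted sh(4)]) simp_all
qed

text \<open>Solving two of the relations for \<open>C\<close> gives the formula by which \<open>C\<close> is
abbreviated.\<close>

lemma eval_wC_gens: "eval gen_perm (wC i) = perm_c i"
proof -
  have "perm_c (Suc i) * (perm_p i * perm_q (Suc i)) = perm_q i * perm_b i" using perm_fam.q_b_same by simp
  hence "perm_c (Suc i) * (perm_p i * (perm_q (Suc i) * (perm_q (Suc i) * perm_p i))) = perm_q i * (perm_b i * (perm_q (Suc i) * perm_p i))"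
    by (metis mult.assoc)
  moreover have "perm_q (Suc i) * (perm_q (Suc i) * perm_p i) = perm_p i"
    by (simp add: mult.assoc[symmetric] perm_fam.q_square)
  ultimately have c: "perm_c (Suc i) = perm_q i * (perm_b i * (perm_q (Suc i) * perm_p i))" by (simp add: perm_fam.p_square)
  have "perm_c i * perm_a i = perm_c (Suc i) * (perm_b i * perm_p (Suc i))"
    using perm_fam.cross_c[of i] perm_fam.c_b[of i "Suc i"] by (simp add: mult.assoc[symmetric])
  hence "perm_c i = perm_c (Suc i) * (perm_b i * (perm_p (Suc i) * inverse (perm_a i)))"
    by (metis group_inverse_cancel(2) mult.assoc mult_1_right)
  thus ?thesis by (simp add: eval_wC eval_shifted_gens c mult.assoc)
qed

theorem relations_hold: "satisfies gen_perm (relations1 \<union> relations2)"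
  by (rule relations_of_families)
    (simp add: eval_shifted_gens eval_wC_gens perm_fam.pattern_families_axioms)

lemma perm_val_run: "tiling p \<Longrightarrow> config_perm p * (inverse (split0 ^ n) * perm_calc.val n ms)
    = config_perm (run ms p) * inverse (split0 ^ final_size n ms)"
proof (induction ms arbitrary: p n)
  case (Cons m ms)
  have "config_perm p * (inverse (split0 ^ n) * perm_calc.weight n m) = config_perm (act m p) * inverse (split0 ^ next_size n m)"
    using Cons.prems
    by (cases m) (simp_all only: perm_calc.weight.simps perm_E_def perm_S_def mult.assoc group_inverse_cancel
      act.simps next_size.simps config_perm_split config_perm_swap)
  hence "config_perm p * (inverse (split0 ^ n) * (perm_calc.weight n m * perm_calc.val (next_size n m) ms))
     = config_perm (act m p) * (inverse (split0 ^ next_size n m) * perm_calc.val (next_size n m) ms)"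
    by (metis mult.assoc)
  thus ?case using Cons.IH[of "act m p" "next_size n m"] Cons.prems by (simp add: tiling_act)
qed simp

lemma perm_val: "perm_calc.val 0 ms = config_perm (run ms squares) * inverse (split0 ^ final_size 0 ms)"
  using perm_val_run[of squares 0 ms] by simp

section \<open>Common refinements\<close>

definition swaps :: "nat \<Rightarrow> move list \<Rightarrow> bool" where
  "swaps n s \<longleftrightarrow> (\<forall>m\<in>set s. \<exists>k<n. m = Swap k)"

lemma swaps_valid: "swaps n s \<Longrightarrow> valid n s \<and> final_size n s = n"
  by (induction s) (auto simp: swaps_def)

lemma swaps_run:
  "swaps n s \<Longrightarrow> mset (map (run s p) [0..<Suc n]) = mset (map p [0..<Suc n]) \<and> (\<forall>i>n. run s p i = p i)"
proof (induction s arbitrary: p)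
  case (Cons m s)
  then obtain k where k: "m = Swap k" "k < n" "swaps n s" by (auto simp: swaps_def)
  have "mset (map (swap_at k p) [0..<Suc n]) = mset (map p [0..<Suc n])"
    using map_swap_at[of k "Suc n" p] k by simp
  moreover have "\<forall>i>n. swap_at k p i = p i" using k by (auto simp: swap_at_def)
  ultimately show ?case using Cons.IH[OF k(3), of "swap_at k p"] by (auto simp: k(1) simp del: upt_Suc)
qed simp

lemma swaps_move_up: "i \<le> n \<Longrightarrow> \<exists>s. swaps n s \<and> run s p n = p i"
proof (induction "n - i" arbitrary: i p)
  case 0
  thus ?case by (intro exI[of _ "[]"]) (simp add: swaps_def)
next
  case (Suc d)
  have "swap_at i p (Suc i) = p i" by (simp add: swap_at_def)
  moreover obtain s where "swaps n s" "run s (swap_at i p) n = swap_at i p (Suc i)"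
    using Suc.hyps(1)[of "Suc i" "swap_at i p"] Suc.hyps(2) by fastforce
  ultimately show ?case using Suc by (intro exI[of _ "Swap i # s"]) (auto simp: swaps_def)
qed

lemma swaps_append: "swaps n (s @ t) \<longleftrightarrow> swaps n s \<and> swaps n t"
  by (auto simp: swaps_def)

lemma swaps_mono: "swaps n s \<Longrightarrow> n \<le> m \<Longrightarrow> swaps m s"
  by (force simp: swaps_def)

lemma permutation_by_swaps:
  assumes "mset (map p [0..<Suc n]) = mset (map p' [0..<Suc n])" "\<And>i. n < i \<Longrightarrow> p i = p' i"
  shows "\<exists>s. swaps n s \<and> run s p = p'"
  using assms
proof (induction n arbitrary: p)
  case 0
  have "p i = p' i" for i using 0 by (cases i) auto
  hence "p = p'" by auto
  thus ?case by (intro exI[of _ "[]"]) (simp add: swaps_def)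
next
  case (Suc n)
  have "p' (Suc n) \<in># mset (map p [0..<Suc (Suc n)])" unfolding Suc.prems(1) by simp
  then obtain i where i: "i \<le> Suc n" "p' (Suc n) = p i"
    by (metis atLeastLessThan_iff imageE less_Suc_eq_le list.set_map set_mset_mset set_upt)
  then obtain s where s: "swaps (Suc n) s" "run s p (Suc n) = p' (Suc n)"
    using swaps_move_up[of i "Suc n" p] by auto
  note rs = swaps_run[OF s(1), of p]
  have "mset (map (run s p) [0..<Suc (Suc n)]) = mset (map p' [0..<Suc (Suc n)])"
    using rs Suc.prems(1) by simp
  hence "mset (map (run s p) [0..<Suc n]) = mset (map p' [0..<Suc n])"
    using s(2) by simp
  moreover have "run s p j = p' j" if "n < j" for j
    using rs s(2) Suc.prems(2)[of j] that by (cases "j = Suc n") auto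
  ultimately obtain t where "swaps n t" "run t (run s p) = p'" using Suc.IH by blast
  thus ?case using s(1) swaps_mono[of n t "Suc n"] by (intro exI[of _ "s @ t"]) (auto simp: swaps_append run_append)
qed

text \<open>All subdivided rectangles lie in the first square, and the remaining squares follow in order.\<close>

definition supported :: "nat \<Rightarrow> config \<Rightarrow> bool" where
  "supported n p \<longleftrightarrow> (\<forall>i\<le>n. fst (p i) = 0) \<and> (\<forall>i>n. p i = squares (i - n))"

lemma fst_child [simp]: "fst (child c b a) = fst a"
  by (cases a; cases c) auto

lemma supported_act: assumes "supported n p" "valid_move n m"
  shows "supported (next_size n m) (act m p)"
proof (cases m)
  case (Split c k)
  have "split_at c k p i = squares (i - Suc n)" if "Suc n < i" for i
  proof -
    have "split_at c k p i = p (i - 1)" using that assms Split by (simp add: split_at_def)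
    thus ?thesis using that assms by (simp add: supported_def)
  qed
  thus ?thesis using assms Split by (auto simp: supported_def) (auto simp: split_at_def)
next
  case (Swap k)
  thus ?thesis using assms by (auto simp: supported_def swap_at_def)
qed

lemma supported_run: "supported n p \<Longrightarrow> valid n ms \<Longrightarrow> supported (final_size n ms) (run ms p)"
  by (induction ms arbitrary: n p) (auto simp: supported_act)

lemma supported_squares: "supported 0 squares"
  by (simp add: supported_def squares_def)

definition derivable :: "nat \<Rightarrow> config \<Rightarrow> bool" where
  "derivable n p \<longleftrightarrow> (\<exists>ms. valid 0 ms \<and> final_size 0 ms = n \<and> run ms squares = p)"

lemma derivable_run: "derivable n p \<Longrightarrow> valid n ms \<Longrightarrow> derivable (final_size n ms) (run ms p)"
  unfolding derivable_def by (metis final_size_append run_append valid_append)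

lemma derivable_supported: "derivable n p \<Longrightarrow> supported n p"
  unfolding derivable_def using supported_run supported_squares by blast

lemma derivable_tiling: "derivable n p \<Longrightarrow> tiling p"
  unfolding derivable_def using tiling_run tiling_squares by blast

lemma overlap_same_square:
  assumes "z \<in> cell a" "z \<in> cell b" shows "fst a = fst b"
proof -
  obtain s u v s' u' v' where ab: "a = (s, u, v)" "b = (s', u', v')" by (cases a; cases b)
  have "\<bar>real s - real s'\<bar> < 1" using assms left_end_bounds[of u] left_end_bounds[of u'] by (auto simp: ab)
  hence "s = s'" by linarith
  thus ?thesis by (simp add: ab)
qed

text \<open>The first letters agree because the two thirds are separated by a gap; the contraction is then undone.\<close>

lemma same_length_disjoint:
  assumes "length u = length w" "0 \<le> x" "x \<le> 1" "0 \<le> y" "y \<le> 1"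
    "left_end u + x / 3 ^ length u = left_end w + y / 3 ^ length w"
  shows "u = w"
  using assms(1,6)
proof (induction u arbitrary: w)
  case (Cons b u)
  then obtain b' w' where w: "w = b' # w'" "length u = length w'" by (cases w) auto
  have bd: "0 \<le> left_end u + t / 3 ^ length u \<and> left_end u + t / 3 ^ length u \<le> 1" if "0 \<le> t" "t \<le> 1" for u t
  proof -
    have "t / 3 ^ length u \<le> 1 / 3 ^ length u" using that by (simp add: divide_right_mono)
    thus ?thesis using left_end_bounds[of u] that by (smt (verit) divide_nonneg_pos zero_less_power)
  qed
  have e: "left_end (b # u) + x / 3 ^ length (b # u) = (if b then 2 / 3 else 0) + (left_end u + x / 3 ^ length u) / 3"
    "left_end (b' # w') + y / 3 ^ length (b' # w') = (if b' then 2 / 3 else 0) + (left_end w' + y / 3 ^ length w') / 3"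
    by (simp_all only: left_end.simps length_Cons power_Suc add_divide_distrib divide_divide_eq_left mult.commute[of 3] add.assoc)
  have eq: "(if b then 2 / 3 else 0) + (left_end u + x / 3 ^ length u) / 3
      = (if b' then 2 / 3 else 0) + (left_end w' + y / 3 ^ length w') / 3"
    using Cons.prems(2) unfolding w(1) e .
  have "s = t \<longrightarrow> b = b'" if "0 \<le> X \<and> X \<le> 1" "0 \<le> Y \<and> Y \<le> 1"
    "s = (if b then 2 / 3 else 0) + X / 3" "t = (if b' then 2 / 3 else 0) + Y / 3" for X Y s t :: real
    using that by auto
  hence "b = b'" using bd[of x u] bd[of y w'] assms(2-5) eq by blast
  hence "(left_end u + x / 3 ^ length u) / 3 = (left_end w' + y / 3 ^ length w') / 3"
    using eq by (simp only: add_left_cancel)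
  hence "left_end u + x / 3 ^ length u = left_end w' + y / 3 ^ length w'" by (simp only: divide_cancel_right) simp
  with Cons.IH[OF w(2)] w \<open>b = b'\<close> show ?case by simp
qed simp

lemma full_cells_disjoint:
  assumes "z \<in> cantor_Y" "z \<in> cell (s, u, v)" "z \<in> cell (s', u', v')" "length u = length u'" "length v = length v'"
  shows "(s, u, v) = (s', u', v')"
proof -
  have s: "s = s'" using overlap_same_square[OF assms(2,3)] by simp
  obtain x y where xy: "x \<in> cantor_set" "y \<in> cantor_set" "z = cell_point (s, u, v) (x, y)"
    using assms(1,2) Y_cell[of "(s, u, v)"] by blast
  obtain x' y' where xy': "x' \<in> cantor_set" "y' \<in> cantor_set" "z = cell_point (s', u', v') (x', y')"
    using assms(1,3) Y_cell[of "(s', u', v')"] by blast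
  have "u = u'"
    by (rule same_length_disjoint[OF assms(4), of x x']) (use cantor_bounds xy xy' s in auto)
  moreover have "v = v'"
    by (rule same_length_disjoint[OF assms(5), of y y']) (use cantor_bounds xy xy' s in auto)
  ultimately show ?thesis using s by simp
qed

definition full :: "nat \<times> nat \<Rightarrow> nat \<Rightarrow> config \<Rightarrow> bool" where
  "full D n p \<longleftrightarrow> all_fit D n p \<and> (\<forall>i\<le>n. \<forall>c. \<not> allowed D c (p i))"

lemma refine_to_full:
  "all_fit D n p \<Longrightarrow> \<exists>ms. valid n ms \<and> full D (final_size n ms) (run ms p)"
proof (induction "total_room D n p" arbitrary: n p rule: less_induct)
  case less
  show ?case
  proof (cases "full D n p")
    case True
    thus ?thesis by (intro exI[of _ "[]"]) simp
  next
    case False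
    then obtain k c where kc: "k \<le> n" "allowed D c (p k)" using less.prems by (auto simp: full_def)
    obtain ms where "valid (Suc n) ms" "full D (final_size (Suc n) ms) (run ms (split_at c k p))"
      using less.hyps[OF total_room_split[of k n D c p, OF kc]] less.prems all_fit_split[OF kc(1)] kc(2) by blast
    thus ?thesis using kc by (intro exI[of _ "Split c k # ms"]) auto
  qed
qed

text \<open>A tiling by cells of one fixed shape contains every cell of this shape: a point of such a cell lies
in some member, and two cells of the same shape that meet coincide.\<close>

lemma full_image:
  fixes d e n :: nat
  assumes "supported n p" "tiling p" "full (d, e) n p"
  shows "p ` {..n} = {(s::nat, u::bool list, v::bool list). s = 0 \<and> length u = d \<and> length v = e}"
proof -
  have len: "\<exists>u v. p i = (0, u, v) \<and> length u = d \<and> length v = e" if i: "i \<le> n" for i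
  proof -
    obtain s u v where eq: "p i = (s, u, v)" by (cases "p i")
    have "s = 0" using assms(1) i eq unfolding supported_def by force
    have "fits (d, e) (p i)" using assms(3) i unfolding full_def all_fit_def by blast
    moreover have "\<not> allowed (d, e) Vert (p i)" "\<not> allowed (d, e) Horiz (p i)"
      using assms(3) i unfolding full_def by blast+
    ultimately show ?thesis using eq \<open>s = 0\<close> by auto
  qed
  show ?thesis
  proof (intro equalityI subsetI)
    fix a :: addr assume "a \<in> {(s, u, v). s = 0 \<and> length u = d \<and> length v = e}"
    then obtain u v where a: "a = (0, u, v)" "length u = d" "length v = e" by auto
    obtain z where z: "z \<in> cantor_Y" "z \<in> cell a" using Y_cell_nonempty by blast
    obtain i where i: "z \<in> cell (p i)" using tiling_obtain assms(2) z(1) .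
    have "fst (p i) = 0" using overlap_same_square[OF i z(2)] a by simp
    hence "i \<le> n" using assms(1) by (cases "i \<le> n") (auto simp: supported_def squares_def)
    from len[OF this] obtain u' v' where p: "p i = (0, u', v')" "length u' = d" "length v' = e" by blast
    have "a = p i" using full_cells_disjoint[OF z(1), of 0 u v 0 u' v'] z(2) i a p by simp
    thus "a \<in> p ` {..n}" using \<open>i \<le> n\<close> by blast
  next
    fix a assume "a \<in> p ` {..n}"
    with len show "a \<in> {(s, u, v). s = 0 \<and> length u = d \<and> length v = e}" by fastforce
  qed
qed

lemma mset_map_eq:
  assumes "inj p" "inj p'" "p ` {..n} = p' ` {..n}"
  shows "mset (map p [0..<Suc n]) = mset (map p' [0..<Suc n])"
proof -
  have "{0..<Suc n} = {..n}" by auto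
  hence "set (map p [0..<Suc n]) = set (map p' [0..<Suc n])" using assms(3) by (simp del: upt_Suc)
  moreover have "distinct (map p [0..<Suc n])" "distinct (map p' [0..<Suc n])"
    using assms(1,2) unfolding distinct_map by (meson distinct_upt inj_on_subset subset_UNIV)+
  ultimately show ?thesis using set_eq_iff_mset_eq_distinct by blast
qed

lemma all_fit_mono: "all_fit (d, e) n p \<Longrightarrow> d \<le> d' \<Longrightarrow> e \<le> e' \<Longrightarrow> all_fit (d', e') n p"
  unfolding all_fit_def
proof (intro allI impI)
  fix i assume "\<forall>i\<le>n. fits (d, e) (p i)" "d \<le> d'" "e \<le> e'" "i \<le> n"
  thus "fits (d', e') (p i)" by (cases "p i") (metis fits.simps le_trans)
qed

text \<open>Both configurations can be refined to the grid of a depth that bounds all their cells; there they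
differ by the numbering only.\<close>

lemma common_refinement:
  assumes "derivable n p" "derivable n' p'"
  shows "\<exists>ms ms'. valid n ms \<and> valid n' ms' \<and> final_size n ms = final_size n' ms' \<and> run ms p = run ms' p'"
proof -
  obtain d e d' e' where "all_fit (d, e) n p" "all_fit (d', e') n' p'"
    using all_fit_exists by (metis surj_pair)
  then obtain D where D: "all_fit D n p" "all_fit D n' p'"
    by (meson all_fit_mono le_add1 le_add2)
  obtain d e where de: "D = (d, e)" by (cases D)
  obtain ms where ms: "valid n ms" "full D (final_size n ms) (run ms p)"
    using refine_to_full[OF D(1)] by blast
  obtain ms' where ms': "valid n' ms'" "full D (final_size n' ms') (run ms' p')"
    using refine_to_full[OF D(2)] by blast
  let ?m = "final_size n ms" and ?m' = "final_size n' ms'" and ?q = "run ms p" and ?q' = "run ms' p'"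
  have q: "derivable ?m ?q" "derivable ?m' ?q'" using assms ms ms' derivable_run by blast+
  note qs = derivable_supported[OF q(1)] derivable_tiling[OF q(1)]
  note qs' = derivable_supported[OF q(2)] derivable_tiling[OF q(2)]
  have im: "?q ` {..?m} = ?q' ` {..?m'}"
    using full_image[OF qs ms(2)[unfolded de]] full_image[OF qs' ms'(2)[unfolded de]] by simp
  have inj: "inj ?q" "inj ?q'" using qs qs' tiling_inj by blast+
  have "card (?q ` {..?m}) = card (?q' ` {..?m'})" using im by simp
  hence m: "?m = ?m'" using inj by (simp add: card_image inj_on_subset)
  have "\<exists>s. swaps ?m s \<and> run s ?q = ?q'"
    using mset_map_eq[OF inj] im m qs qs'
    by (intro permutation_by_swaps) (auto simp: supported_def simp del: upt_Suc)
  then obtain s where s: "swaps ?m s" "run s ?q = ?q'" by blast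
  show ?thesis
    using s ms ms' swaps_valid[OF s(1)] m
    by (intro exI[of _ "ms @ s"] exI[of _ ms']) (simp add: run_append valid_append final_size_append)
qed


section \<open>The presented group\<close>

lemma words_append [simp]: "u @ v \<in> words X \<longleftrightarrow> u \<in> words X \<and> v \<in> words X"
  by (auto simp: words_def)

lemma words_Nil [simp]: "[] \<in> words X"
  by (simp add: words_def)

lemma words_Cons [simp]: "(x, e) # w \<in> words X \<longleftrightarrow> x \<in> X \<and> w \<in> words X"
  by (simp add: words_def)

lemma word_inv_words [simp]: "word_inv w \<in> words X \<longleftrightarrow> w \<in> words X"
  by (auto simp: words_def word_inv_def in_lists_conv_set)

lemma word_inv_simps [simp]:
  "word_inv [] = []" "word_inv ((x, e) # w) = word_inv w @ [(x, \<not> e)]"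
  by (simp_all add: word_inv_def)

lemma word_inv_word_inv [simp]: "word_inv (word_inv w) = w"
  by (induction w) (auto simp: word_inv_def rev_map[symmetric])

lemma word_cong_words:
  assumes "(u, v) \<in> word_cong X R" "R \<subseteq> words X \<times> words X" shows "u \<in> words X \<and> v \<in> words X"
  using assms by (induction rule: word_cong.induct) auto

lemma word_cong_context:
  assumes "(u, v) \<in> word_cong X R" "s \<in> words X" "t \<in> words X"
  shows "(s @ u @ t, s @ v @ t) \<in> word_cong X R"
  using assms
proof (induction rule: word_cong.induct)
  case (refl w)
  thus ?case by (intro word_cong.refl) auto
next
  case (cancel u v x e)
  thus ?case using word_cong.cancel[of "s @ u" X "v @ t" x e R] by simp
next
  case (relation u v l r)
  thus ?case using word_cong.relation[of "s @ u" X "v @ t" l r R] by simp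
qed (auto intro: word_cong.sym word_cong.trans)

lemma word_cong_append:
  assumes "R \<subseteq> words X \<times> words X" "(u, u') \<in> word_cong X R" "(v, v') \<in> word_cong X R"
  shows "(u @ v, u' @ v') \<in> word_cong X R"
proof -
  note w = word_cong_words[OF assms(2,1)] word_cong_words[OF assms(3,1)]
  have "(u @ v, u' @ v) \<in> word_cong X R" using word_cong_context[OF assms(2), of "[]" v] w by simp
  moreover have "(u' @ v, u' @ v') \<in> word_cong X R" using word_cong_context[OF assms(3), of u' "[]"] w by simp
  ultimately show ?thesis by (rule word_cong.trans)
qed

lemma word_cong_inverse: "w \<in> words X \<Longrightarrow> (word_inv w @ w, []) \<in> word_cong X R"
proof (induction w)
  case (Cons xe w)
  obtain x e where xe: "xe = (x, e)" by (cases xe)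
  have "(word_inv w @ [(x, \<not> e), (x, \<not> \<not> e)] @ w, word_inv w @ w) \<in> word_cong X R"
    using Cons.prems by (intro word_cong.cancel) (auto simp: xe)
  thus ?case using Cons by (auto simp: xe intro: word_cong.trans)
qed (auto intro: word_cong.refl)

lemma word_cong_word_inv:
  assumes "R \<subseteq> words X \<times> words X" "(u, v) \<in> word_cong X R"
  shows "(word_inv u, word_inv v) \<in> word_cong X R"
proof -
  note w = word_cong_words[OF assms(2,1)]
  have "(v @ word_inv v, []) \<in> word_cong X R"
    using word_cong_inverse[of "word_inv v" X R] w by simp
  hence "(word_inv u @ v @ word_inv v, word_inv u) \<in> word_cong X R"
    using word_cong_context[of "v @ word_inv v" "[]" X R "word_inv u" "[]"] w by simp
  moreover have "(word_inv u @ u @ word_inv v, word_inv u @ v @ word_inv v) \<in> word_cong X R"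
    using word_cong_context[OF assms(2), of "word_inv u" "word_inv v"] w by simp
  moreover have "(word_inv u @ u @ word_inv v, word_inv v) \<in> word_cong X R"
    using word_cong_context[OF word_cong_inverse[of u X R], of "[]" "word_inv v"] w by simp
  ultimately show ?thesis by (meson word_cong.sym word_cong.trans)
qed

lemma word_cong_eval:
  assumes "satisfies f R" "(u, v) \<in> word_cong X R" shows "eval f u = eval f v"
  using assms(2)
  by (induction rule: word_cong.induct) (use assms(1) in \<open>auto simp: satisfies_def\<close>)

abbreviation (input) rels :: "(gen word \<times> gen word) set" where "rels \<equiv> relations1 \<union> relations2"

lemma gens_iff: "gens = {gA 0, gA 1, gB 0, gB 1, g\<pi> 0, g\<pi> 1, g\<pi>b 0, g\<pi>b 1}"
  by (auto simp: gens_def)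

lemma shifted_words:
  "wA i \<in> words gens" "wB i \<in> words gens" "w\<pi> i \<in> words gens" "w\<pi>b i \<in> words gens"
  by (auto simp: shifted_def words_def gens_iff less_2_cases_iff)

lemma rels_words: "rels \<subseteq> words gens \<times> words gens"
  by (simp add: relations1_def relations2_def shifted_words wC_def)

quotient_type pgroup = "gen word" / partial: "\<lambda>u v. (u, v) \<in> word_cong gens rels"
proof (rule part_equivpI)
  show "\<exists>u. (u, u) \<in> word_cong gens rels" by (intro exI[of _ "[]"] word_cong.refl) simp
  show "symp (\<lambda>u v. (u, v) \<in> word_cong gens rels)" by (rule sympI) (rule word_cong.sym)
  show "transp (\<lambda>u v. (u, v) \<in> word_cong gens rels)" by (rule transpI) (rule word_cong.trans)
qed

lemma abs_pgroup_eq_iff: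
  assumes "u \<in> words gens" "v \<in> words gens"
  shows "abs_pgroup u = abs_pgroup v \<longleftrightarrow> (u, v) \<in> word_cong gens rels"
  using Quotient3_rel[OF Quotient3_pgroup, of u v] assms by (auto intro: word_cong.refl)

lemma abs_pgroup_surj: obtains w where "w \<in> words gens" "g = abs_pgroup w"
proof -
  have "(rep_pgroup g, rep_pgroup g) \<in> word_cong gens rels"
    using Quotient3_rep_reflp[OF Quotient3_pgroup] .
  thus ?thesis using that word_cong_words[OF _ rels_words] Quotient3_abs_rep[OF Quotient3_pgroup] by metis
qed

instantiation pgroup :: "{one, times, inverse}"
begin

lift_definition one_pgroup :: pgroup is "[]" by (rule word_cong.refl) simp
lift_definition times_pgroup :: "pgroup \<Rightarrow> pgroup \<Rightarrow> pgroup" is "(@)"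
  by (rule word_cong_append[OF rels_words])
lift_definition inverse_pgroup :: "pgroup \<Rightarrow> pgroup" is word_inv
  by (rule word_cong_word_inv[OF rels_words])
definition divide_pgroup :: "pgroup \<Rightarrow> pgroup \<Rightarrow> pgroup" where
  "divide_pgroup a b = a * inverse b"

instance ..

end

instance pgroup :: mult_group
proof
  fix a b c :: pgroup
  note w = word_cong_words[OF _ rels_words]
  show "a * b * c = a * (b * c)"
    by transfer (auto intro!: word_cong.refl dest: w)
  show "1 * a = a" "a * 1 = a" by (transfer; auto intro!: word_cong.refl dest: w)+
  show "inverse a * a = 1"
    by transfer (auto intro!: word_cong_inverse dest: w)
  show "a / b = a * inverse b" by (rule divide_pgroup_def)
qed

lemma abs_pgroup_append: "u \<in> words gens \<Longrightarrow> v \<in> words gens \<Longrightarrow> abs_pgroup (u @ v) = abs_pgroup u * abs_pgroup v"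
  by (subst times_pgroup.abs_eq) (auto intro: word_cong.refl)

lemma abs_pgroup_Nil: "abs_pgroup [] = 1"
  by (simp add: one_pgroup_def)

lemma abs_pgroup_word_inv: "u \<in> words gens \<Longrightarrow> abs_pgroup (word_inv u) = inverse (abs_pgroup u)"
  by (subst inverse_pgroup.abs_eq) (auto intro: word_cong.refl)

definition gen_elt :: "gen \<Rightarrow> pgroup" where "gen_elt x = abs_pgroup [(x, True)]"

lemma eval_gen_elt: "w \<in> words gens \<Longrightarrow> eval gen_elt w = abs_pgroup w"
proof (induction w)
  case (Cons xe w)
  obtain x e where xe: "xe = (x, e)" by (cases xe)
  have x: "x \<in> gens" "w \<in> words gens" using Cons.prems by (auto simp: xe)
  have "(if e then gen_elt x else inverse (gen_elt x)) = abs_pgroup [(x, e)]"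
    using abs_pgroup_word_inv[of "[(x, True)]"] x by (simp add: gen_elt_def)
  hence "eval gen_elt (xe # w) = abs_pgroup [(x, e)] * abs_pgroup w"
    using Cons.IH x by (simp only: xe eval.simps fst_conv snd_conv)
  thus ?case using x abs_pgroup_append[of "[(x, e)]" w] by (simp add: xe)
qed (simp add: abs_pgroup_Nil)

lemma satisfies_gen_elt: "satisfies gen_elt rels"
  unfolding satisfies_def
proof (clarify)
  fix l r assume lr: "(l, r) \<in> rels"
  hence w: "l \<in> words gens" "r \<in> words gens" using rels_words by auto
  have "(l, r) \<in> word_cong gens rels" using word_cong.relation[of "[]" gens "[]" l r rels] lr by simp
  thus "eval gen_elt l = eval gen_elt r" using w by (simp add: eval_gen_elt abs_pgroup_eq_iff)
qed

abbreviation "pres_a \<equiv> \<lambda>i. eval gen_elt (wA i)"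
abbreviation "pres_b \<equiv> \<lambda>i. eval gen_elt (wB i)"
abbreviation "pres_p \<equiv> \<lambda>i. eval gen_elt (w\<pi> i)"
abbreviation "pres_q \<equiv> \<lambda>i. eval gen_elt (w\<pi>b i)"
abbreviation "pres_c \<equiv> \<lambda>i. eval gen_elt (wC i)"

interpretation pres: pattern_families pres_a pres_b pres_p pres_q pres_c
  by (rule families_of_relations[OF satisfies_gen_elt])

text \<open>The homomorphism from the presented group to permutations, well defined by \<open>relations_hold\<close>.\<close>

lift_definition realize :: "pgroup \<Rightarrow> cperm" is "eval gen_perm"
  by (rule word_cong_eval[OF relations_hold])

lemma realize_mult [simp]: "realize (a * b) = realize a * realize b"
  by transfer simp

lemma realize_1 [simp]: "realize 1 = 1"
  by transfer simp

lemma realize_inverse [simp]: "realize (inverse a) = inverse (realize a)"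
  by transfer simp

lemma realize_abs: "w \<in> words gens \<Longrightarrow> realize (abs_pgroup w) = eval gen_perm w"
  by (subst realize.abs_eq) (auto intro: word_cong.refl)

lemma wC_words: "wC i \<in> words gens"
  by (simp add: wC_def shifted_words)

lemma realize_families:
  "realize (pres_a i) = perm_a i" "realize (pres_b i) = perm_b i" "realize (pres_p i) = perm_p i" "realize (pres_q i) = perm_q i" "realize (pres_c i) = perm_c i"
  by (simp_all add: eval_gen_elt shifted_words wC_words realize_abs eval_shifted_gens eval_wC_gens)

lemma realize_E: "k \<le> n \<Longrightarrow> realize (pres.E n k c) = perm_E n k c"
  by (cases k; cases c) (simp_all add: perm_E_eq realize_families)

lemma realize_S: "k < n \<Longrightarrow> realize (pres.S n k) = perm_S n k"
  by (cases k) (simp_all add: perm_S_eq realize_families)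

lemma realize_val: "valid n ms \<Longrightarrow> realize (pres.val n ms) = perm_calc.val n ms"
proof (induction ms arbitrary: n)
  case (Cons m ms)
  thus ?case by (cases m) (simp_all add: realize_E realize_S)
qed simp

text \<open>The elements \<open>[P] [Q]\<^sup>-\<^sup>1\<close> of the presented group, given by moves that
build \<open>P\<close> and \<open>Q\<close>.\<close>

definition quotients :: "pgroup set" where
  "quotients = {pres.val 0 ms * inverse (pres.val 0 ms') | ms ms'.
     valid 0 ms \<and> valid 0 ms' \<and> final_size 0 ms = final_size 0 ms'}"

lemma quotientsI:
  "valid 0 ms \<Longrightarrow> valid 0 ms' \<Longrightarrow> final_size 0 ms = final_size 0 ms'
    \<Longrightarrow> pres.val 0 ms * inverse (pres.val 0 ms') \<in> quotients"
  unfolding quotients_def by blast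

lemma quotients_inverse: assumes "g \<in> quotients" shows "inverse g \<in> quotients"
proof -
  obtain ms ms' where "g = pres.val 0 ms * inverse (pres.val 0 ms')"
    "valid 0 ms" "valid 0 ms'" "final_size 0 ms = final_size 0 ms'"
    using assms unfolding quotients_def by blast
  thus ?thesis using quotientsI[of ms' ms] by simp
qed

lemma valid_size_append:
  assumes "valid 0 ms" "valid 0 ms'" "final_size 0 ms = final_size 0 ms'" "valid (final_size 0 ms) r"
  shows "valid 0 (ms @ r)" "valid 0 (ms' @ r)" "final_size 0 (ms @ r) = final_size 0 (ms' @ r)"
    "pres.val 0 (ms @ r) * inverse (pres.val 0 (ms' @ r)) = pres.val 0 ms * inverse (pres.val 0 ms')"
  using assms by (auto simp: valid_append final_size_append pres.val_append mult.assoc)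

text \<open>Common refinement of the inner two patterns of \<open>[P] [Q]\<^sup>-\<^sup>1 [P']
[Q']\<^sup>-\<^sup>1\<close>: after the same moves on both members of each pair, coherence lets the inner
factors cancel.\<close>

lemma quotients_mult: assumes "g \<in> quotients" "h \<in> quotients" shows "g * h \<in> quotients"
proof -
  obtain ms ms' where g: "g = pres.val 0 ms * inverse (pres.val 0 ms')"
    "valid 0 ms" "valid 0 ms'" "final_size 0 ms = final_size 0 ms'"
    using assms unfolding quotients_def by blast
  obtain ns ns' where h: "h = pres.val 0 ns * inverse (pres.val 0 ns')"
    "valid 0 ns" "valid 0 ns'" "final_size 0 ns = final_size 0 ns'"
    using assms unfolding quotients_def by blast
  have d: "derivable (final_size 0 ms) (run ms' squares)" "derivable (final_size 0 ns) (run ns squares)"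
    unfolding derivable_def using g h by auto
  obtain r t where rt: "valid (final_size 0 ms) r" "valid (final_size 0 ns) t"
     "final_size (final_size 0 ms) r = final_size (final_size 0 ns) t"
     "run r (run ms' squares) = run t (run ns squares)"
    using common_refinement[OF d] by blast
  note gr = valid_size_append[OF g(2-4) rt(1)] and ht = valid_size_append[OF h(2-4) rt(2)]
  have "pres.val 0 (ms' @ r) = pres.val 0 (ns @ t)"
    using gr ht rt g h by (intro pres.coherence[OF tiling_squares]) (auto simp: final_size_append run_append)
  hence "g * h = pres.val 0 (ms @ r) * inverse (pres.val 0 (ns' @ t))"
    unfolding g(1) h(1) gr(4)[symmetric] ht(4)[symmetric] by (simp add: mult.assoc)
  moreover have "final_size 0 (ms @ r) = final_size 0 (ns' @ t)"
    using rt(3) ht(3) by (simp add: final_size_append)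
  ultimately show ?thesis using quotientsI gr(1) ht(2) by simp
qed

definition spine :: "nat \<Rightarrow> move list" where "spine n = replicate n (Split Vert 0)"

lemma spine: "valid m (spine n)" "final_size m (spine n) = m + n" "pres.val m (spine n) = 1"
  by (induction n arbitrary: m) (auto simp: spine_def)

lemma weight_in_quotients:
  assumes "valid_move n m" shows "pres.weight n m \<in> quotients"
proof -
  let ?k = "next_size n m"
  have "pres.val 0 (spine n @ [m]) * inverse (pres.val 0 (spine ?k)) \<in> quotients"
    using assms by (intro quotientsI) (auto simp: valid_append final_size_append spine)
  thus ?thesis by (simp add: pres.val_append spine)
qed

lemma quotients_UNIV: "g \<in> quotients"
proof -
  have gen: "gen_elt x \<in> quotients" if x: "x \<in> gens" for x
  proof -
    have "pres_a i \<in> quotients" "pres_b i \<in> quotients" "pres_p i \<in> quotients" "pres_q i \<in> quotients" for i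
      using weight_in_quotients[of "Suc i" "Split Vert 1"] weight_in_quotients[of "Suc i" "Split Horiz 1"]
        weight_in_quotients[of "Suc (Suc i)" "Swap 1"] weight_in_quotients[of "Suc i" "Swap 0"]
      by simp_all
    from this[of 0] this[of 1] show ?thesis using x by (auto simp: gens_iff)
  qed
  have one: "1 \<in> quotients" using quotientsI[of "[]" "[]"] by simp
  have "abs_pgroup w \<in> quotients" if "w \<in> words gens" for w
    unfolding eval_gen_elt[OF that, symmetric] using that
  proof (induction w)
    case (Cons xe w)
    thus ?case using gen quotients_inverse by (cases xe) (auto intro!: quotients_mult)
  qed (use one in simp)
  moreover obtain w where "w \<in> words gens" "g = abs_pgroup w" by (rule abs_pgroup_surj)
  ultimately show ?thesis by simp
qed

lemma realize_quotient:
  assumes "valid 0 ms" "valid 0 ms'" "final_size 0 ms = final_size 0 ms'"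
  shows "realize (pres.val 0 ms * inverse (pres.val 0 ms')) = pair_perm (run ms squares) (run ms' squares)"
  using assms by (simp add: realize_val perm_val pair_perm_eq tiling_run mult.assoc)

lemma realize_range: "range realize = {pair_perm p q | p q n. derivable n p \<and> derivable n q}"
proof (intro equalityI subsetI)
  fix x assume "x \<in> range realize"
  then obtain g where "x = realize g" by blast
  moreover obtain ms ms' where "g = pres.val 0 ms * inverse (pres.val 0 ms')"
    "valid 0 ms" "valid 0 ms'" "final_size 0 ms = final_size 0 ms'"
    using quotients_UNIV[of g] unfolding quotients_def by blast
  ultimately have "x = pair_perm (run ms squares) (run ms' squares)" "valid 0 ms" "valid 0 ms'"
     "final_size 0 ms = final_size 0 ms'"
    using realize_quotient by simp_all
  thus "x \<in> {pair_perm p q | p q n. derivable n p \<and> derivable n q}"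
    unfolding derivable_def by blast
next
  fix x assume "x \<in> {pair_perm p q | p q n. derivable n p \<and> derivable n q}"
  then obtain ms ms' where "x = pair_perm (run ms squares) (run ms' squares)"
    "valid 0 ms" "valid 0 ms'" "final_size 0 ms = final_size 0 ms'"
    unfolding derivable_def by auto
  hence "x = realize (pres.val 0 ms * inverse (pres.val 0 ms'))" using realize_quotient by metis
  thus "x \<in> range realize" by blast
qed

lemma realize_kernel: assumes "realize g = 1" shows "g = 1"
proof -
  obtain ms ms' where g: "g = pres.val 0 ms * inverse (pres.val 0 ms')"
    "valid 0 ms" "valid 0 ms'" "final_size 0 ms = final_size 0 ms'"
    using quotients_UNIV[of g] unfolding quotients_def by blast
  have "run ms squares = run ms' squares"
    using assms g by (intro pair_perm_eq_1) (auto simp: realize_quotient tiling_run simp del: realize_mult)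
  hence "pres.val 0 ms = pres.val 0 ms'" using g by (intro pres.coherence[OF tiling_squares]) auto
  thus ?thesis using g by simp
qed

theorem realize_inject: "realize g = realize h \<longleftrightarrow> g = h"
proof
  assume "realize g = realize h"
  hence "g * inverse h = 1" by (intro realize_kernel) simp
  thus "g = h" by (metis group_inverse_cancel(1) mult.assoc mult_1_left mult_1_right)
qed simp


section \<open>Patterns and the group 2V\<close>

lemma split_image:
  assumes "inj p" "k \<le> n"
  shows "split_at c k p ` {..Suc n} = p ` {..n} - {p k} \<union> {child c False (p k), child c True (p k)}"
proof (intro equalityI subsetI)
  fix a assume "a \<in> split_at c k p ` {..Suc n}"
  then obtain i where i: "i \<le> Suc n" "a = split_at c k p i" by auto
  consider "i < k" | "i = k \<or> i = Suc k" | "Suc k < i" by linarith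
  thus "a \<in> p ` {..n} - {p k} \<union> {child c False (p k), child c True (p k)}"
  proof cases
    case 1
    hence "a = p i" "i \<le> n" "i \<noteq> k" using i assms(2) by (auto simp: split_at_def)
    thus ?thesis using assms(1) by (auto simp: inj_eq)
  next
    case 2
    thus ?thesis using i by (auto simp: split_at_def)
  next
    case 3
    hence "a = p (i - 1)" "i - 1 \<le> n" "i - 1 \<noteq> k" using i by (auto simp: split_at_def)
    thus ?thesis using assms(1) by (auto simp: inj_eq)
  qed
next
  fix a assume a: "a \<in> p ` {..n} - {p k} \<union> {child c False (p k), child c True (p k)}"
  have "split_at c k p k = child c False (p k)" "split_at c k p (Suc k) = child c True (p k)"
    by (simp_all add: split_at_def)
  moreover have "\<exists>j\<le>Suc n. p i = split_at c k p j" if "i \<le> n" "i \<noteq> k" for i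
    using that by (intro exI[of _ "if i < k then i else Suc i"]) (auto simp: split_at_def)
  ultimately show "a \<in> split_at c k p ` {..Suc n}" using a assms(2)
    by (auto simp: image_iff) (metis Suc_le_mono atMost_iff le_SucI)+
qed

lemma split_range:
  assumes "inj p"
  shows "range (split_at c k p) = range p - {p k} \<union> {child c False (p k), child c True (p k)}"
proof -
  have r: "range f = (\<Union>n\<in>{k..}. f ` {..n})" "range f = (\<Union>n\<in>{k..}. f ` {..Suc n})" for f :: config
    by (auto simp: image_iff) (metis atLeast_iff atMost_iff le_SucI max.cobounded1 max.cobounded2)+
  have "range (split_at c k p) = (\<Union>n\<in>{k..}. p ` {..n} - {p k} \<union> {child c False (p k), child c True (p k)})"
    unfolding r(2)[of "split_at c k p"] using split_image[OF assms] by (intro SUP_cong) auto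
  also have "\<dots> = range p - {p k} \<union> {child c False (p k), child c True (p k)}"
    unfolding r(1)[of p] by auto
  finally show ?thesis .
qed

lemma swap_range: "range (swap_at k p) = range p"
proof -
  have "range (swap_at k p) \<subseteq> range p" for p by (auto simp: swap_at_def)
  from this[of p] this[of "swap_at k p"] show ?thesis by (simp add: swap_swap)
qed

lemma cell_image_replace:
  "cell ` (A - {x} \<union> {y, w}) = cell ` A - {cell x} \<union> {cell y, cell w}"
proof -
  have "inj cell" by (rule injI) (simp only: cell_inj)
  from image_set_diff[OF this, of A "{x}"] show ?thesis
    by (simp only: image_Un image_insert image_empty)
qed

lemma is_pattern_child:
  assumes "is_pattern T" "cell a \<in> T"
  shows "is_pattern (T - {cell a} \<union> {cell (child c False a), cell (child c True a)})"
proof -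
  obtain s u v where a: "a = (s, u, v)" by (cases a)
  show ?thesis
    using is_pattern.vertical[OF assms(1) assms(2)[unfolded a cell.simps]]
      is_pattern.horizontal[OF assms(1) assms(2)[unfolded a cell.simps]]
    by (cases c) (simp_all only: a cell.simps[symmetric] cell_thirds)
qed

lemma is_pattern_run:
  assumes "is_pattern (cell ` range p)" "tiling p"
  shows "is_pattern (cell ` range (run ms p))"
  using assms
proof (induction ms arbitrary: p)
  case (Cons m ms)
  have "is_pattern (cell ` range (act m p))"
  proof (cases m)
    case (Split c k)
    have "cell ` range (split_at c k p)
      = cell ` range p - {cell (p k)} \<union> {cell (child c False (p k)), cell (child c True (p k))}"
      unfolding split_range[OF tiling_inj[OF Cons.prems(2)]] by (rule cell_image_replace)
    thus ?thesis using is_pattern_child[OF Cons.prems(1), of "p k" c] Split by simp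
  next
    case (Swap k)
    thus ?thesis using Cons.prems by (simp add: swap_range)
  qed
  thus ?case using Cons by (simp add: tiling_act)
qed simp

lemma cell_squares: "cell (squares i) = unit_square i"
  by (simp add: squares_def unit_square_def)

lemma cell_subset_square: "cell a \<subseteq> unit_square i \<longleftrightarrow> fst a = i"
proof
  assume "cell a \<subseteq> unit_square i"
  moreover obtain z where "z \<in> cell a" using Y_cell_nonempty by blast
  ultimately have "z \<in> cell a" "z \<in> cell (squares i)" by (auto simp: cell_squares)
  thus "fst a = i" using overlap_same_square by (fastforce simp: squares_def)
next
  assume i: "fst a = i"
  obtain s u v where "a = (s, u, v)" by (cases a)
  thus "cell a \<subseteq> unit_square i"
    using i left_end_bounds[of u] left_end_bounds[of v] by (auto simp: unit_square_def)
qed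

lemma derivable_numbered:
  assumes "derivable n p" shows "numbered_pattern (\<lambda>i. cell (p i))"
proof -
  obtain ms where ms: "p = run ms squares" using assms unfolding derivable_def by blast
  have "cell ` range squares = range unit_square" by (simp add: image_image cell_squares)
  hence "is_pattern (cell ` range p)"
    using is_pattern_run[OF _ tiling_squares] is_pattern.trivial ms by simp
  moreover have "bij_betw (\<lambda>i. cell (p i)) UNIV (cell ` range p)"
    using tiling_inj[OF derivable_tiling[OF assms]]
    by (auto simp: bij_betw_def inj_on_def cell_inj image_image)
  moreover have "{m. cell (p m) \<subseteq> unit_square i} = {i + n}" if "i > 0" for i
  proof -
    have "fst (p m) = i \<longleftrightarrow> m = i + n" for m
      using derivable_supported[OF assms] that
      by (cases "m \<le> n") (auto simp: supported_def squares_def)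
    thus ?thesis by (simp add: cell_subset_square)
  qed
  ultimately show ?thesis unfolding numbered_pattern_def by blast
qed

text \<open>What has to be known about the cells of a pattern: they tile the Cantor set, and those in the first
square can be obtained by moves.\<close>

definition good_cells :: "addr set \<Rightarrow> bool" where
  "good_cells A \<longleftrightarrow> (\<forall>z\<in>cantor_Y. \<exists>!a. a \<in> A \<and> z \<in> cell a)
    \<and> (\<exists>n p. derivable n p \<and> {a \<in> A. fst a = 0} = p ` {..n})"

lemma good_cells_child:
  assumes "good_cells A" "x \<in> A"
  shows "good_cells (A - {x} \<union> {child c False x, child c True x})" (is "good_cells ?A")
proof -
  have uniq: "\<exists>!a. a \<in> A \<and> z \<in> cell a" if "z \<in> cantor_Y" for z
    using assms that unfolding good_cells_def by blast
  have "\<exists>!a. a \<in> ?A \<and> z \<in> cell a" if z: "z \<in> cantor_Y" for z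
  proof (cases "z \<in> cell x")
    case True
    obtain b where b: "z \<in> cell (child c b x)" "z \<notin> cell (child c (\<not> b) x)"
      using Y_child[OF z, where a = x and c = c] True by (metis (full_types))
    show ?thesis
    proof (rule ex1I[of _ "child c b x"])
      show "child c b x \<in> ?A \<and> z \<in> cell (child c b x)" using b(1) by (cases b) auto
      fix a assume a: "a \<in> ?A \<and> z \<in> cell a"
      have "a \<notin> A - {x}" using uniq[OF z] a True assms(2) by blast
      thus "a = child c b x" using a b by (cases b) auto
    qed
  next
    case False
    hence nb: "z \<notin> cell (child c b x)" for b using Y_child(1)[OF z, where a = x and c = c] by (metis (full_types))
    obtain a where a: "a \<in> A" "z \<in> cell a" "\<And>a'. a' \<in> A \<Longrightarrow> z \<in> cell a' \<Longrightarrow> a' = a"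
      using uniq[OF z] by blast
    show ?thesis
    proof (rule ex1I[of _ a])
      show "a \<in> ?A \<and> z \<in> cell a" using a(1,2) False by auto
      show "a' = a" if "a' \<in> ?A \<and> z \<in> cell a'" for a' using that nb a(3) by blast
    qed
  qed
  moreover have "\<exists>n p. derivable n p \<and> {a \<in> ?A. fst a = 0} = p ` {..n}"
  proof -
    obtain n p where p: "derivable n p" "{a \<in> A. fst a = 0} = p ` {..n}"
      using assms unfolding good_cells_def by blast
    show ?thesis
    proof (cases "fst x = 0")
      case True
      then obtain k where k: "k \<le> n" "x = p k" using assms(2) p(2) by blast
      have "{a \<in> ?A. fst a = 0} = p ` {..n} - {x} \<union> {child c False x, child c True x}"
        using p(2) True by auto
      hence "{a \<in> ?A. fst a = 0} = split_at c k p ` {..Suc n}"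
        using split_image[OF tiling_inj[OF derivable_tiling[OF p(1)]] k(1), of c] k(2) by simp
      moreover have "derivable (Suc n) (split_at c k p)"
        using derivable_run[OF p(1), of "[Split c k]"] k by simp
      ultimately show ?thesis by blast
    next
      case False
      hence "{a \<in> ?A. fst a = 0} = {a \<in> A. fst a = 0}" by auto
      with p(2) have "{a \<in> ?A. fst a = 0} = p ` {..n}" by (simp only:)
      with p(1) show ?thesis by (intro exI conjI)
    qed
  qed
  ultimately show ?thesis unfolding good_cells_def by (intro conjI ballI)
qed

lemma good_cells_squares: "good_cells (range squares)"
proof -
  have "\<exists>!a. a \<in> range squares \<and> z \<in> cell a" if z: "z \<in> cantor_Y" for z
  proof -
    obtain i where i: "z \<in> cell (squares i)" using tiling_obtain tiling_squares z .
    show ?thesis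
    proof (rule ex1I[of _ "squares i"])
      fix a assume "a \<in> range squares \<and> z \<in> cell a"
      then obtain j where "a = squares j" "z \<in> cell (squares j)" by blast
      thus "a = squares i" using tiling_disjoint[OF tiling_squares z i] by simp
    qed (use i in simp)
  qed
  moreover have "derivable 0 squares" unfolding derivable_def by (intro exI[of _ "[]"]) simp
  moreover have "{a \<in> range squares. fst a = 0} = squares ` {..0}" by (auto simp: squares_def)
  ultimately show ?thesis unfolding good_cells_def by (intro conjI ballI exI)
qed

lemma rect_eq_cell:
  assumes "{a..b} \<times> {c..d} = cell (s, u, v)"
  shows "a = 2 * real s + left_end u" "b = a + 1 / 3 ^ length u" "c = left_end v" "d = c + 1 / 3 ^ length v"
  using assms by (auto simp: times_eq_iff Icc_eq_Icc)

lemma is_pattern_cells: "is_pattern T \<Longrightarrow> \<exists>A. T = cell ` A \<and> good_cells A"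
proof (induction rule: is_pattern.induct)
  case trivial
  thus ?case using good_cells_squares by (intro exI[of _ "range squares"]) (auto simp: image_image cell_squares)
next
  case (vertical T a b c d)
  then obtain A x where A: "T = cell ` A" "good_cells A" "x \<in> A" "{a..b} \<times> {c..d} = cell x" by auto
  obtain s u v where x: "x = (s, u, v)" by (cases x)
  note eqs = rect_eq_cell[OF A(4)[unfolded x]]
  have "T - {{a..b} \<times> {c..d}} \<union> {left_third a b c d, right_third a b c d}
      = cell ` (A - {x} \<union> {child Vert False x, child Vert True x})"
    unfolding A(4) unfolding A(1) eqs(2,4) unfolding eqs(1,3) x cell_thirds cell_image_replace ..
  thus ?case using good_cells_child[OF A(2,3)] by blast
next
  case (horizontal T a b c d)
  then obtain A x where A: "T = cell ` A" "good_cells A" "x \<in> A" "{a..b} \<times> {c..d} = cell x" by auto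
  obtain s u v where x: "x = (s, u, v)" by (cases x)
  note eqs = rect_eq_cell[OF A(4)[unfolded x]]
  have "T - {{a..b} \<times> {c..d}} \<union> {bottom_third a b c d, top_third a b c d}
      = cell ` (A - {x} \<union> {child Horiz False x, child Horiz True x})"
    unfolding A(4) unfolding A(1) eqs(2,4) unfolding eqs(1,3) x cell_thirds cell_image_replace ..
  thus ?case using good_cells_child[OF A(2,3)] by blast
qed

lemma numbered_pattern_cells:
  assumes "numbered_pattern P"
  obtains p n p0 where "P = (\<lambda>i. cell (p i))" "tiling p" "derivable n p0"
    "{a \<in> range p. fst a = 0} = p0 ` {..n}"
proof -
  obtain T where T: "is_pattern T" "bij_betw P UNIV T" using assms unfolding numbered_pattern_def by blast
  obtain A where A: "T = cell ` A" "good_cells A" using is_pattern_cells[OF T(1)] by blast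
  have "\<forall>i. \<exists>a. a \<in> A \<and> cell a = P i" using T(2) A(1) unfolding bij_betw_def by (metis imageE rangeI)
  then obtain p where p: "\<And>i. p i \<in> A \<and> cell (p i) = P i" by metis
  have "range p = A"
  proof
    show "A \<subseteq> range p"
    proof
      fix a assume "a \<in> A"
      hence "cell a \<in> range P" using A(1) T(2) by (auto simp: bij_betw_def)
      then obtain i where "cell a = cell (p i)" using p by auto
      thus "a \<in> range p" by (simp add: cell_inj)
    qed
  qed (use p in auto)
  moreover have "tiling p"
    unfolding tiling_def
  proof
    fix z assume "z \<in> cantor_Y"
    hence "\<exists>!a. a \<in> A \<and> z \<in> cell a" using A(2) unfolding good_cells_def by simp
    then obtain a where a: "a \<in> A \<and> z \<in> cell a" "\<forall>a'. a' \<in> A \<and> z \<in> cell a' \<longrightarrow> a' = a"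
      by (rule ex1E)
    then obtain i where i: "a = p i" using \<open>range p = A\<close> by blast
    have "j = i" if "z \<in> cell (p j)" for j
    proof -
      have "p j = p i" using a(2) that p[of j] unfolding i by blast
      hence "P j = P i" using p by metis
      thus ?thesis using T(2) by (auto simp: bij_betw_def inj_def)
    qed
    thus "\<exists>!i. z \<in> cell (p i)" using a(1) i by (intro ex1I[of _ i]) simp_all
  qed
  moreover obtain n p0 where "derivable n p0" "{a \<in> A. fst a = 0} = p0 ` {..n}"
    using A(2) unfolding good_cells_def by blast
  moreover have "P = (\<lambda>i. cell (p i))" using p by auto
  ultimately show ?thesis using that by simp
qed

lemma hat_mult: "Rep_cperm f \<otimes>\<^bsub>V2_hat\<^esub> Rep_cperm g = Rep_cperm (f * g)"
  using Rep_cperm[of f] Rep_cperm[of g]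
  by (simp add: V2_hat_def BijGroup_def times_cperm.rep_eq)

lemma hat_one: "\<one>\<^bsub>V2_hat\<^esub> = Rep_cperm 1"
  by (simp add: V2_hat_def BijGroup_def one_cperm.rep_eq)

lemma hat_pow: "Rep_cperm f [^]\<^bsub>V2_hat\<^esub> (n::nat) = Rep_cperm (f ^ n)"
  by (induction n) (simp_all add: nat_pow_def hat_one hat_mult power_commutes)

lemma hat_carrier: "carrier V2_hat = {pattern_pair P Q | P Q. numbered_pattern P \<and> numbered_pattern Q}"
  by (simp add: V2_hat_def)

lemma hat_carrier_Rep: assumes "x \<in> carrier V2_hat" obtains f where "x = Rep_cperm f"
proof -
  obtain P Q where x: "x = pattern_pair P Q" "numbered_pattern P" "numbered_pattern Q"
    using assms unfolding hat_carrier by blast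
  obtain p where "P = (\<lambda>i. cell (p i))" "tiling p" using numbered_pattern_cells[OF x(2)] .
  moreover obtain q where "Q = (\<lambda>i. cell (q i))" "tiling q" using numbered_pattern_cells[OF x(3)] .
  ultimately have "x = Rep_cperm (pair_perm p q)" using x by (simp add: pattern_pair_eq_cellwise Rep_pair_perm)
  thus ?thesis using that by blast
qed

lemma hat_carrierI: "derivable n p \<Longrightarrow> derivable m q \<Longrightarrow> Rep_cperm (pair_perm p q) \<in> carrier V2_hat"
  unfolding hat_carrier
  using derivable_numbered derivable_tiling pattern_pair_eq_cellwise Rep_pair_perm by (metis (mono_tags, lifting) mem_Collect_eq)

text \<open>The inverse in the sense of the carrier-based structure is unique because all members of the carrier
are permutations.\<close>

lemma hat_inverse:
  assumes "Rep_cperm (inverse f) \<in> carrier V2_hat"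
  shows "inv\<^bsub>V2_hat\<^esub> (Rep_cperm f) = Rep_cperm (inverse f)"
  unfolding m_inv_def
proof (rule the_equality)
  show "Rep_cperm (inverse f) \<in> carrier V2_hat \<and> Rep_cperm f \<otimes>\<^bsub>V2_hat\<^esub> Rep_cperm (inverse f) = \<one>\<^bsub>V2_hat\<^esub> \<and>
    Rep_cperm (inverse f) \<otimes>\<^bsub>V2_hat\<^esub> Rep_cperm f = \<one>\<^bsub>V2_hat\<^esub>"
    using assms by (simp add: hat_mult hat_one)
  fix y assume y: "y \<in> carrier V2_hat \<and> Rep_cperm f \<otimes>\<^bsub>V2_hat\<^esub> y = \<one>\<^bsub>V2_hat\<^esub> \<and> y \<otimes>\<^bsub>V2_hat\<^esub> Rep_cperm f = \<one>\<^bsub>V2_hat\<^esub>"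
  then obtain g where g: "y = Rep_cperm g" using hat_carrier_Rep by blast
  with y have "f * g = 1" by (simp add: hat_mult hat_one Rep_cperm_inject)
  thus "y = Rep_cperm (inverse f)" using g group_inverse_unique by metis
qed

lemma derivable_squares: "derivable 0 squares"
  unfolding derivable_def by (intro exI[of _ "[]"]) simp

lemma unit_square_cells: "unit_square = (\<lambda>i. cell (squares i))"
  by (simp add: cell_squares)

lemma elt_of_pattern_cells: "tiling p \<Longrightarrow> elt_of_pattern (\<lambda>i. cell (p i)) = Rep_cperm (config_perm p)"
  unfolding elt_of_pattern_def unit_square_cells config_perm_def
  by (simp add: pattern_pair_eq_cellwise Rep_pair_perm)

lemma elt_basic: "elt_v i = Rep_cperm (split_perm Vert i)" "elt_h i = Rep_cperm (split_perm Horiz i)"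
  "elt_\<sigma> i = Rep_cperm (swap_perm i)"
proof -
  have sq: "unit_square n = cell (n, [], [])" for n
    using cell_squares[of n] by (simp only: squares_def)
  have thirds: "left_third (2 * real i) (2 * real i + 1) 0 1 = cell (child Vert False (i, [], []))"
    "right_third (2 * real i) (2 * real i + 1) 0 1 = cell (child Vert True (i, [], []))"
    "bottom_third (2 * real i) (2 * real i + 1) 0 1 = cell (child Horiz False (i, [], []))"
    "top_third (2 * real i) (2 * real i + 1) 0 1 = cell (child Horiz True (i, [], []))"
    using cell_thirds[of i "[]" "[]"] by simp_all
  have "v_pattern i = (\<lambda>n. cell (split_at Vert i squares n))"
    "h_pattern i = (\<lambda>n. cell (split_at Horiz i squares n))"
    by (intro ext; simp only: v_pattern_def h_pattern_def split_at_def squares_def sq thirds; simp)+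
  moreover have "\<sigma>_pattern i = (\<lambda>n. cell (swap_at i squares n))"
    by (auto simp: fun_eq_iff \<sigma>_pattern_def swap_at_def cell_squares)
  ultimately show "elt_v i = Rep_cperm (split_perm Vert i)" "elt_h i = Rep_cperm (split_perm Horiz i)"
    "elt_\<sigma> i = Rep_cperm (swap_perm i)"
    by (simp_all add: elt_v_def elt_h_def elt_\<sigma>_def elt_of_pattern_cells split_perm_def swap_perm_def)
qed

lemma split0_power: "split0 ^ n = config_perm (run (spine n) squares)"
proof -
  have "perm_calc.val m (spine n) = 1" for m
    by (induction n arbitrary: m) (auto simp: spine_def perm_E_eq)
  hence "config_perm (run (spine n) squares) * inverse (split0 ^ n) = 1"
    using perm_val[of "spine n"] by (simp add: spine)
  thus ?thesis by (metis inverse_inverse group_inverse_unique)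
qed

lemma quot_split0_power: "elt_quot (Rep_cperm f) (Rep_cperm (split0 ^ n)) = Rep_cperm (f * inverse (split0 ^ n))"
proof -
  have "derivable n (run (spine n) squares)" unfolding derivable_def by (intro exI[of _ "spine n"]) (simp add: spine)
  hence "Rep_cperm (inverse (split0 ^ n)) \<in> carrier V2_hat"
    using hat_carrierI[OF derivable_squares] derivable_tiling
    by (simp add: split0_power config_perm_def inverse_pair_perm)
  thus ?thesis unfolding elt_quot_def by (simp add: hat_inverse hat_mult)
qed

lemma gen_val_eq: "gen_val x = Rep_cperm (gen_perm x)"
  by (cases x) (simp_all only: gen_val.simps gen_perm.simps elt_A_def elt_B_def elt_\<pi>_def
      elt_\<pi>b_def elt_basic hat_pow hat_mult quot_split0_power perm_a_def perm_b_def perm_p_def perm_q_def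
      perm_E_def perm_S_def mult.assoc Suc_eq_plus1[symmetric] add_2_eq_Suc')

lemma V2_mult: "Rep_cperm f \<otimes>\<^bsub>V2\<^esub> Rep_cperm g = Rep_cperm (f * g)"
  using hat_mult by (simp add: V2_def)

lemma V2_one: "\<one>\<^bsub>V2\<^esub> = Rep_cperm 1"
  using hat_one by (simp add: V2_def)

lemma V2_carrier: "carrier V2 = {g \<in> carrier V2_hat. \<forall>p \<in> cantor_Y - unit_square 0. g p = p}"
  by (simp add: V2_def)

lemma not_in_square_0: "z \<in> cell a \<Longrightarrow> z \<notin> unit_square 0 \<longleftrightarrow> fst a \<noteq> 0"
  by (metis cell_squares cell_subset_square fst_conv overlap_same_square squares_def subsetD)

lemma cellwise_outside_square_0:
  assumes "derivable n p" "derivable n q" "z \<in> cantor_Y - unit_square 0"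
  shows "cellwise p q z = z"
proof -
  obtain i where i: "z \<in> cell (q i)" using tiling_obtain derivable_tiling[OF assms(2)] assms(3) by blast
  hence "fst (q i) \<noteq> 0" using not_in_square_0 assms(3) by blast
  hence "i > n" using derivable_supported[OF assms(2)] unfolding supported_def by (meson linorder_not_le)
  hence "p i = q i" using derivable_supported[OF assms(1)] derivable_supported[OF assms(2)]
    unfolding supported_def by simp
  thus ?thesis using cellwise_eq[OF derivable_tiling[OF assms(2)] _ i] assms(3) by (simp add: cell_map_self)
qed

text \<open>The rectangles of a pattern that lie in the first square, in any order, form a derivable configuration.\<close>

lemma reorder_derivable:
  assumes "tiling p" "derivable n p0" "{a \<in> range p. fst a = 0} = p0 ` {..n}"
    and e: "bij_betw e {..n} {i. fst (p i) = 0}"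
  shows "derivable n (\<lambda>i. if i \<le> n then p (e i) else squares (i - n))" (is "derivable n ?q")
proof -
  have mapq: "map ?q [0..<Suc n] = map (\<lambda>i. p (e i)) [0..<Suc n]" by (intro map_cong) auto
  have set: "{0..<Suc n} = {..n}" by auto
  have "(\<lambda>i. p (e i)) ` {..n} = p ` {i. fst (p i) = 0}"
    unfolding bij_betw_imp_surj_on[OF e, symmetric] image_image ..
  also have "\<dots> = {a \<in> range p. fst a = 0}" by auto
  finally have im: "(\<lambda>i. p (e i)) ` {..n} = p0 ` {..n}" using assms(3) by simp
  have "inj p0" using tiling_inj derivable_tiling assms(2) by blast
  have "distinct (map p0 [0..<Suc n])" unfolding distinct_map
    by (meson \<open>inj p0\<close> distinct_upt inj_on_subset subset_UNIV)
  moreover have "inj_on (\<lambda>i. p (e i)) {..n}"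
    using e tiling_inj[OF assms(1)] by (auto simp: bij_betw_def inj_on_def inj_def)
  hence "distinct (map (\<lambda>i. p (e i)) [0..<Suc n])" unfolding distinct_map
    by (simp only: distinct_upt set_upt set simp_thms)
  moreover have "set (map p0 [0..<Suc n]) = set (map (\<lambda>i. p (e i)) [0..<Suc n])"
    using im by (simp only: set_map set_upt set)
  ultimately have "mset (map p0 [0..<Suc n]) = mset (map (\<lambda>i. p (e i)) [0..<Suc n])"
    using set_eq_iff_mset_eq_distinct by blast
  hence "mset (map p0 [0..<Suc n]) = mset (map ?q [0..<Suc n])" unfolding mapq .
  moreover have "p0 i = ?q i" if "n < i" for i
    using derivable_supported[OF assms(2)] that by (simp add: supported_def)
  ultimately obtain s where "swaps n s" "run s p0 = ?q" using permutation_by_swaps[of p0 n ?q] by blast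
  thus ?thesis using derivable_run[OF assms(2), of s] swaps_valid by metis
qed

text \<open>A pair of patterns that acts as the identity off the first square uses the same numbers for rectangles
in the first square on both sides.  Renumbering both patterns in the same way, with these numbers first
and in place of everything else the undivided squares, gives a pair with the same map.\<close>

lemma V2_element:
  assumes "g \<in> carrier V2" obtains n p q where "derivable n p" "derivable n q" "g = Rep_cperm (pair_perm p q)"
proof -
  obtain P Q where PQ: "g = pattern_pair P Q" "numbered_pattern P" "numbered_pattern Q"
    using assms unfolding V2_carrier hat_carrier by blast
  have g_id: "g z = z" if "z \<in> cantor_Y - unit_square 0" for z
    using assms that unfolding V2_carrier by blast
  obtain p n p0 where p: "P = (\<lambda>i. cell (p i))" "tiling p" "derivable n p0"
    "{a \<in> range p. fst a = 0} = p0 ` {..n}" using numbered_pattern_cells[OF PQ(2)] .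
  obtain q m q0 where q: "Q = (\<lambda>i. cell (q i))" "tiling q" "derivable m q0"
    "{a \<in> range q. fst a = 0} = q0 ` {..m}" using numbered_pattern_cells[OF PQ(3)] .
  have g: "g = cellwise p q" using PQ p q by (simp add: pattern_pair_eq_cellwise)
  have inj_g: "inj_on g cantor_Y" using cellwise_Bij[OF p(2) q(2)] g by (auto simp: Bij_def bij_betw_def)
  (* Otherwise a point off the first square would be the image of itself and of a point in it. *)
  have same: "fst (p i) = 0 \<longleftrightarrow> fst (q i) = 0" for i
  proof -
    obtain z where z: "z \<in> cantor_Y" "z \<in> cell (q i)" using Y_cell_nonempty by blast
    have w: "g z \<in> cantor_Y" "g z \<in> cell (p i)" using cellwise_cell[OF q(2) z] g by auto
    show ?thesis
    proof (cases "fst (q i) = 0")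
      case True
      have "fst (p i) = 0"
      proof (rule ccontr)
        assume "fst (p i) \<noteq> 0"
        hence "g (g z) = g z" using g_id w not_in_square_0 by blast
        hence "g z = z" using inj_g w z by (auto dest: inj_onD)
        thus False using \<open>fst (p i) \<noteq> 0\<close> True w z overlap_same_square by metis
      qed
      with True show ?thesis by simp
    next
      case False
      hence "g z = z" using g_id z not_in_square_0 by blast
      thus ?thesis using w(2) z(2) overlap_same_square by metis
    qed
  qed
  let ?I = "{i. fst (q i) = 0}"
  have card_I: "finite ?I \<and> card ?I = Suc k"
    if "tiling r" "derivable k r0" "{a \<in> range r. fst a = 0} = r0 ` {..k}" "?I = {i. fst (r i) = 0}" for r r0 k
  proof -
    have "{a \<in> range r. fst a = 0} = r ` {i. fst (r i) = 0}" by auto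
    hence "r ` ?I = r0 ` {..k}" using that(3,4) by simp
    moreover have "inj_on r ?I" "inj_on r0 {..k}"
      using tiling_inj[OF that(1)] tiling_inj[OF derivable_tiling[OF that(2)]] by (auto intro: inj_on_subset)
    ultimately show ?thesis
      by (metis card_atMost card_image finite_atMost finite_imageD finite_imageI)
  qed
  have I: "finite ?I" "card ?I = Suc m" using card_I[OF q(2-4)] by auto
  moreover have "card ?I = Suc n" using card_I[OF p(2-4)] same by auto
  ultimately have mn: "m = n" by simp
  obtain e where "bij_betw e {0..<card ?I} ?I" using ex_bij_betw_nat_finite[OF I(1)] by blast
  moreover have "{0..<card ?I} = {..n}" using I(2) mn by auto
  ultimately have e: "bij_betw e {..n} ?I" by simp
  define p' where "p' = (\<lambda>i. if i \<le> n then p (e i) else squares (i - n))"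
  define q' where "q' = (\<lambda>i. if i \<le> n then q (e i) else squares (i - n))"
  have p': "derivable n p'" unfolding p'_def using reorder_derivable[OF p(2-4)] e same by simp
  have q': "derivable n q'" unfolding q'_def using reorder_derivable[OF q(2-4)[unfolded mn] e] .
  have "cellwise p' q' = g"
  proof (rule extensionalityI[of _ cantor_Y])
    fix z assume z: "z \<in> cantor_Y"
    show "cellwise p' q' z = g z"
    proof (cases "z \<in> unit_square 0")
      case False
      thus ?thesis using g_id cellwise_outside_square_0[OF p' q'] z by simp
    next
      case True
      obtain i where i: "z \<in> cell (q i)" using tiling_obtain q(2) z .
      hence "fst (q i) = 0" using True not_in_square_0 by blast
      then obtain j where j: "j \<le> n" "i = e j" using e by (auto simp: bij_betw_def)
      have "cellwise p' q' z = cell_map (p' j) (q' j) z"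
        using i j by (intro cellwise_eq[OF derivable_tiling[OF q'] z]) (simp add: q'_def)
      thus ?thesis using cellwise_eq[OF q(2) z i] j g by (simp add: p'_def q'_def)
    qed
  qed (auto simp: g cellwise_extensional)
  thus ?thesis using that p' q' derivable_tiling Rep_pair_perm by metis
qed

lemma V2_carrier_realize: "carrier V2 = range (\<lambda>g. Rep_cperm (realize g))"
proof (intro equalityI subsetI)
  fix x assume "x \<in> carrier V2"
  then obtain n p q where "derivable n p" "derivable n q" "x = Rep_cperm (pair_perm p q)" by (rule V2_element)
  moreover from this have "pair_perm p q \<in> range realize" unfolding realize_range by blast
  ultimately show "x \<in> range (\<lambda>g. Rep_cperm (realize g))" by auto
next
  fix x assume "x \<in> range (\<lambda>g. Rep_cperm (realize g))"
  then obtain g where g: "x = Rep_cperm (realize g)" by blast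
  have "realize g \<in> range realize" by simp
  then obtain n p q where pq: "realize g = pair_perm p q" "derivable n p" "derivable n q" unfolding realize_range by blast
  hence "x = cellwise p q" using g Rep_pair_perm derivable_tiling by simp
  thus "x \<in> carrier V2" unfolding V2_carrier
    using pq g hat_carrierI[OF pq(2,3)] cellwise_outside_square_0[OF pq(2,3)] by simp
qed

lemma group_V2: "group V2"
proof (rule groupI)
  fix x y z assume xyz: "x \<in> carrier V2" "y \<in> carrier V2" "z \<in> carrier V2"
  then obtain f g h where fgh: "x = Rep_cperm (realize f)" "y = Rep_cperm (realize g)" "z = Rep_cperm (realize h)"
    unfolding V2_carrier_realize by blast
  show "x \<otimes>\<^bsub>V2\<^esub> y \<in> carrier V2"
    unfolding V2_carrier_realize fgh V2_mult realize_mult[symmetric] by blast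
  show "x \<otimes>\<^bsub>V2\<^esub> y \<otimes>\<^bsub>V2\<^esub> z = x \<otimes>\<^bsub>V2\<^esub> (y \<otimes>\<^bsub>V2\<^esub> z)"
    by (simp add: fgh V2_mult mult.assoc)
next
  show "\<one>\<^bsub>V2\<^esub> \<in> carrier V2" unfolding V2_carrier_realize V2_one realize_1[symmetric] by blast
  fix x assume "x \<in> carrier V2"
  then obtain g where g: "x = Rep_cperm (realize g)" unfolding V2_carrier_realize by blast
  show "\<one>\<^bsub>V2\<^esub> \<otimes>\<^bsub>V2\<^esub> x = x" by (simp add: g V2_one V2_mult)
  have "Rep_cperm (realize (inverse g)) \<in> carrier V2" unfolding V2_carrier_realize by blast
  moreover have "Rep_cperm (realize (inverse g)) \<otimes>\<^bsub>V2\<^esub> x = \<one>\<^bsub>V2\<^esub>"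
    by (simp add: g V2_one V2_mult)
  ultimately show "\<exists>y\<in>carrier V2. y \<otimes>\<^bsub>V2\<^esub> x = \<one>\<^bsub>V2\<^esub>" by blast
qed

text \<open>Any member of a class of words gives the same value, by \<open>class_val\<close> below.\<close>

definition class_val :: "gen word set \<Rightarrow> real \<times> real \<Rightarrow> real \<times> real" where
  "class_val c = Rep_cperm (eval gen_perm (SOME w. w \<in> c))"

lemma class_val:
  assumes "w \<in> words gens" shows "class_val (word_cong gens rels `` {w}) = Rep_cperm (realize (abs_pgroup w))"
proof -
  have "w \<in> word_cong gens rels `` {w}" using assms by (auto intro: word_cong.refl)
  hence "(SOME w'. w' \<in> word_cong gens rels `` {w}) \<in> word_cong gens rels `` {w}" by (rule someI)
  hence "(w, SOME w'. w' \<in> word_cong gens rels `` {w}) \<in> word_cong gens rels" by simp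
  from word_cong_eval[OF relations_hold this] show ?thesis
    by (simp add: class_val_def realize_abs[OF assms])
qed

lemma UN_UN_constant:
  assumes "a \<in> A" "b \<in> B" "\<And>x y. x \<in> A \<Longrightarrow> y \<in> B \<Longrightarrow> F x y = K"
  shows "(\<Union>x\<in>A. \<Union>y\<in>B. F x y) = K"
proof -
  have "(\<Union>x\<in>A. \<Union>y\<in>B. F x y) = (\<Union>x\<in>A. \<Union>y\<in>B. K)" using assms(3) by (intro SUP_cong) auto
  thus ?thesis using assms(1,2) by auto
qed

lemma presented_mult:
  assumes "u \<in> words X" "v \<in> words X" "R \<subseteq> words X \<times> words X"
  shows "word_cong X R `` {u} \<otimes>\<^bsub>presented_group X R\<^esub> word_cong X R `` {v} = word_cong X R `` {u @ v}"
proof -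
  have cong: "word_cong X R `` {u' @ v'} = word_cong X R `` {u @ v}"
    if "(u, u') \<in> word_cong X R" "(v, v') \<in> word_cong X R" for u' v'
    using word_cong_append[OF assms(3) that] by (auto intro: word_cong.sym word_cong.trans)
  have mem: "u \<in> word_cong X R `` {u}" "v \<in> word_cong X R `` {v}"
    using assms by (auto intro: word_cong.refl)
  have "(\<Union>u'\<in>word_cong X R `` {u}. \<Union>v'\<in>word_cong X R `` {v}. word_cong X R `` {u' @ v'})
      = word_cong X R `` {u @ v}"
    by (rule UN_UN_constant[OF mem], rule cong; simp only: Image_singleton_iff)
  thus ?thesis by (simp add: presented_group_def)
qed

theorem theorem5:
  shows "is_presentation V2 gens gen_val (relations1 \<union> relations2)"
proof -
  have carrier: "carrier (presented_group gens rels) = (\<lambda>w. word_cong gens rels `` {w}) ` words gens"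
    by (auto simp: presented_group_def quotient_def)
  have hom: "class_val \<in> hom (presented_group gens rels) V2"
  proof (rule homI)
    fix c d assume "c \<in> carrier (presented_group gens rels)" "d \<in> carrier (presented_group gens rels)"
    then obtain u v where uv: "u \<in> words gens" "c = word_cong gens rels `` {u}"
      "v \<in> words gens" "d = word_cong gens rels `` {v}" unfolding carrier by blast
    show "class_val c \<in> carrier V2" unfolding V2_carrier_realize uv(2) class_val[OF uv(1)] by blast
    show "class_val (c \<otimes>\<^bsub>presented_group gens rels\<^esub> d) = class_val c \<otimes>\<^bsub>V2\<^esub> class_val d"
      unfolding uv(2,4) presented_mult[OF uv(1,3) rels_words]
      using uv by (simp add: class_val abs_pgroup_append V2_mult)
  qed
  have "inj_on class_val (carrier (presented_group gens rels))"
  proof (rule inj_onI)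
    fix c d assume "c \<in> carrier (presented_group gens rels)" "d \<in> carrier (presented_group gens rels)"
      and eq: "class_val c = class_val d"
    then obtain u v where uv: "u \<in> words gens" "c = word_cong gens rels `` {u}"
      "v \<in> words gens" "d = word_cong gens rels `` {v}" unfolding carrier by blast
    have "(u, v) \<in> word_cong gens rels"
      using eq uv by (simp add: class_val Rep_cperm_inject realize_inject abs_pgroup_eq_iff)
    thus "c = d" unfolding uv by (auto intro: word_cong.sym word_cong.trans)
  qed
  moreover have "class_val ` carrier (presented_group gens rels) = carrier V2"
  proof
    show "class_val ` carrier (presented_group gens rels) \<subseteq> carrier V2" using hom by (auto simp: hom_def)
    show "carrier V2 \<subseteq> class_val ` carrier (presented_group gens rels)"
    proof
      fix x assume "x \<in> carrier V2"
      then obtain g where g: "x = Rep_cperm (realize g)" unfolding V2_carrier_realize by blast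
      obtain w where w: "w \<in> words gens" "g = abs_pgroup w" by (rule abs_pgroup_surj)
      hence "x = class_val (word_cong gens rels `` {w})" by (simp add: g class_val)
      thus "x \<in> class_val ` carrier (presented_group gens rels)" unfolding carrier using w(1) by blast
    qed
  qed
  ultimately have "class_val \<in> iso (presented_group gens rels) V2"
    using hom by (simp add: iso_def bij_betw_def)
  moreover have val: "class_val (word_cong gens rels `` {[(x, True)]}) = gen_val x" if "x \<in> gens" for x
    using that by (simp add: class_val realize_abs gen_val_eq)
  moreover have "gen_val \<in> gens \<rightarrow> carrier V2"
  proof
    fix x assume "x \<in> gens"
    hence "gen_val x = Rep_cperm (realize (abs_pgroup [(x, True)]))" by (simp add: realize_abs gen_val_eq)
    thus "gen_val x \<in> carrier V2" unfolding V2_carrier_realize by blast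
  qed
  ultimately show ?thesis unfolding is_presentation_def using group_V2 rels_words by blast
qed

end
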